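(* There is a universal constant $C>0$ such that for every $n\ge 1$ and every centrally symmetric convex body $K\subset\mathbb{R}^n$ in isotropic position with $\mathrm{Vol}(K)=\mathrm{Vol}(D_n)$, $$L_K\le C\,\frac{T_2(X_K)}{M_2(K)}.$$
   Context: $D_n$ is the Euclidean unit ball of $\mathbb{R}^n$ and $\sigma$ is the Haar probability measure on $S^{n-1}$. A convex body is a compact convex set with non-empty interior; it is centrally symmetric if $K=-K$. A centrally symmetric convex body $K\subset\mathbb{R}^n$ is in isotropic position if $\int_K\langle x,\theta\rangle^2dx$ is the same for all $\theta\in S^{n-1}$. Every such body has an invertible linear image of volume 1 in isotropic position, unique up to rotation; $L_K$ is the number with $\int_{K'}\langle x,\theta\rangle^2dx=L_K^2$ for all $\theta\in S^{n-1}$, where $K'$ is such an image of $K$. $\|\cdot\|_K$ is the norm with unit ball $K$, $X_K=(\mathbb{R}^n,\|\cdot\|_K)$, and $M_2(K)=\left(\int_{S^{n-1}}\|x\|_K^2\,d\sigma(x)\right)^{1/2}$. The (Gaussian) type-2 constant $T_2(X)$ of $X=(\mathbb{R}^n,\|\cdot\|)$ is the minimal $T>0$ such that $\left(\mathbb{E}\left\|\sum_{i=1}^m g_ix_i\right\|^2\right)^{1/2}\le T\left(\sum_{i=1}^m\|x_i\|^2\right)^{1/2}$ for all $m\ge1$ and $x_1,\dots,x_m\in X$, where $g_1,\dots,g_m$ are independent real standard Gaussian random variables. *)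

theory Defs
  imports "HOL-Probability.Probability"
begin

text \<open>
  The constant in the theorem is uniform in the dimension, so \<open>n\<close> has to be a term and not a type:
  \<open>\<real>\<^sup>n\<close> is the set \<open>Rn n\<close> of extensional functions on \<open>{..<n}\<close>. This is the
  carrier both of the library's product topology \<open>powertop_real {..<n}\<close> and of the library's
  product measure \<open>Pi\<^sub>M {..<n} (\<lambda>_. lborel)\<close>, which here are the Euclidean topology and
  Lebesgue measure.
\<close>

definition Rn :: "nat \<Rightarrow> (nat \<Rightarrow> real) set" where
  "Rn n = {..<n} \<rightarrow>\<^sub>E UNIV"

definition vadd :: "nat \<Rightarrow> (nat \<Rightarrow> real) \<Rightarrow> (nat \<Rightarrow> real) \<Rightarrow> nat \<Rightarrow> real" where
  "vadd n x y = (\<lambda>j\<in>{..<n}. x j + y j)"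

definition vscale :: "nat \<Rightarrow> real \<Rightarrow> (nat \<Rightarrow> real) \<Rightarrow> nat \<Rightarrow> real" where
  "vscale n a x = (\<lambda>j\<in>{..<n}. a * x j)"

definition dotp :: "nat \<Rightarrow> (nat \<Rightarrow> real) \<Rightarrow> (nat \<Rightarrow> real) \<Rightarrow> real" where
  "dotp n x y = (\<Sum>j<n. x j * y j)"

definition unit_ball :: "nat \<Rightarrow> (nat \<Rightarrow> real) set" where
  "unit_ball n = {x \<in> Rn n. dotp n x x \<le> 1}"

definition unit_sphere :: "nat \<Rightarrow> (nat \<Rightarrow> real) set" where
  "unit_sphere n = {x \<in> Rn n. dotp n x x = 1}"

definition leb :: "nat \<Rightarrow> (nat \<Rightarrow> real) measure" where
  "leb n = Pi\<^sub>M {..<n} (\<lambda>_. lborel)"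

definition vol :: "nat \<Rightarrow> (nat \<Rightarrow> real) set \<Rightarrow> real" where
  "vol n K = measure (leb n) K"

definition linear_Rn :: "nat \<Rightarrow> ((nat \<Rightarrow> real) \<Rightarrow> nat \<Rightarrow> real) \<Rightarrow> bool" where
  "linear_Rn n T \<longleftrightarrow> T \<in> Rn n \<rightarrow> Rn n \<and>
     (\<forall>x\<in>Rn n. \<forall>y\<in>Rn n. T (vadd n x y) = vadd n (T x) (T y)) \<and>
     (\<forall>a. \<forall>x\<in>Rn n. T (vscale n a x) = vscale n a (T x))"

definition invertible_linear_Rn :: "nat \<Rightarrow> ((nat \<Rightarrow> real) \<Rightarrow> nat \<Rightarrow> real) \<Rightarrow> bool" where
  "invertible_linear_Rn n T \<longleftrightarrow> linear_Rn n T \<and> bij_betw T (Rn n) (Rn n)"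

definition orthogonal_Rn :: "nat \<Rightarrow> ((nat \<Rightarrow> real) \<Rightarrow> nat \<Rightarrow> real) \<Rightarrow> bool" where
  "orthogonal_Rn n U \<longleftrightarrow> linear_Rn n U \<and>
     (\<forall>x\<in>Rn n. \<forall>y\<in>Rn n. dotp n (U x) (U y) = dotp n x y)"

definition convex_body :: "nat \<Rightarrow> (nat \<Rightarrow> real) set \<Rightarrow> bool" where
  "convex_body n K \<longleftrightarrow>
     compactin (powertop_real {..<n}) K \<and>
     (\<forall>x\<in>K. \<forall>y\<in>K. \<forall>t\<in>{0..1}. vadd n (vscale n (1 - t) x) (vscale n t y) \<in> K) \<and>
     powertop_real {..<n} interior_of K \<noteq> {}"

definition centrally_symmetric :: "nat \<Rightarrow> (nat \<Rightarrow> real) set \<Rightarrow> bool" where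
  "centrally_symmetric n K \<longleftrightarrow> vscale n (-1) ` K = K"

definition isotropic_position :: "nat \<Rightarrow> (nat \<Rightarrow> real) set \<Rightarrow> bool" where
  "isotropic_position n K \<longleftrightarrow>
     (\<exists>c. \<forall>\<theta>\<in>unit_sphere n. (LINT x:K|leb n. (dotp n x \<theta>)\<^sup>2) = c)"

definition isotropic_constant :: "nat \<Rightarrow> (nat \<Rightarrow> real) set \<Rightarrow> real" where
  "isotropic_constant n K = (THE L. 0 < L \<and>
     (\<exists>T. invertible_linear_Rn n T \<and> vol n (T ` K) = 1 \<and> isotropic_position n (T ` K) \<and>
          (\<forall>\<theta>\<in>unit_sphere n. (LINT x:T ` K|leb n. (dotp n x \<theta>)\<^sup>2) = L\<^sup>2)))"

text \<open>The norm with unit ball \<open>K\<close>, i.e. the Minkowski functional of \<open>K\<close>.\<close>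

definition body_norm :: "nat \<Rightarrow> (nat \<Rightarrow> real) set \<Rightarrow> (nat \<Rightarrow> real) \<Rightarrow> real" where
  "body_norm n K x = Inf {t. 0 < t \<and> x \<in> vscale n t ` K}"

text \<open>
  Invariance is required under the full orthogonal group; for \<open>n = 1\<close> the group \<open>SO(1)\<close> is trivial
  and would not determine the measure.
\<close>

definition haar_sphere :: "nat \<Rightarrow> (nat \<Rightarrow> real) measure" where
  "haar_sphere n = (THE \<sigma>. prob_space \<sigma> \<and>
     space \<sigma> = unit_sphere n \<and>
     sets \<sigma> = sets (restrict_space (leb n) (unit_sphere n)) \<and>
     (\<forall>U. orthogonal_Rn n U \<longrightarrow> (\<forall>A\<in>sets \<sigma>. emeasure \<sigma> (U ` A) = emeasure \<sigma> A)))"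

definition M2 :: "nat \<Rightarrow> (nat \<Rightarrow> real) set \<Rightarrow> real" where
  "M2 n K = sqrt (LINT x|haar_sphere n. (body_norm n K x)\<^sup>2)"

definition std_gaussian :: "nat \<Rightarrow> (nat \<Rightarrow> real) measure" where
  "std_gaussian m = Pi\<^sub>M {..<m} (\<lambda>_. density lborel (\<lambda>t. ennreal (std_normal_density t)))"

text \<open>
  The independent standard Gaussians \<open>g\<^sub>1, \<dots>, g\<^sub>m\<close> are the coordinates on the product space
  \<open>std_gaussian m\<close>, indexed by \<open>{..<m}\<close>.
\<close>

definition type2_constant :: "nat \<Rightarrow> ((nat \<Rightarrow> real) \<Rightarrow> real) \<Rightarrow> real" where
  "type2_constant n N = (LEAST T. 0 < T \<and>
     (\<forall>m\<ge>1. \<forall>x. (\<forall>i<m. x i \<in> Rn n) \<longrightarrow>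
        sqrt (LINT g|std_gaussian m. (N (\<lambda>j\<in>{..<n}. \<Sum>i<m. g i * x i j))\<^sup>2)
          \<le> T * sqrt (\<Sum>i<m. (N (x i))\<^sup>2)))"

end

theory Submission
  imports Defs
begin

text \<open>
  If \<open>\<integral>\<^sub>K x x\<^sup>T dx / vol(K) = \<mu> I\<close>, then approximating the integral by finite sums shows
  that \<open>\<mu> I\<close> is, up to a small error, a combination \<open>\<Sum> p\<^sub>i x\<^sub>i x\<^sub>i\<^sup>T\<close> with \<open>x\<^sub>i \<in> K\<close> and
  \<open>\<Sum> p\<^sub>i = 1\<close>; the error is repaired exactly by finitely many rank-one matrices of small weight.
  The Gaussian vector \<open>\<Sum> g\<^sub>i \<surd>p\<^sub>i x\<^sub>i\<close> then has the law of \<open>\<surd>\<mu> G\<close> with \<open>G\<close> standard, and as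
  the norms of the \<open>x\<^sub>i\<close> are at most 1, the type-2 inequality gives
  \<open>\<mu> E N(G)\<^sup>2 = \<mu> n M\<^sub>2(K)\<^sup>2 \<le> T\<^sub>2\<^sup>2\<close>. Finally \<open>L\<^sub>K\<^sup>2 = \<mu> vol(K)\<^bsup>-2/n\<^esup>\<close>, and the ball contains a
  cube of side \<open>2 / \<surd>n\<close>, so \<open>L\<^sub>K\<^sup>2 \<le> \<mu> n / 4\<close>.
\<close>

section \<open>Lebesgue measure on \<open>Rn n\<close>\<close>

text \<open>The statement rests on \<open>THE\<close> and \<open>LEAST\<close>, so its quantities
  must first be shown to exist: \<open>haar_sphere\<close> through a Gaussian model and a uniqueness
  proof, \<open>isotropic_constant\<close> through the rigidity of isotropic position,
  \<open>type2_constant\<close> as an attained infimum. This takes most of the text. As the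
  dimension is a term, vectors are functions, and determinants are replaced by uniqueness of
  translation-invariant measures: an invertible linear map multiplies volume by some constant, which
  is then found by testing a single set. The covariance must be repaired exactly, because the
  Gaussian sum is identified with a multiple of \<open>G\<close> by completing orthonormal rows,
  which tolerates no error. The repair may be wasteful, however: its cost depends on the cubes
  inside and outside \<open>K\<close>, but it is proportional to the mesh of the discretization and
  disappears in the limit. Hence only crude comparisons of the norm with Euclidean length are ever
  required.\<close>

lemma space_leb [simp]: "space (leb n) = Rn n"
  by (simp add: leb_def space_PiM Rn_def)

lemma sets_leb [measurable_cong]: "sets (leb n) = sets (Pi\<^sub>M {..<n} (\<lambda>_. borel))"
  unfolding leb_def by (rule sets_PiM_cong) auto

interpretation lborel_family: product_sigma_finite "\<lambda>_::nat. lborel :: real measure"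
  by standard

lemma sigma_finite_leb: "sigma_finite_measure (leb n)"
  unfolding leb_def by (rule lborel_family.sigma_finite) simp

lemma emeasure_leb_PiE:
  assumes "\<And>i. i < n \<Longrightarrow> A i \<in> sets borel"
  shows "emeasure (leb n) (Pi\<^sub>E {..<n} A) = (\<Prod>i<n. emeasure lborel (A i))"
  unfolding leb_def using assms by (intro lborel_family.emeasure_PiM) auto

lemma leb_eqI:
  assumes "sets \<mu> = sets (leb n)"
    and "\<And>A. (\<And>i. i < n \<Longrightarrow> A i \<in> sets borel) \<Longrightarrow>
           emeasure \<mu> (Pi\<^sub>E {..<n} A) = (\<Prod>i<n. emeasure lborel (A i))"
  shows "\<mu> = leb n"
  unfolding leb_def by (rule lborel_family.PiM_eqI) (use assms in \<open>auto simp: leb_def\<close>)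

lemma Rn_iff: "x \<in> Rn n \<longleftrightarrow> x \<in> extensional {..<n}"
  by (simp add: Rn_def PiE_def)

lemma Rn_eqI: "x \<in> Rn n \<Longrightarrow> y \<in> Rn n \<Longrightarrow> (\<And>j. j < n \<Longrightarrow> x j = y j) \<Longrightarrow> x = y"
  by (auto simp: Rn_iff intro: extensionalityI)

lemma restrict_Rn [simp]: "restrict f {..<n} \<in> Rn n"
  by (simp add: Rn_iff)

lemma vadd_Rn [simp]: "vadd n x y \<in> Rn n"
  by (simp add: vadd_def)

lemma vscale_Rn [simp]: "vscale n a x \<in> Rn n"
  by (simp add: vscale_def)

lemma vadd_nth [simp]: "j < n \<Longrightarrow> vadd n x y j = x j + y j"
  by (simp add: vadd_def)

lemma vscale_nth [simp]: "j < n \<Longrightarrow> vscale n a x j = a * x j"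
  by (simp add: vscale_def)

lemma vscale_one [simp]: "x \<in> Rn n \<Longrightarrow> vscale n 1 x = x"
  by (rule Rn_eqI[of _ n]) auto

lemma vscale_vscale [simp]: "vscale n a (vscale n b x) = vscale n (a * b) x"
  by (rule Rn_eqI[of _ n]) auto

lemma dotp_vadd [simp]: "dotp n (vadd n x y) z = dotp n x z + dotp n y z"
  "dotp n z (vadd n x y) = dotp n z x + dotp n z y"
  by (simp_all add: dotp_def algebra_simps sum.distrib)

lemma dotp_vscale [simp]: "dotp n (vscale n a x) z = a * dotp n x z"
  "dotp n z (vscale n a x) = a * dotp n z x"
  by (simp_all add: dotp_def algebra_simps sum_distrib_left)

lemma dotp_commute: "dotp n x y = dotp n y x"
  by (simp add: dotp_def mult.commute)

lemma dotp_self_nonneg [simp]: "0 \<le> dotp n x x"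
  by (simp add: dotp_def sum_nonneg)

lemma dotp_self_eq_0: "dotp n x x = 0 \<Longrightarrow> j < n \<Longrightarrow> x j = 0"
  by (auto simp: dotp_def sum_nonneg_eq_0_iff)

lemma nth_square_le_dotp: "j < n \<Longrightarrow> (x j)\<^sup>2 \<le> dotp n x x"
  unfolding dotp_def power2_eq_square
  by (rule member_le_sum[of j "{..<n}" "\<lambda>j. x j * x j"]) auto

lemma component_leb_measurable [measurable]: "j < n \<Longrightarrow> (\<lambda>x. x j) \<in> borel_measurable (leb n)"
  by (simp add: measurable_cong_sets[OF sets_leb refl] measurable_component_singleton)

lemma measurable_leb_restrict:
  assumes "\<And>j. j < n \<Longrightarrow> (\<lambda>x. f x j) \<in> borel_measurable M"
  shows "(\<lambda>x. \<lambda>j\<in>{..<n}. f x j) \<in> M \<rightarrow>\<^sub>M leb n"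
  unfolding measurable_cong_sets[OF refl sets_leb]
  using assms by (intro measurable_restrict) auto

lemma component_measurable: "f \<in> M \<rightarrow>\<^sub>M leb n \<Longrightarrow> j < n \<Longrightarrow> (\<lambda>x. f x j) \<in> borel_measurable M"
  by (rule measurable_compose[OF _ component_leb_measurable])

lemma vadd_measurable [measurable]:
  "f \<in> M \<rightarrow>\<^sub>M leb n \<Longrightarrow> g \<in> M \<rightarrow>\<^sub>M leb n \<Longrightarrow> (\<lambda>x. vadd n (f x) (g x)) \<in> M \<rightarrow>\<^sub>M leb n"
  unfolding vadd_def
  by (rule measurable_leb_restrict) (intro borel_measurable_add component_measurable; assumption)

lemma vscale_measurable [measurable]:
  "a \<in> borel_measurable M \<Longrightarrow> g \<in> M \<rightarrow>\<^sub>M leb n \<Longrightarrow> (\<lambda>x. vscale n (a x) (g x)) \<in> M \<rightarrow>\<^sub>M leb n"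
  unfolding vscale_def
  by (rule measurable_leb_restrict)
    (rule borel_measurable_times, assumption, rule component_measurable; assumption)

lemma dotp_measurable [measurable]:
  "f \<in> M \<rightarrow>\<^sub>M leb n \<Longrightarrow> g \<in> M \<rightarrow>\<^sub>M leb n \<Longrightarrow> (\<lambda>x. dotp n (f x) (g x)) \<in> borel_measurable M"
  unfolding dotp_def
  by (intro borel_measurable_sum borel_measurable_times component_measurable) auto

text \<open>Cubes are the standard test sets below: the product measure gives their volume in closed
  form, and the volume of the ball is only estimated through them.\<close>

definition cube :: "nat \<Rightarrow> real \<Rightarrow> (nat \<Rightarrow> real) set" where
  "cube n a = {..<n} \<rightarrow>\<^sub>E {-a..a}"

lemma cube_iff: "x \<in> cube n a \<longleftrightarrow> x \<in> Rn n \<and> (\<forall>j<n. \<bar>x j\<bar> \<le> a)"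
proof -
  have "t \<in> {-a..a} \<longleftrightarrow> \<bar>t\<bar> \<le> a" for t by (auto simp: abs_le_iff)
  thus ?thesis unfolding cube_def Rn_def PiE_iff by auto
qed

lemma cube_sets [measurable, simp]: "cube n a \<in> sets (leb n)"
  unfolding cube_def sets_leb by (rule sets_PiM_I_finite) auto

lemma emeasure_cube: "0 \<le> a \<Longrightarrow> emeasure (leb n) (cube n a) = ennreal ((2 * a) ^ n)"
  unfolding cube_def by (subst emeasure_leb_PiE) (auto simp: ennreal_power)

lemma distr_leb_vadd:
  assumes "a \<in> Rn n" shows "distr (leb n) (leb n) (vadd n a) = leb n"
proof (rule leb_eqI)
  fix A :: "nat \<Rightarrow> real set" assume A: "\<And>i. i < n \<Longrightarrow> A i \<in> sets borel"
  have "emeasure (distr (leb n) (leb n) (vadd n a)) (Pi\<^sub>E {..<n} A)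
      = emeasure (leb n) (vadd n a -` (Pi\<^sub>E {..<n} A) \<inter> space (leb n))"
  proof (rule emeasure_distr)
    show "vadd n a \<in> leb n \<rightarrow>\<^sub>M leb n" using assms by simp
    show "Pi\<^sub>E {..<n} A \<in> sets (leb n)" unfolding sets_leb using A by (intro sets_PiM_I_finite) auto
  qed
  also have "vadd n a -` (Pi\<^sub>E {..<n} A) \<inter> space (leb n) = Pi\<^sub>E {..<n} (\<lambda>i. (+) (a i) -` A i)"
    by (rule set_eqI) (simp add: PiE_iff Rn_iff[symmetric] conj_commute)
  also have "emeasure (leb n) \<dots> = (\<Prod>i<n. emeasure lborel ((+) (a i) -` A i))"
  proof (rule emeasure_leb_PiE)
    show "(+) (a i) -` A i \<in> sets borel" if "i < n" for i
      using measurable_sets[of "(+) (a i)" borel borel "A i"] A[OF that] by simp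
  qed
  also have "\<dots> = (\<Prod>i<n. emeasure (distr lborel borel ((+) (a i))) (A i))"
    using A by (intro prod.cong refl) (subst emeasure_distr, auto)
  also have "\<dots> = (\<Prod>i<n. emeasure lborel (A i))"
    by (simp add: lborel_distr_plus)
  finally show "emeasure (distr (leb n) (leb n) (vadd n a)) (Pi\<^sub>E {..<n} A) = \<dots>" .
qed simp

text \<open>
  Uniqueness of Haar measure on the group \<open>Rn n\<close>: with \<open>Q\<close> the centred unit cube, Fubini and the two
  invariances turn \<open>\<integral>\<integral> 1\<^sub>A(x) 1\<^sub>Q(y)\<close> into \<open>\<integral>\<integral> 1\<^sub>A(x + y) 1\<^sub>Q(y)\<close>, then into
  \<open>\<integral>\<integral> 1\<^sub>A(y) 1\<^sub>Q(y - x)\<close>, and finally, as \<open>Q = -Q\<close>, into \<open>\<nu>(Q) leb(A)\<close>.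
\<close>
lemma translation_invariant_eq_leb:
  assumes sets [measurable_cong, simp]: "sets \<nu> = sets (leb n)" and sf: "sigma_finite_measure \<nu>"
    and inv: "\<And>a. a \<in> Rn n \<Longrightarrow> distr \<nu> \<nu> (vadd n a) = \<nu>"
  shows "\<nu> = density (leb n) (\<lambda>_. emeasure \<nu> (cube n (1/2)))"
proof (rule measure_eqI)
  fix A assume "A \<in> sets \<nu>"
  hence A [measurable]: "A \<in> sets (leb n)" by simp
  define Q where "Q = cube n (1/2)"
  have Q [measurable]: "Q \<in> sets (leb n)" by (simp add: Q_def)
  have Q1: "emeasure (leb n) Q = 1" by (simp add: Q_def emeasure_cube)
  interpret P: pair_sigma_finite \<nu> "leb n"
    using sf sigma_finite_leb by (simp add: pair_sigma_finite_def)
  have sp: "space \<nu> = Rn n" using sets_eq_imp_space_eq[OF sets] by simp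
  have trn: "(\<integral>\<^sup>+x. f (vadd n a x) \<partial>\<nu>) = (\<integral>\<^sup>+x. f x \<partial>\<nu>)"
    if [measurable]: "f \<in> borel_measurable (leb n)" and a: "a \<in> Rn n" for f a
  proof -
    have "vadd n a \<in> \<nu> \<rightarrow>\<^sub>M \<nu>" using a by (simp add: measurable_cong_sets[OF sets sets])
    hence "(\<integral>\<^sup>+x. f x \<partial>distr \<nu> \<nu> (vadd n a)) = (\<integral>\<^sup>+x. f (vadd n a x) \<partial>\<nu>)"
      by (rule nn_integral_distr) (simp add: measurable_cong_sets[OF sets refl] that)
    thus ?thesis by (simp add: inv[OF a])
  qed
  have trl: "(\<integral>\<^sup>+x. f (vadd n a x) \<partial>leb n) = (\<integral>\<^sup>+x. f x \<partial>leb n)"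
    if [measurable]: "f \<in> borel_measurable (leb n)" and a: "a \<in> Rn n" for f a
  proof -
    have "vadd n a \<in> leb n \<rightarrow>\<^sub>M leb n" using a by simp
    hence "(\<integral>\<^sup>+x. f x \<partial>distr (leb n) (leb n) (vadd n a)) = (\<integral>\<^sup>+x. f (vadd n a x) \<partial>leb n)"
      by (rule nn_integral_distr) (simp add: that)
    thus ?thesis by (simp add: distr_leb_vadd[OF a])
  qed
  have iAv: "(\<lambda>x. indicator A (vadd n (f x) (g x)) :: ennreal) \<in> borel_measurable M"
    "(\<lambda>x. indicator Q (vadd n (vscale n (-1) (f x)) (g x)) :: ennreal) \<in> borel_measurable M"
    if "f \<in> M \<rightarrow>\<^sub>M leb n" "g \<in> M \<rightarrow>\<^sub>M leb n" for f g and M :: "'b measure"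
    using that by (auto intro!: measurable_compose[OF _ borel_measurable_indicator[OF A]]
      measurable_compose[OF _ borel_measurable_indicator[OF Q]])
  have fs: "fst \<in> \<nu> \<Otimes>\<^sub>M leb n \<rightarrow>\<^sub>M leb n" "snd \<in> \<nu> \<Otimes>\<^sub>M leb n \<rightarrow>\<^sub>M leb n"
    using measurable_fst[of \<nu> "leb n"] by (simp_all add: measurable_cong_sets[OF refl sets])
  have mA: "(\<lambda>p. indicator Q (snd p) * indicator A (vadd n (snd p) (fst p)) :: ennreal)
      \<in> borel_measurable (\<nu> \<Otimes>\<^sub>M leb n)"
    by (rule borel_measurable_times_ennreal[OF measurable_compose[OF fs(2) borel_measurable_indicator[OF Q]]
          iAv(1)[OF fs(2) fs(1)]])
  have mA1: "(\<lambda>y. indicator Q y * indicator A (vadd n y x) :: ennreal) \<in> borel_measurable (leb n)"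
    if "x \<in> Rn n" for x
    by (rule borel_measurable_times_ennreal[OF borel_measurable_indicator[OF Q] iAv(1)]) (use that in simp_all)
  have mQ: "(\<lambda>p. indicator Q (vadd n (vscale n (-1) (fst p)) (snd p)) * indicator A (snd p) :: ennreal)
      \<in> borel_measurable (\<nu> \<Otimes>\<^sub>M leb n)"
    by (rule borel_measurable_times_ennreal[OF iAv(2)[OF fs(1) fs(2)]
          measurable_compose[OF fs(2) borel_measurable_indicator[OF A]]])
  have "emeasure \<nu> A = (\<integral>\<^sup>+y. indicator Q y * emeasure \<nu> A \<partial>leb n)"
    by (simp add: nn_integral_multc Q1)
  also have "\<dots> = (\<integral>\<^sup>+y. (\<integral>\<^sup>+x. indicator Q y * indicator A (vadd n y x) \<partial>\<nu>) \<partial>leb n)"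
  proof (rule nn_integral_cong)
    fix y assume "y \<in> space (leb n)"
    hence y: "y \<in> Rn n" by simp
    have "(\<integral>\<^sup>+x. indicator Q y * indicator A (vadd n y x) \<partial>\<nu>)
        = indicator Q y * (\<integral>\<^sup>+x. indicator A (vadd n y x) \<partial>\<nu>)"
      using y by (intro nn_integral_cmult iAv(1)) (simp_all add: sp)
    also have "(\<integral>\<^sup>+x. indicator A (vadd n y x) \<partial>\<nu>) = ((\<integral>\<^sup>+x. indicator A x \<partial>\<nu>) :: ennreal)"
      using y by (intro trn) simp_all
    finally show "indicator Q y * emeasure \<nu> A = (\<integral>\<^sup>+x. indicator Q y * indicator A (vadd n y x) \<partial>\<nu>)"
      by simp
  qed
  also have "\<dots> = (\<integral>\<^sup>+x. (\<integral>\<^sup>+y. indicator Q y * indicator A (vadd n y x) \<partial>leb n) \<partial>\<nu>)"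
    using mA by (intro P.Fubini'[of "\<lambda>x y. indicator Q y * indicator A (vadd n y x)"])
      (simp add: case_prod_beta')
  also have "\<dots> = (\<integral>\<^sup>+x. (\<integral>\<^sup>+y. indicator Q (vadd n (vscale n (-1) x) y) * indicator A y \<partial>leb n) \<partial>\<nu>)"
  proof (rule nn_integral_cong)
    fix x assume "x \<in> space \<nu>"
    hence x: "x \<in> Rn n" by (simp add: sp)
    have "(\<integral>\<^sup>+y. indicator Q y * indicator A (vadd n y x) \<partial>leb n) =
        (\<integral>\<^sup>+y. indicator Q (vadd n (vscale n (-1) x) y)
           * indicator A (vadd n (vadd n (vscale n (-1) x) y) x) \<partial>leb n)"
      using x mA1[OF x] by (intro trl[symmetric, of "\<lambda>y. indicator Q y * indicator A (vadd n y x)"]) auto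
    also have "\<dots> = (\<integral>\<^sup>+y. indicator Q (vadd n (vscale n (-1) x) y) * indicator A y \<partial>leb n)"
    proof (rule nn_integral_cong)
      fix y assume "y \<in> space (leb n)"
      hence "vadd n (vadd n (vscale n (-1) x) y) x = y"
        by (intro Rn_eqI) auto
      thus "indicator Q (vadd n (vscale n (-1) x) y) * indicator A (vadd n (vadd n (vscale n (-1) x) y) x)
        = (indicator Q (vadd n (vscale n (-1) x) y) * indicator A y :: ennreal)" by simp
    qed
    finally show "(\<integral>\<^sup>+y. indicator Q y * indicator A (vadd n y x) \<partial>leb n) = \<dots>" .
  qed
  also have "\<dots> = (\<integral>\<^sup>+y. (\<integral>\<^sup>+x. indicator Q (vadd n (vscale n (-1) x) y) * indicator A y \<partial>\<nu>) \<partial>leb n)"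
    using mQ by (intro P.Fubini'[of "\<lambda>x y. indicator Q (vadd n (vscale n (-1) x) y) * indicator A y",
        symmetric]) (simp add: case_prod_beta')
  also have "\<dots> = (\<integral>\<^sup>+y. emeasure \<nu> Q * indicator A y \<partial>leb n)"
  proof (rule nn_integral_cong)
    fix y assume "y \<in> space (leb n)"
    hence y: "y \<in> Rn n" by simp
    have "(\<integral>\<^sup>+x. indicator Q (vadd n (vscale n (-1) x) y) * indicator A y \<partial>\<nu>)
        = (\<integral>\<^sup>+x. indicator Q (vadd n (vscale n (-1) y) x) * indicator A y \<partial>\<nu>)"
      by (rule nn_integral_cong) (auto simp: Q_def cube_iff indicator_def abs_minus_commute)
    also have "\<dots> = (\<integral>\<^sup>+x. indicator Q x * indicator A y \<partial>\<nu>)"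
      using y Q by (intro trn[of "\<lambda>x. indicator Q x * indicator A y"]) auto
    also have "\<dots> = emeasure \<nu> Q * indicator A y"
      by (subst nn_integral_multc) (auto simp: Q)
    finally show "(\<integral>\<^sup>+x. indicator Q (vadd n (vscale n (-1) x) y) * indicator A y \<partial>\<nu>)
      = emeasure \<nu> Q * indicator A y" .
  qed
  finally show "emeasure \<nu> A = emeasure (density (leb n) (\<lambda>_. emeasure \<nu> (cube n (1/2)))) A"
    by (simp add: emeasure_density Q_def)
qed simp

section \<open>Linear maps\<close>

definition unit_vec :: "nat \<Rightarrow> nat \<Rightarrow> nat \<Rightarrow> real" where
  "unit_vec n j = (\<lambda>i\<in>{..<n}. if i = j then 1 else 0)"

lemma unit_vec_Rn [simp]: "unit_vec n j \<in> Rn n"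
  by (simp add: unit_vec_def)

lemma unit_vec_nth [simp]: "i < n \<Longrightarrow> unit_vec n j i = (if i = j then 1 else 0)"
  by (simp add: unit_vec_def)

lemma dotp_unit_vec [simp]: "j < n \<Longrightarrow> dotp n x (unit_vec n j) = x j" "j < n \<Longrightarrow> dotp n (unit_vec n j) x = x j"
  by (simp_all add: dotp_def if_distrib[of "\<lambda>t. t * _"] if_distrib[of "\<lambda>t. _ * t"] cong: if_cong)

lemma linear_RnD:
  assumes "linear_Rn n T"
  shows "x \<in> Rn n \<Longrightarrow> T x \<in> Rn n"
    and "x \<in> Rn n \<Longrightarrow> y \<in> Rn n \<Longrightarrow> T (vadd n x y) = vadd n (T x) (T y)"
    and "x \<in> Rn n \<Longrightarrow> T (vscale n a x) = vscale n a (T x)"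
  using assms by (auto simp: linear_Rn_def)

lemma linear_Rn_expand:
  assumes T: "linear_Rn n T" and x: "x \<in> Rn n" and j: "j < n"
  shows "T x j = (\<Sum>i<n. x i * T (unit_vec n i) j)"
proof -
  \<comment> \<open>\<open>tr k\<close> keeps the first \<open>k\<close> coordinates and sets the
    rest to zero, so each induction step adds one multiple of a unit vector.\<close>
  define tr where "tr k = (\<lambda>i\<in>{..<n}. if i < k then x i else 0)" for k
  have "k \<le> n \<Longrightarrow> T (tr k) j = (\<Sum>i<k. x i * T (unit_vec n i) j)" for k
  proof (induction k)
    case 0
    have "tr 0 = vscale n 0 x" by (rule Rn_eqI[of _ n]) (auto simp: tr_def)
    thus ?case using linear_RnD(3)[OF T x, of 0] j by simp
  next
    case (Suc k)
    have "tr (Suc k) = vadd n (tr k) (vscale n (x k) (unit_vec n k))"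
      by (rule Rn_eqI[of _ n]) (use Suc.prems in \<open>auto simp: tr_def less_Suc_eq\<close>)
    hence "T (tr (Suc k)) = vadd n (T (tr k)) (vscale n (x k) (T (unit_vec n k)))"
      by (simp add: linear_RnD(2,3)[OF T] tr_def)
    thus ?case using Suc j by simp
  qed
  from this[of n] have "T (tr n) j = (\<Sum>i<n. x i * T (unit_vec n i) j)" by simp
  moreover have "tr n = x" by (rule Rn_eqI[of _ n]) (use x in \<open>auto simp: tr_def\<close>)
  ultimately show ?thesis by simp
qed

lemma linear_Rn_eqI:
  assumes "linear_Rn n T" "linear_Rn n U" "x \<in> Rn n"
    and "\<And>i. i < n \<Longrightarrow> T (unit_vec n i) = U (unit_vec n i)"
  shows "T x = U x"
  by (rule Rn_eqI[of _ n]) (use assms in \<open>simp_all add: linear_RnD(1) linear_Rn_expand\<close>)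

lemma linear_Rn_measurable:
  assumes T: "linear_Rn n T" shows "T \<in> leb n \<rightarrow>\<^sub>M leb n"
proof -
  have "(\<lambda>x. \<lambda>j\<in>{..<n}. \<Sum>i<n. x i * T (unit_vec n i) j) \<in> leb n \<rightarrow>\<^sub>M leb n"
    by (intro measurable_leb_restrict borel_measurable_sum borel_measurable_times) auto
  moreover have "T x = (\<lambda>j\<in>{..<n}. \<Sum>i<n. x i * T (unit_vec n i) j)" if "x \<in> space (leb n)" for x
    by (rule Rn_eqI[of _ n]) (use that T in \<open>auto simp: linear_RnD(1) linear_Rn_expand\<close>)
  ultimately show ?thesis by (subst measurable_cong) auto
qed

definition transpose_Rn :: "nat \<Rightarrow> ((nat \<Rightarrow> real) \<Rightarrow> nat \<Rightarrow> real) \<Rightarrow> (nat \<Rightarrow> real) \<Rightarrow> nat \<Rightarrow> real" where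
  "transpose_Rn n T y = (\<lambda>i\<in>{..<n}. dotp n (T (unit_vec n i)) y)"

lemma dotp_transpose:
  assumes "linear_Rn n T" "x \<in> Rn n"
  shows "dotp n (T x) y = dotp n x (transpose_Rn n T y)"
proof -
  have "dotp n (T x) y = (\<Sum>j<n. \<Sum>i<n. x i * (T (unit_vec n i) j * y j))"
    unfolding dotp_def using assms
    by (simp add: linear_Rn_expand sum_distrib_left sum_distrib_right mult_ac)
  also have "\<dots> = (\<Sum>i<n. \<Sum>j<n. x i * (T (unit_vec n i) j * y j))" by (rule sum.swap)
  also have "\<dots> = dotp n x (transpose_Rn n T y)"
    by (simp add: transpose_Rn_def dotp_def sum_distrib_left)
  finally show ?thesis .
qed

lemma linear_transpose: "linear_Rn n (transpose_Rn n T)"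
  unfolding linear_Rn_def by (auto simp: transpose_Rn_def intro!: Rn_eqI[of _ n])

text \<open>The sum of the absolute values of all matrix entries serves as \<open>b\<close>. This
  will make pushforwards of \<open>leb n\<close> finite on cubes.\<close>

lemma linear_Rn_cube:
  assumes T: "linear_Rn n T"
  shows "\<exists>b\<ge>0. \<forall>x a. x \<in> cube n a \<longrightarrow> 0 \<le> a \<longrightarrow> T x \<in> cube n (a * b)"
proof (intro exI conjI allI impI)
  define b where "b = (\<Sum>i<n. \<Sum>j<n. \<bar>T (unit_vec n i) j\<bar>)"
  show "0 \<le> b" by (auto simp: b_def intro!: sum_nonneg)
  fix x a assume x: "x \<in> cube n a" and a: "0 \<le> a"
  have "\<bar>T x j\<bar> \<le> a * b" if j: "j < n" for j
  proof -
    have "\<bar>T x j\<bar> \<le> (\<Sum>i<n. \<bar>x i * T (unit_vec n i) j\<bar>)"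
      using x j T by (simp add: cube_iff linear_Rn_expand sum_abs)
    also have "\<dots> \<le> (\<Sum>i<n. a * (\<Sum>j<n. \<bar>T (unit_vec n i) j\<bar>))"
    proof (rule sum_mono)
      fix i assume i: "i \<in> {..<n}"
      have "\<bar>T (unit_vec n i) j\<bar> \<le> (\<Sum>j<n. \<bar>T (unit_vec n i) j\<bar>)"
        using j by (intro member_le_sum[of j "{..<n}" "\<lambda>j. \<bar>T (unit_vec n i) j\<bar>"]) auto
      thus "\<bar>x i * T (unit_vec n i) j\<bar> \<le> a * (\<Sum>j<n. \<bar>T (unit_vec n i) j\<bar>)"
        using x i a unfolding abs_mult by (intro mult_mono) (auto simp: cube_iff)
    qed
    finally show ?thesis by (simp add: b_def sum_distrib_left)
  qed
  thus "T x \<in> cube n (a * b)" using x T by (auto simp: cube_iff linear_RnD(1))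
qed

text \<open>The inverse is carried along explicitly so that an image under \<open>T\<close> can be
  rewritten as a preimage under \<open>S\<close>, the form in which measurability and pushforward
  measures apply.\<close>

definition linear_inverses ::
    "nat \<Rightarrow> ((nat \<Rightarrow> real) \<Rightarrow> nat \<Rightarrow> real) \<Rightarrow> ((nat \<Rightarrow> real) \<Rightarrow> nat \<Rightarrow> real) \<Rightarrow> bool" where
  "linear_inverses n T S \<longleftrightarrow> linear_Rn n T \<and> linear_Rn n S \<and> (\<forall>x\<in>Rn n. S (T x) = x \<and> T (S x) = x)"

lemma linear_inversesD:
  assumes "linear_inverses n T S"
  shows "linear_Rn n T" "linear_Rn n S" "x \<in> Rn n \<Longrightarrow> S (T x) = x" "x \<in> Rn n \<Longrightarrow> T (S x) = x"
    "x \<in> Rn n \<Longrightarrow> T x \<in> Rn n" "x \<in> Rn n \<Longrightarrow> S x \<in> Rn n"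
  using assms by (auto simp: linear_inverses_def linear_Rn_def)

lemma linear_inverses_bij:
  assumes "linear_inverses n T S" shows "invertible_linear_Rn n T"
  unfolding invertible_linear_Rn_def
  by (intro conjI bij_betwI[of _ _ _ S]) (use linear_inversesD[OF assms] in auto)

lemma invertible_linear_inverses:
  assumes "invertible_linear_Rn n T" obtains S where "linear_inverses n T S"
proof -
  define S where "S = inv_into (Rn n) T"
  have T: "linear_Rn n T" and b: "bij_betw T (Rn n) (Rn n)"
    using assms by (auto simp: invertible_linear_Rn_def)
  have ST: "S (T x) = x" "T (S x) = x" "S x \<in> Rn n" if "x \<in> Rn n" for x
    using b that by (auto simp: S_def bij_betw_def inv_into_into f_inv_into_f)
  have "linear_Rn n S"
    unfolding linear_Rn_def
  proof (intro conjI ballI allI)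
    show "S \<in> Rn n \<rightarrow> Rn n" using ST by auto
    fix x y a assume x: "x \<in> Rn n"
    have "vscale n a x = T (vscale n a (S x))" using x ST by (simp add: linear_RnD[OF T])
    thus "S (vscale n a x) = vscale n a (S x)" using ST by simp
    assume y: "y \<in> Rn n"
    have "vadd n x y = T (vadd n (S x) (S y))" using x y ST by (simp add: linear_RnD[OF T])
    thus "S (vadd n x y) = vadd n (S x) (S y)" using ST by simp
  qed
  with T ST have "linear_inverses n T S" by (simp add: linear_inverses_def)
  thus ?thesis by (rule that)
qed

section \<open>Volume and integrals under invertible linear maps\<close>

lemma linear_image_eq_vimage:
  assumes "linear_inverses n T S" "A \<subseteq> Rn n"
  shows "T ` A = S -` A \<inter> Rn n"
proof (intro set_eqI iffI)
  fix x assume "x \<in> T ` A"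
  thus "x \<in> S -` A \<inter> Rn n" using linear_inversesD[OF assms(1)] assms(2) by auto
next
  fix x assume "x \<in> S -` A \<inter> Rn n"
  thus "x \<in> T ` A" using linear_inversesD(4)[OF assms(1), of x] by (metis IntD1 IntD2 image_eqI vimageD)
qed

lemma linear_image_sets:
  assumes "linear_inverses n T S" "A \<in> sets (leb n)"
  shows "T ` A \<in> sets (leb n)"
proof -
  have "A \<subseteq> Rn n" using sets.sets_into_space[OF assms(2)] by simp
  thus ?thesis
    using measurable_sets[OF linear_Rn_measurable[OF linear_inversesD(2)[OF assms(1)]] assms(2)]
    by (simp add: linear_image_eq_vimage[OF assms(1)])
qed

text \<open>The factor \<open>d\<close> is |det T|, obtained without determinants: the pushforward
  by \<open>S\<close> is translation invariant because \<open>S\<close> is additive, it is finite on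
  cubes, and so it is a constant multiple of \<open>leb n\<close>.\<close>

lemma distr_leb_linear:
  assumes TS: "linear_inverses n T S"
  obtains d :: real where "0 \<le> d" "distr (leb n) (leb n) S = density (leb n) (\<lambda>_. ennreal d)"
proof -
  note T = linear_inversesD(1)[OF TS] and S = linear_inversesD(2)[OF TS]
  define \<nu> where "\<nu> = distr (leb n) (leb n) S"
  have Sm: "S \<in> leb n \<rightarrow>\<^sub>M leb n" by (rule linear_Rn_measurable[OF S])
  have sets: "sets \<nu> = sets (leb n)" and space: "space \<nu> = Rn n" by (simp_all add: \<nu>_def)
  obtain b where b: "b \<ge> 0" "\<And>x a. x \<in> cube n a \<Longrightarrow> 0 \<le> a \<Longrightarrow> T x \<in> cube n (a * b)"
    using linear_Rn_cube[OF T] by blast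
  have fin: "emeasure \<nu> (cube n a) < \<infinity>" if a: "0 \<le> a" for a
  proof -
    have "emeasure \<nu> (cube n a) = emeasure (leb n) (T ` cube n a)"
      unfolding \<nu>_def by (subst emeasure_distr[OF Sm])
        (auto simp: linear_image_eq_vimage[OF TS] cube_iff subset_eq)
    also have "\<dots> \<le> emeasure (leb n) (cube n (a * b))"
      using b(2) a by (intro emeasure_mono) auto
    also have "\<dots> < \<infinity>" using a b(1) by (simp add: emeasure_cube)
    finally show ?thesis .
  qed
  have "sigma_finite_measure \<nu>"
  proof
    show "\<exists>A. countable A \<and> A \<subseteq> sets \<nu> \<and> \<Union>A = space \<nu> \<and> (\<forall>a\<in>A. emeasure \<nu> a \<noteq> \<infinity>)"
    proof (intro exI[of _ "range (\<lambda>k::nat. cube n (real k))"] conjI ballI)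
      show "\<Union>(range (\<lambda>k::nat. cube n (real k))) = space \<nu>"
      proof (intro equalityI subsetI)
        fix x assume "x \<in> space \<nu>"
        hence x: "x \<in> Rn n" by (simp add: space)
        obtain k :: nat where k: "(\<Sum>j<n. \<bar>x j\<bar>) \<le> real k" using real_arch_simple by blast
        have "\<bar>x j\<bar> \<le> real k" if "j < n" for j
          using member_le_sum[of j "{..<n}" "\<lambda>j. \<bar>x j\<bar>"] that k by simp
        thus "x \<in> \<Union>(range (\<lambda>k::nat. cube n (real k)))" using x by (auto simp: cube_iff)
      qed (auto simp: space cube_iff)
    qed (use fin in \<open>auto simp: sets less_top\<close>)
  qed
  moreover have "distr \<nu> \<nu> (vadd n a) = \<nu>" if a: "a \<in> Rn n" for a
  proof -
    have [simp]: "T a \<in> Rn n" using a linear_inversesD(5)[OF TS] by simp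
    have m: "vadd n c \<in> leb n \<rightarrow>\<^sub>M leb n" if "c \<in> Rn n" for c using that by simp
    have "distr \<nu> \<nu> (vadd n a) = distr (leb n) (leb n) (vadd n a \<circ> S)"
      unfolding \<nu>_def using distr_distr[OF m[OF a] Sm]
      by (metis distr_cong sets_distr)
    \<comment> \<open>Translating by \<open>a\<close> after \<open>S\<close> is translating by
      \<open>T a\<close> before it.\<close>
    also have "\<dots> = distr (leb n) (leb n) (S \<circ> vadd n (T a))"
      using a by (intro distr_cong refl) (simp add: linear_RnD[OF S] linear_inversesD[OF TS])
    also have "\<dots> = distr (distr (leb n) (leb n) (vadd n (T a))) (leb n) S"
      by (rule distr_distr[OF Sm m, symmetric]) simp
    also have "\<dots> = \<nu>" by (simp add: distr_leb_vadd \<nu>_def)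
    finally show ?thesis .
  qed
  ultimately have \<nu>: "\<nu> = density (leb n) (\<lambda>_. emeasure \<nu> (cube n (1/2)))"
    by (rule translation_invariant_eq_leb[OF sets])
  have c: "emeasure \<nu> (cube n (1/2)) = ennreal (enn2real (emeasure \<nu> (cube n (1/2))))"
    using fin[of "1/2"] by (simp add: less_top)
  show ?thesis
    by (rule that[of "enn2real (emeasure \<nu> (cube n (1/2)))"])
      (rule enn2real_nonneg, subst c[symmetric], subst \<nu>_def[symmetric], rule \<nu>)
qed

lemma emeasure_linear_image:
  assumes TS: "linear_inverses n T S" and d: "distr (leb n) (leb n) S = density (leb n) (\<lambda>_. ennreal d)"
    and A: "A \<in> sets (leb n)"
  shows "emeasure (leb n) (T ` A) = ennreal d * emeasure (leb n) A"
proof -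
  have "emeasure (leb n) (T ` A) = emeasure (distr (leb n) (leb n) S) A"
    using sets.sets_into_space[OF A]
    by (subst emeasure_distr) (simp_all add: linear_image_eq_vimage[OF TS] A
        linear_Rn_measurable[OF linear_inversesD(2)[OF TS]])
  thus ?thesis using A by (simp add: d emeasure_density_const)
qed

lemma integral_linear_image:
  fixes f :: "(nat \<Rightarrow> real) \<Rightarrow> real"
  assumes TS: "linear_inverses n T S" and d: "distr (leb n) (leb n) S = density (leb n) (\<lambda>_. ennreal d)"
    and d0: "0 \<le> d" and A: "A \<in> sets (leb n)" and f: "f \<in> borel_measurable (leb n)"
  shows "(LINT x:T ` A|leb n. f x) = d * (LINT x:A|leb n. f (T x))"
proof -
  note T = linear_Rn_measurable[OF linear_inversesD(1)[OF TS]]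
    and S = linear_Rn_measurable[OF linear_inversesD(2)[OF TS]]
  have AR: "A \<subseteq> Rn n" using sets.sets_into_space[OF A] by simp
  have m: "(\<lambda>x. indicator A x *\<^sub>R f (T x)) \<in> borel_measurable (leb n)"
    by (intro borel_measurable_scaleR borel_measurable_indicator[OF A] measurable_compose[OF T f])
  have "(LINT x:T ` A|leb n. f x) = (LINT x|leb n. indicator A (S x) *\<^sub>R f (T (S x)))"
    unfolding set_lebesgue_integral_def linear_image_eq_vimage[OF TS AR]
    by (rule Bochner_Integration.integral_cong) (auto simp: indicator_def linear_inversesD[OF TS])
  also have "\<dots> = (LINT x|distr (leb n) (leb n) S. indicator A x *\<^sub>R f (T x))"
    by (rule integral_distr[OF S m, symmetric])
  also have "\<dots> = (LINT x|leb n. d *\<^sub>R (indicator A x *\<^sub>R f (T x)))"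
    unfolding d by (rule integral_density) (use m d0 in auto)
  also have "\<dots> = d * (LINT x:A|leb n. f (T x))"
    by (simp add: set_lebesgue_integral_def)
  finally show ?thesis .
qed

section \<open>Orthogonal maps\<close>

lemma unit_ball_sets [measurable, simp]: "unit_ball n \<in> sets (leb n)"
proof -
  have "{x \<in> space (leb n). dotp n x x \<le> 1} \<in> sets (leb n)" by measurable
  thus ?thesis by (simp add: unit_ball_def)
qed

lemma unit_sphere_sets [measurable, simp]: "unit_sphere n \<in> sets (leb n)"
proof -
  have "{x \<in> space (leb n). dotp n x x = 1} \<in> sets (leb n)" by measurable
  thus ?thesis by (simp add: unit_sphere_def)
qed

lemma dotp_le_cube:
  assumes "x \<in> cube n a" shows "dotp n x x \<le> n * a\<^sup>2"
proof -
  have "x j * x j \<le> a\<^sup>2" if "j < n" for j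
    using assms that by (auto simp: cube_iff power2_eq_square[symmetric] intro: abs_le_square_iff[THEN iffD1] order_trans)
      (metis abs_ge_self abs_le_square_iff order_trans)
  hence "dotp n x x \<le> (\<Sum>j<n. a\<^sup>2)" unfolding dotp_def by (intro sum_mono) auto
  thus ?thesis by simp
qed

lemma cube_subset_unit_ball: "cube n (1 / sqrt n) \<subseteq> unit_ball n"
proof
  fix x assume x: "x \<in> cube n (1 / sqrt n)"
  have "dotp n x x \<le> n * (1 / sqrt n)\<^sup>2" by (rule dotp_le_cube[OF x])
  also have "\<dots> \<le> 1" by (simp add: power_divide)
  finally show "x \<in> unit_ball n" using x by (simp add: unit_ball_def cube_iff)
qed

lemma unit_ball_subset_cube: "unit_ball n \<subseteq> cube n 1"
proof
  fix x assume x: "x \<in> unit_ball n"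
  have "\<bar>x j\<bar> \<le> 1" if "j < n" for j
    using nth_square_le_dotp[OF that, of x] x by (auto simp: unit_ball_def intro!: abs_le_square_iff[THEN iffD2, of _ 1, simplified])
  thus "x \<in> cube n 1" using x by (simp add: unit_ball_def cube_iff)
qed

text \<open>The lower bound, from the inscribed cube, later bounds the rescaling of \<open>K\<close>
  to volume 1; here it also shows that the ball is not a null set.\<close>

lemma emeasure_unit_ball:
  "ennreal ((2 / sqrt n) ^ n) \<le> emeasure (leb n) (unit_ball n)" "emeasure (leb n) (unit_ball n) < \<infinity>"
proof -
  have "ennreal ((2 * (1 / sqrt n)) ^ n) = emeasure (leb n) (cube n (1 / sqrt n))"
    by (rule emeasure_cube[symmetric]) simp
  also have "\<dots> \<le> emeasure (leb n) (unit_ball n)"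
    by (rule emeasure_mono[OF cube_subset_unit_ball]) simp
  finally show "ennreal ((2 / sqrt n) ^ n) \<le> emeasure (leb n) (unit_ball n)" by simp
  have "emeasure (leb n) (unit_ball n) \<le> emeasure (leb n) (cube n 1)"
    by (rule emeasure_mono[OF unit_ball_subset_cube]) simp
  also have "\<dots> < \<infinity>" by (simp add: emeasure_cube)
  finally show "emeasure (leb n) (unit_ball n) < \<infinity>" .
qed

text \<open>\<open>orthogonal_Rn\<close> speaks only of preserved inner products. With the inverse
  as part of the data, \<open>W\<close> is at once the adjoint of \<open>V\<close>.\<close>

definition orthogonal_inverses ::
    "nat \<Rightarrow> ((nat \<Rightarrow> real) \<Rightarrow> nat \<Rightarrow> real) \<Rightarrow> ((nat \<Rightarrow> real) \<Rightarrow> nat \<Rightarrow> real) \<Rightarrow> bool" where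
  "orthogonal_inverses n V W \<longleftrightarrow> linear_inverses n V W \<and>
     (\<forall>x\<in>Rn n. \<forall>y\<in>Rn n. dotp n (V x) (V y) = dotp n x y)"

lemma orthogonal_inversesD:
  assumes "orthogonal_inverses n V W"
  shows "linear_inverses n V W" "x \<in> Rn n \<Longrightarrow> W (V x) = x" "x \<in> Rn n \<Longrightarrow> V (W x) = x"
    "x \<in> Rn n \<Longrightarrow> V x \<in> Rn n" "x \<in> Rn n \<Longrightarrow> W x \<in> Rn n"
    "x \<in> Rn n \<Longrightarrow> y \<in> Rn n \<Longrightarrow> dotp n (V x) (V y) = dotp n x y"
  using assms linear_inversesD[of n V W] by (auto simp: orthogonal_inverses_def)

lemma orthogonal_inverses_sym:
  assumes "orthogonal_inverses n V W" shows "orthogonal_inverses n W V"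
  using orthogonal_inversesD[OF assms] linear_inversesD[of n V W]
  unfolding orthogonal_inverses_def linear_inverses_def by metis

lemma orthogonal_inverses_dotp:
  assumes "orthogonal_inverses n V W" "x \<in> Rn n" "y \<in> Rn n"
  shows "dotp n (V x) y = dotp n x (W y)"
  using orthogonal_inversesD[OF assms(1)] assms(2,3) by metis

lemma orthogonal_inverses_id: "orthogonal_inverses n (\<lambda>x. x) (\<lambda>x. x)"
  by (auto simp: orthogonal_inverses_def linear_inverses_def linear_Rn_def)

lemma orthogonal_inverses_comp:
  assumes "orthogonal_inverses n V W" "orthogonal_inverses n V' W'"
  shows "orthogonal_inverses n (\<lambda>x. V (V' x)) (\<lambda>x. W' (W x))"
  using assms unfolding orthogonal_inverses_def linear_inverses_def linear_Rn_def
  by (simp add: Pi_iff)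

lemma orthogonal_inverses_Rn:
  assumes "orthogonal_inverses n V W" shows "orthogonal_Rn n V"
  using assms by (auto simp: orthogonal_inverses_def linear_inverses_def orthogonal_Rn_def)

text \<open>Since \<open>t / 0 = 0\<close>, this is the identity for \<open>v = 0\<close>.\<close>
definition reflection :: "nat \<Rightarrow> (nat \<Rightarrow> real) \<Rightarrow> (nat \<Rightarrow> real) \<Rightarrow> nat \<Rightarrow> real" where
  "reflection n v x = vadd n x (vscale n (- (2 * dotp n x v / dotp n v v)) v)"

lemma reflection_orthogonal: "orthogonal_inverses n (reflection n v) (reflection n v)"
proof -
  have "linear_Rn n (reflection n v)"
    unfolding linear_Rn_def
    by (auto simp: reflection_def algebra_simps add_divide_distrib intro!: Rn_eqI[of _ n])
  moreover have "reflection n v (reflection n v x) = x" if "x \<in> Rn n" for x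
    using that by (cases "dotp n v v = 0")
      (auto simp: reflection_def field_simps intro!: Rn_eqI[of _ n])
  moreover have "dotp n (reflection n v x) (reflection n v y) = dotp n x y" for x y
    by (cases "dotp n v v = 0")
      (auto simp: reflection_def dotp_commute[of n v y] field_simps)
  ultimately show ?thesis by (simp add: orthogonal_inverses_def linear_inverses_def)
qed

lemma reflection_fixes: "x \<in> Rn n \<Longrightarrow> dotp n x v = 0 \<Longrightarrow> reflection n v x = x"
  by (auto simp: reflection_def intro!: Rn_eqI[of _ n])

text \<open>For \<open>v\<close> = x - y and equal lengths, <v,v> = 2 <x,v>, so the reflection
  subtracts exactly \<open>v\<close> from \<open>x\<close>. For \<open>v\<close> = 0 it is the
  identity and x = y.\<close>

lemma reflection_swaps:
  assumes x: "x \<in> Rn n" and y: "y \<in> Rn n" and eq: "dotp n x x = dotp n y y"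
  shows "reflection n (vadd n x (vscale n (-1) y)) x = y"
proof (rule Rn_eqI[of _ n])
  fix j assume j: "j < n"
  define v where "v = vadd n x (vscale n (-1) y)"
  have vv: "dotp n v v = 2 * dotp n x v"
    using eq by (simp add: v_def algebra_simps dotp_commute[of n y x])
  show "reflection n (vadd n x (vscale n (-1) y)) x j = y j"
  proof (cases "dotp n v v = 0")
    case True
    with dotp_self_eq_0[OF True j] j show ?thesis
      by (simp add: reflection_def v_def[symmetric]) (simp add: v_def)
  next
    case False
    thus ?thesis using vv j by (simp add: reflection_def v_def[symmetric]) (simp add: v_def)
  qed
qed (use y in \<open>simp_all add: reflection_def\<close>)

text \<open>A completion by reflections instead of Gram-Schmidt: pull the new vector back by
  \<open>W\<close> to \<open>u\<close>, which is orthogonal to the unit vectors already placed, and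
  compose \<open>V\<close> with the reflection that takes the next unit vector to \<open>u\<close>.
  This reflection fixes the earlier unit vectors. The bound on \<open>k\<close> comes out of the
  same induction.\<close>

lemma extend_orthonormal:
  assumes "\<And>j. j < k \<Longrightarrow> r j \<in> Rn m"
    and "\<And>i j. i < k \<Longrightarrow> j < k \<Longrightarrow> dotp m (r i) (r j) = (if i = j then 1 else 0)"
  shows "k \<le> m \<and> (\<exists>V W. orthogonal_inverses m V W \<and> (\<forall>j<k. V (unit_vec m j) = r j))"
  using assms
proof (induction k)
  case 0
  show ?case using orthogonal_inverses_id by auto
next
  case (Suc k)
  then obtain V W where km: "k \<le> m" and VW: "orthogonal_inverses m V W"
    and Vr: "\<And>j. j < k \<Longrightarrow> V (unit_vec m j) = r j"
    by (metis less_SucI)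
  define u where "u = W (r k)"
  have rk: "r k \<in> Rn m" using Suc.prems(1) by simp
  have u: "u \<in> Rn m" using orthogonal_inversesD[OF VW] rk by (simp add: u_def)
  have uu: "dotp m u u = 1"
    using orthogonal_inversesD(6)[OF orthogonal_inverses_sym[OF VW] rk rk] Suc.prems(2)[of k k]
    by (simp add: u_def)
  have uj: "u j = 0" if "j < k" for j
  proof -
    have "u j = dotp m (unit_vec m j) u" using that km by simp
    also have "\<dots> = dotp m (r j) (r k)"
      using orthogonal_inverses_dotp[OF VW unit_vec_Rn rk, of j] Vr[OF that] by (simp add: u_def)
    also have "\<dots> = 0" using Suc.prems(2)[of j k] that by simp
    finally show ?thesis .
  qed
  \<comment> \<open>If no free coordinate were left, all coordinates of the unit vector
    \<open>u\<close> would vanish.\<close>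
  have "k \<noteq> m"
  proof
    assume "k = m"
    hence "dotp m u u = 0" by (simp add: dotp_def uj)
    thus False using uu by simp
  qed
  hence km': "k < m" using km by simp
  define H where "H = reflection m (vadd m (unit_vec m k) (vscale m (-1) u))"
  have H: "orthogonal_inverses m H H" unfolding H_def by (rule reflection_orthogonal)
  have "V (H (unit_vec m j)) = r j" if j: "j < Suc k" for j
  proof (cases "j = k")
    case True
    have "H (unit_vec m k) = u" unfolding H_def
      by (rule reflection_swaps) (use u uu km' in auto)
    thus ?thesis using True orthogonal_inversesD(3)[OF VW rk] by (simp add: u_def)
  next
    case False
    hence "j < k" using j by simp
    moreover have "H (unit_vec m j) = unit_vec m j"
      unfolding H_def by (rule reflection_fixes) (use \<open>j < k\<close> km' uj in auto)
    ultimately show ?thesis using Vr by simp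
  qed
  thus ?case using km' orthogonal_inverses_comp[OF VW H] by (metis Suc_leI)
qed

text \<open>The images of the unit vectors are orthonormal; completing them yields an invertible map
  that agrees with \<open>U\<close> on a basis, hence on \<open>Rn n\<close>. Invertibility thus
  needs no dimension theory.\<close>

lemma orthogonal_RnE:
  assumes U: "orthogonal_Rn n U"
  obtains V W where "orthogonal_inverses n V W" "\<And>x. x \<in> Rn n \<Longrightarrow> U x = V x"
proof -
  have lin: "linear_Rn n U" using U by (simp add: orthogonal_Rn_def)
  have "\<exists>V W. orthogonal_inverses n V W \<and> (\<forall>j<n. V (unit_vec n j) = U (unit_vec n j))"
    using extend_orthonormal[of n "\<lambda>j. U (unit_vec n j)" n] U
    by (auto simp: orthogonal_Rn_def linear_RnD(1)[OF lin])
  then obtain V W where VW: "orthogonal_inverses n V W"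
    and eq: "\<And>j. j < n \<Longrightarrow> V (unit_vec n j) = U (unit_vec n j)" by blast
  have "U x = V x" if "x \<in> Rn n" for x
    by (rule linear_Rn_eqI[OF lin _ that]) (use VW eq in \<open>auto dest: orthogonal_inversesD(1) linear_inversesD(1)\<close>)
  with VW that show ?thesis by blast
qed

lemma orthogonal_image_unit_ball:
  assumes VW: "orthogonal_inverses n V W" shows "V ` unit_ball n = unit_ball n"
proof (intro equalityI subsetI)
  fix x assume "x \<in> V ` unit_ball n"
  thus "x \<in> unit_ball n" using orthogonal_inversesD[OF VW] by (auto simp: unit_ball_def)
next
  fix x assume "x \<in> unit_ball n"
  hence "V (W x) = x" "W x \<in> unit_ball n"
    using orthogonal_inversesD[OF VW] orthogonal_inversesD(6)[OF orthogonal_inverses_sym[OF VW]]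
    by (auto simp: unit_ball_def)
  thus "x \<in> V ` unit_ball n" by (metis image_eqI)
qed

text \<open>The pushforward is a multiple of \<open>leb n\<close>, and the ball, which is preserved
  and has positive finite volume, forces the factor 1.\<close>

lemma distr_leb_orthogonal:
  assumes VW: "orthogonal_inverses n V W" shows "distr (leb n) (leb n) V = leb n"
proof -
  have WV: "orthogonal_inverses n W V" by (rule orthogonal_inverses_sym[OF VW])
  obtain d where d: "0 \<le> d" "distr (leb n) (leb n) V = density (leb n) (\<lambda>_. ennreal d)"
    using distr_leb_linear[OF orthogonal_inversesD(1)[OF WV]] by blast
  have "emeasure (leb n) (unit_ball n) = ennreal d * emeasure (leb n) (unit_ball n)"
    using emeasure_linear_image[OF orthogonal_inversesD(1)[OF WV] d(2), of "unit_ball n"]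
    by (simp add: orthogonal_image_unit_ball[OF WV])
  moreover have "emeasure (leb n) (unit_ball n) \<noteq> 0"
  proof -
    have "0 < (2 / sqrt n) ^ n" by (cases "n = 0") auto
    hence "0 < ennreal ((2 / sqrt n) ^ n)" by simp
    thus ?thesis using emeasure_unit_ball(1)[of n] by (metis not_le)
  qed
  moreover obtain b where b: "0 \<le> b" "emeasure (leb n) (unit_ball n) = ennreal b"
    using emeasure_unit_ball(2)[of n] by (cases "emeasure (leb n) (unit_ball n)") auto
  ultimately have "b = d * b" "b \<noteq> 0"
    using d(1) by (simp_all add: ennreal_mult[symmetric])
  hence "d = 1" by simp
  thus ?thesis by (simp add: d(2) density_1)
qed

section \<open>Gaussian measure\<close>

lemma vscale_linear_inverses:
  "s \<noteq> 0 \<Longrightarrow> linear_inverses n (vscale n s) (vscale n (1 / s))"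
  by (auto simp: linear_inverses_def linear_Rn_def algebra_simps intro!: Rn_eqI[of _ n])

lemma vscale_image_cube:
  assumes "0 < s" shows "vscale n s ` cube n a = cube n (s * a)"
  using assms
  by (subst linear_image_eq_vimage[OF vscale_linear_inverses])
    (auto simp: cube_iff abs_mult field_simps)

text \<open>The unknown factor is read off from the unit cube.\<close>

lemma distr_leb_vscale:
  assumes s: "0 < s"
  shows "distr (leb n) (leb n) (vscale n (1 / s)) = density (leb n) (\<lambda>_. ennreal (s ^ n))"
proof -
  have TS: "linear_inverses n (vscale n s) (vscale n (1 / s))"
    using s by (intro vscale_linear_inverses) simp
  obtain d where d: "0 \<le> d" "distr (leb n) (leb n) (vscale n (1 / s)) = density (leb n) (\<lambda>_. ennreal d)"
    using distr_leb_linear[OF TS] by blast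
  have "ennreal (s ^ n) = ennreal d"
    using emeasure_linear_image[OF TS d(2), of "cube n (1/2)"] s
    by (simp add: vscale_image_cube emeasure_cube)
  thus ?thesis by (simp add: d(2))
qed

interpretation gaussian_family:
  product_prob_space "\<lambda>_::nat. density lborel (\<lambda>t. ennreal (std_normal_density t))" UNIV
  by (rule product_prob_spaceI) (rule prob_space_normal_density, simp)

lemma sets_std_gaussian [simp, measurable_cong]: "sets (std_gaussian n) = sets (leb n)"
  unfolding std_gaussian_def leb_def by (rule sets_PiM_cong) auto

lemma space_std_gaussian [simp]: "space (std_gaussian n) = Rn n"
  using sets_eq_imp_space_eq[OF sets_std_gaussian] by simp

text \<open>The product density is radial. Together with the invariance of \<open>leb n\<close> this
  is the source of rotation invariance of the Gaussian measure.\<close>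

lemma prod_std_normal_density:
  "(\<Prod>j<n. std_normal_density (x j)) = (1 / sqrt (2 * pi)) ^ n * exp (- dotp n x x / 2)"
  by (induction n) (simp_all add: std_normal_density_def dotp_def exp_add[symmetric] power2_eq_square
      add_divide_distrib diff_divide_distrib)

lemma gaussian_density_measurable [measurable]:
  "(\<lambda>x. \<Prod>j<n. std_normal_density (x j)) \<in> borel_measurable (leb n)"
  unfolding prod_std_normal_density by measurable

lemma std_gaussian_eq_density:
  "std_gaussian n = density (leb n) (\<lambda>x. ennreal (\<Prod>j<n. std_normal_density (x j)))" (is "_ = ?D")
proof -
  have "?D = Pi\<^sub>M {..<n} (\<lambda>_. density lborel (\<lambda>t. ennreal (std_normal_density t)))"
  proof (rule gaussian_family.PiM_eqI)
    show "sets ?D = sets (Pi\<^sub>M {..<n} (\<lambda>_. density lborel (\<lambda>t. ennreal (std_normal_density t))))"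
      using sets_std_gaussian[of n] by (simp add: std_gaussian_def)
    fix A :: "nat \<Rightarrow> real set"
    assume "\<And>i. i \<in> {..<n} \<Longrightarrow> A i \<in> sets (density lborel (\<lambda>t. ennreal (std_normal_density t)))"
    hence A: "\<And>i. i < n \<Longrightarrow> A i \<in> sets borel" by simp
    have "Pi\<^sub>E {..<n} A \<in> sets (leb n)" unfolding sets_leb using A by (intro sets_PiM_I_finite) auto
    hence "emeasure ?D (Pi\<^sub>E {..<n} A)
        = (\<integral>\<^sup>+x. ennreal (\<Prod>j<n. std_normal_density (x j)) * indicator (Pi\<^sub>E {..<n} A) x \<partial>leb n)"
      by (subst emeasure_density) auto
    also have "\<dots> = (\<integral>\<^sup>+x. (\<Prod>j<n. ennreal (std_normal_density (x j)) * indicator (A j) (x j)) \<partial>leb n)"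
    proof (rule nn_integral_cong)
      fix x assume "x \<in> space (leb n)"
      hence "indicator (Pi\<^sub>E {..<n} A) x = (\<Prod>j<n. indicator (A j) (x j) :: ennreal)"
        by (auto simp: indicator_def PiE_iff Rn_iff prod_zero_iff split: if_splits)
      thus "ennreal (\<Prod>j<n. std_normal_density (x j)) * indicator (Pi\<^sub>E {..<n} A) x
          = (\<Prod>j<n. ennreal (std_normal_density (x j)) * indicator (A j) (x j))"
        by (simp add: prod.distrib prod_ennreal)
    qed
    also have "\<dots> = (\<Prod>j<n. \<integral>\<^sup>+t. ennreal (std_normal_density t) * indicator (A j) t \<partial>lborel)"
      unfolding leb_def
      by (rule lborel_family.product_nn_integral_prod) (use A in auto)
    also have "\<dots> = (\<Prod>j<n. emeasure (density lborel (\<lambda>t. ennreal (std_normal_density t))) (A j))"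
      using A by (intro prod.cong refl) (simp add: emeasure_density)
    finally show "emeasure ?D (Pi\<^sub>E {..<n} A)
      = (\<Prod>j\<in>{..<n}. emeasure (density lborel (\<lambda>t. ennreal (std_normal_density t))) (A j))" .
  qed simp
  thus ?thesis by (simp add: std_gaussian_def)
qed

lemma distr_std_gaussian_orthogonal:
  assumes VW: "orthogonal_inverses n V W"
  shows "distr (std_gaussian n) (leb n) V = std_gaussian n"
proof (rule measure_eqI)
  have V: "V \<in> leb n \<rightarrow>\<^sub>M leb n"
    by (intro linear_Rn_measurable linear_inversesD(1)[OF orthogonal_inversesD(1)[OF VW]])
  hence V': "V \<in> std_gaussian n \<rightarrow>\<^sub>M leb n" by (simp add: measurable_cong_sets[OF sets_std_gaussian refl])
  fix A assume "A \<in> sets (distr (std_gaussian n) (leb n) V)"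
  hence A [measurable]: "A \<in> sets (leb n)" by simp
  let ?f = "\<lambda>x. ennreal (\<Prod>j<n. std_normal_density (x j))"
  have m: "(\<lambda>x. ?f x * indicator A x) \<in> borel_measurable (leb n)" by measurable
  have "emeasure (distr (std_gaussian n) (leb n) V) A = emeasure (std_gaussian n) (V -` A \<inter> Rn n)"
    by (subst emeasure_distr[OF V' A]) simp
  also have "\<dots> = (\<integral>\<^sup>+x. ?f x * indicator (V -` A \<inter> Rn n) x \<partial>leb n)"
    unfolding std_gaussian_eq_density
    using measurable_sets[OF V A] by (subst emeasure_density) auto
  also have "\<dots> = (\<integral>\<^sup>+x. ?f (V x) * indicator A (V x) \<partial>leb n)"
    by (rule nn_integral_cong)
      (auto simp: prod_std_normal_density orthogonal_inversesD[OF VW] indicator_def)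
  also have "\<dots> = (\<integral>\<^sup>+x. ?f x * indicator A x \<partial>distr (leb n) (leb n) V)"
    by (rule nn_integral_distr[OF V, symmetric]) (simp add: m)
  also have "\<dots> = emeasure (std_gaussian n) A"
    unfolding distr_leb_orthogonal[OF VW] std_gaussian_eq_density by (simp add: emeasure_density)
  finally show "emeasure (distr (std_gaussian n) (leb n) V) A = emeasure (std_gaussian n) A" .
qed simp

lemma distr_std_gaussian_restrict:
  assumes "n \<le> m"
  shows "distr (std_gaussian m) (leb n) (\<lambda>x. restrict x {..<n}) = std_gaussian n"
proof -
  have "std_gaussian n = distr (std_gaussian m) (std_gaussian n) (\<lambda>x. restrict x {..<n})"
    unfolding std_gaussian_def using assms by (intro gaussian_family.distr_restrict) auto
  also have "\<dots> = distr (std_gaussian m) (leb n) (\<lambda>x. restrict x {..<n})"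
    by (rule distr_cong) auto
  finally show ?thesis by simp
qed

lemma measurable_restrict_leb: "n \<le> m \<Longrightarrow> (\<lambda>x. restrict x {..<n}) \<in> leb m \<rightarrow>\<^sub>M leb n"
  by (rule measurable_leb_restrict) auto

text \<open>
  The rows of the matrix with columns \<open>x\<^sub>i / a\<close> are orthonormal; completing them to an orthogonal
  map of \<open>Rn m\<close> turns \<open>\<Sum> g\<^sub>i x\<^sub>i\<close> into the first \<open>n\<close> coordinates of a rotated Gaussian vector.
\<close>
lemma integral_gaussian_combination:
  fixes F :: "(nat \<Rightarrow> real) \<Rightarrow> real"
  assumes a: "0 < a"
    and cov: "\<And>j l. j < n \<Longrightarrow> l < n \<Longrightarrow> (\<Sum>i<m. x i j * x i l) = (if j = l then a\<^sup>2 else 0)"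
    and F: "F \<in> borel_measurable (leb n)"
  shows "(LINT g|std_gaussian m. F (\<lambda>j\<in>{..<n}. \<Sum>i<m. g i * x i j))
       = (LINT g|std_gaussian n. F (vscale n a g))"
proof -
  define r where "r j = (\<lambda>i\<in>{..<m}. x i j / a)" for j
  have rr: "dotp m (r i) (r j) = (if i = j then 1 else 0)" if "i < n" "j < n" for i j
  proof -
    have "dotp m (r i) (r j) = (\<Sum>k<m. x k i * x k j) / a\<^sup>2"
      by (simp add: dotp_def r_def power2_eq_square sum_divide_distrib)
    thus ?thesis using cov[OF that] a by simp
  qed
  have "n \<le> m \<and> (\<exists>V W. orthogonal_inverses m V W \<and> (\<forall>j<n. V (unit_vec m j) = r j))"
    using rr by (intro extend_orthonormal) (auto simp: r_def)
  then obtain V W where nm: "n \<le> m" and VW: "orthogonal_inverses m V W"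
    and Vr: "\<And>j. j < n \<Longrightarrow> V (unit_vec m j) = r j" by blast
  note WV = orthogonal_inverses_sym[OF VW]
  have W: "W \<in> std_gaussian m \<rightarrow>\<^sub>M leb m"
    using linear_Rn_measurable[OF linear_inversesD(1)[OF orthogonal_inversesD(1)[OF WV]]]
    by (simp add: measurable_cong_sets[OF sets_std_gaussian refl])
  have mr: "(\<lambda>g. restrict g {..<n}) \<in> leb m \<rightarrow>\<^sub>M leb n" by (rule measurable_restrict_leb[OF nm])
  have mr': "(\<lambda>g. restrict g {..<n}) \<in> std_gaussian m \<rightarrow>\<^sub>M leb n"
    using mr by (simp add: measurable_cong_sets[OF sets_std_gaussian refl])
  have Fa: "(\<lambda>g. F (vscale n a g)) \<in> borel_measurable (leb n)"
    by (rule measurable_compose[OF _ F]) measurable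
  have eq: "(\<lambda>j\<in>{..<n}. \<Sum>i<m. g i * x i j) = vscale n a (restrict (W g) {..<n})" if g: "g \<in> Rn m" for g
  proof (rule Rn_eqI[of _ n])
    fix j assume j: "j < n"
    have "W g j = dotp m (W g) (unit_vec m j)" using j nm by simp
    also have "\<dots> = dotp m g (r j)"
      using orthogonal_inverses_dotp[OF WV g unit_vec_Rn] Vr[OF j] by simp
    also have "a * \<dots> = (\<Sum>i<m. g i * x i j)"
      using a by (simp add: dotp_def r_def sum_distrib_left)
    finally show "(\<lambda>j\<in>{..<n}. \<Sum>i<m. g i * x i j) j = vscale n a (restrict (W g) {..<n}) j"
      using j by simp
  qed auto
  have "(LINT g|std_gaussian m. F (\<lambda>j\<in>{..<n}. \<Sum>i<m. g i * x i j))
      = (LINT g|std_gaussian m. F (vscale n a (restrict (W g) {..<n})))"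
    by (rule Bochner_Integration.integral_cong) (simp_all add: eq)
  also have "\<dots> = (LINT g|distr (std_gaussian m) (leb m) W. F (vscale n a (restrict g {..<n})))"
    by (rule integral_distr[OF W measurable_compose[OF mr Fa], symmetric])
  also have "\<dots> = (LINT g|std_gaussian m. F (vscale n a (restrict g {..<n})))"
    by (simp only: distr_std_gaussian_orthogonal[OF WV])
  also have "\<dots> = (LINT g|distr (std_gaussian m) (leb n) (\<lambda>x. restrict x {..<n}). F (vscale n a g))"
    by (rule integral_distr[OF mr' Fa, symmetric])
  also have "\<dots> = (LINT g|std_gaussian n. F (vscale n a g))"
    by (simp only: distr_std_gaussian_restrict[OF nm])
  finally show ?thesis .
qed

lemma std_gaussian_component:
  assumes "j < n"
  shows "integrable (std_gaussian n) (\<lambda>g. (g j)\<^sup>2)" "(LINT g|std_gaussian n. (g j)\<^sup>2) = 1"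
proof -
  let ?N = "density lborel (\<lambda>t. ennreal (std_normal_density t))"
  have d: "distr (std_gaussian n) ?N (\<lambda>g. g j) = ?N"
    unfolding std_gaussian_def using assms
    by (intro distr_PiM_component) (auto intro: prob_space_normal_density)
  have m: "(\<lambda>g. g j) \<in> std_gaussian n \<rightarrow>\<^sub>M ?N"
    using assms unfolding std_gaussian_def by (intro measurable_component_singleton) auto
  have "has_bochner_integral lborel (\<lambda>t. std_normal_density t * t\<^sup>2) 1"
    using std_normal_moment_even[of 1] by (simp add: fact_numeral)
  hence "has_bochner_integral ?N (\<lambda>t. t\<^sup>2) 1"
    by (subst has_bochner_integral_density) auto
  hence *: "has_bochner_integral (distr (std_gaussian n) ?N (\<lambda>g. g j)) (\<lambda>t. t\<^sup>2) 1" by (simp only: d)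
  have "integrable (distr (std_gaussian n) ?N (\<lambda>g. g j)) (\<lambda>t. t\<^sup>2)"
    using * by (rule integrable.intros)
  thus "integrable (std_gaussian n) (\<lambda>g. (g j)\<^sup>2)"
    by (rule integrable_distr[OF m])
  have "(LINT t|distr (std_gaussian n) ?N (\<lambda>g. g j). t\<^sup>2) = 1"
    using * by (rule has_bochner_integral_integral_eq)
  thus "(LINT g|std_gaussian n. (g j)\<^sup>2) = 1"
    by (subst (asm) integral_distr[OF m]) auto
qed

text \<open>A reflection takes a multiple of the first unit vector to \<open>a\<close>, so the inner
  product becomes a multiple of one Gaussian coordinate and no mixed moments occur.\<close>

lemma std_gaussian_dotp:
  assumes a: "a \<in> Rn n"
  shows "integrable (std_gaussian n) (\<lambda>g. (dotp n g a)\<^sup>2)"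
    "(LINT g|std_gaussian n. (dotp n g a)\<^sup>2) = dotp n a a"
proof -
  have "integrable (std_gaussian n) (\<lambda>g. (dotp n g a)\<^sup>2) \<and>
    (LINT g|std_gaussian n. (dotp n g a)\<^sup>2) = dotp n a a"
  proof (cases "n = 0")
    case True
    thus ?thesis by (simp add: dotp_def)
  next
    case False
    hence n: "0 < n" by simp
    define s where "s = sqrt (dotp n a a)"
    have ss: "s * s = dotp n a a" by (simp add: s_def)
    define b where "b = vscale n s (unit_vec n 0)"
    define V where "V = reflection n (vadd n b (vscale n (-1) a))"
    have V: "orthogonal_inverses n V V" unfolding V_def by (rule reflection_orthogonal)
    have Vb: "V b = a" unfolding V_def
      by (rule reflection_swaps) (use a n ss in \<open>auto simp: b_def\<close>)
    have Vm: "V \<in> std_gaussian n \<rightarrow>\<^sub>M leb n"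
      using linear_Rn_measurable[OF linear_inversesD(1)[OF orthogonal_inversesD(1)[OF V]]]
      by (simp add: measurable_cong_sets[OF sets_std_gaussian refl])
    have eq: "(dotp n g a)\<^sup>2 = s\<^sup>2 * (V g 0)\<^sup>2" if "g \<in> Rn n" for g
    proof -
      have "dotp n g a = s * V g 0"
        using orthogonal_inverses_dotp[OF V that, of b] n
        by (simp add: Vb) (simp add: b_def)
      thus ?thesis by (simp add: power_mult_distrib)
    qed
    have m: "(\<lambda>g. (g 0)\<^sup>2) \<in> borel_measurable (leb n)" using n by simp
    have i: "integrable (std_gaussian n) (\<lambda>g. (V g 0)\<^sup>2)"
      using std_gaussian_component(1)[OF n]
      by (subst (asm) distr_std_gaussian_orthogonal[OF V, symmetric]) (simp add: integrable_distr_eq[OF Vm m])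
    have "(LINT g|std_gaussian n. (V g 0)\<^sup>2) = 1"
      using std_gaussian_component(2)[OF n]
      by (subst (asm) distr_std_gaussian_orthogonal[OF V, symmetric]) (simp add: integral_distr[OF Vm m])
    hence "(LINT g|std_gaussian n. s\<^sup>2 * (V g 0)\<^sup>2) = dotp n a a"
      using ss by (simp add: power2_eq_square)
    moreover have "(LINT g|std_gaussian n. (dotp n g a)\<^sup>2) = (LINT g|std_gaussian n. s\<^sup>2 * (V g 0)\<^sup>2)"
      by (rule Bochner_Integration.integral_cong) (simp_all add: eq)
    moreover have "integrable (std_gaussian n) (\<lambda>g. (dotp n g a)\<^sup>2)
        \<longleftrightarrow> integrable (std_gaussian n) (\<lambda>g. s\<^sup>2 * (V g 0)\<^sup>2)"
      by (rule Bochner_Integration.integrable_cong) (simp_all add: eq)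
    ultimately show ?thesis using i by simp
  qed
  thus "integrable (std_gaussian n) (\<lambda>g. (dotp n g a)\<^sup>2)"
    "(LINT g|std_gaussian n. (dotp n g a)\<^sup>2) = dotp n a a" by auto
qed

lemma std_gaussian_dotp_self:
  "integrable (std_gaussian n) (\<lambda>g. dotp n g g)" "(LINT g|std_gaussian n. dotp n g g) = n"
  using std_gaussian_component[of _ n]
  by (auto simp: dotp_def power2_eq_square[symmetric])

text \<open>Coordinate \<open>j\<close> of the Gaussian sum is the inner product of \<open>g\<close>
  with row \<open>j\<close> of the matrix whose columns are the vectors \<open>x i\<close>. This is
  the type-2 identity of Euclidean space.\<close>

lemma std_gaussian_combination_square:
  shows "integrable (std_gaussian m) (\<lambda>g. \<Sum>j<n. (\<Sum>i<m. g i * x i j)\<^sup>2)"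
    and "(LINT g|std_gaussian m. (\<Sum>j<n. (\<Sum>i<m. g i * x i j)\<^sup>2)) = (\<Sum>i<m. dotp n (x i) (x i))"
proof -
  define r where "r j = (\<lambda>i\<in>{..<m}. x i j)" for j
  have eq: "(\<Sum>i<m. g i * x i j) = dotp m g (r j)" for g j by (simp add: dotp_def r_def)
  have r: "r j \<in> Rn m" for j by (simp add: r_def)
  show "integrable (std_gaussian m) (\<lambda>g. \<Sum>j<n. (\<Sum>i<m. g i * x i j)\<^sup>2)"
    unfolding eq using std_gaussian_dotp(1)[OF r] by auto
  have "(LINT g|std_gaussian m. (\<Sum>j<n. (\<Sum>i<m. g i * x i j)\<^sup>2)) = (\<Sum>j<n. dotp m (r j) (r j))"
    unfolding eq using std_gaussian_dotp[OF r] by simp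
  also have "\<dots> = (\<Sum>i<m. dotp n (x i) (x i))"
    unfolding dotp_def r_def by (simp add: sum.swap[of _ "{..<m}"])
  finally show "(LINT g|std_gaussian m. (\<Sum>j<n. (\<Sum>i<m. g i * x i j)\<^sup>2)) = (\<Sum>i<m. dotp n (x i) (x i))" .
qed

section \<open>Haar measure on the sphere\<close>

text \<open>Indicators of closed sets are pointwise limits of bounded continuous functions of the
  distance, and closed sets are an intersection-stable generator of the Borel sets.\<close>

lemma borel_measure_eqI_continuous:
  fixes M N :: "'a::metric_space measure"
  assumes M: "prob_space M" "sets M = sets borel" and N: "prob_space N" "sets N = sets borel"
    and eq: "\<And>f::'a \<Rightarrow> real. continuous_on UNIV f \<Longrightarrow> (LINT x|M. f x) = (LINT x|N. f x)"
  shows "M = N"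
proof -
  interpret M: prob_space M by (rule M(1))
  interpret N: prob_space N by (rule N(1))
  have closed_eq: "emeasure M C = emeasure N C" if C: "closed C" for C
  \<comment> \<open>\<open>infdist\<close> to the empty set is 0 by convention, so the functions
    \<open>f k\<close> below would not tend to its indicator.\<close>
  proof (cases "C = {}")
    case False
    define f where "f k x = max 0 (1 - real k * infdist x C)" for k :: nat and x
    have cont: "continuous_on UNIV (f k)" for k
      unfolding f_def by (intro continuous_intros)
    have bd: "norm (f k x) \<le> 1" for k x by (simp add: f_def infdist_nonneg)
    have lim: "(\<lambda>k. f k x) \<longlonglongrightarrow> indicator C x" for x
    proof (cases "x \<in> C")
      case True
      thus ?thesis by (simp add: f_def)
    next
      case x: False
      hence pos: "0 < infdist x C"
        using C False by (metis in_closed_iff_infdist_zero infdist_nonneg less_eq_real_def)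
      \<comment> \<open>Off \<open>C\<close> the sequence is eventually 0, namely once
        \<open>k\<close> times the distance reaches 1.\<close>
      obtain K :: nat where K: "1 / infdist x C \<le> real K" using real_arch_simple by blast
      have "f k x = 0" if "K \<le> k" for k
      proof -
        have "1 / infdist x C \<le> real k" using K that by linarith
        thus ?thesis using pos by (simp add: f_def field_simps)
      qed
      hence "eventually (\<lambda>k. f k x = 0) sequentially" by (auto simp: eventually_sequentially)
      thus ?thesis using x by (simp add: tendsto_eventually)
    qed
    have limint: "(\<lambda>k. LINT x|P. f k x) \<longlonglongrightarrow> measure P C"
      if P: "prob_space P" "sets P = sets borel" for P
    proof -
      interpret P: prob_space P by (rule P(1))
      have [measurable]: "f k \<in> borel_measurable P" for k
        using borel_measurable_continuous_onI[OF cont] P(2) by (simp cong: measurable_cong_sets)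
      have [measurable]: "C \<in> sets P" using C P(2) by simp
      have "(\<lambda>k. LINT x|P. f k x) \<longlonglongrightarrow> (LINT x|P. indicator C x)"
        by (rule integral_dominated_convergence[where w="\<lambda>_. 1"]) (use lim bd in auto)
      thus ?thesis using \<open>C \<in> sets P\<close> P.emeasure_finite by (simp add: less_top)
    qed
    have "measure M C = measure N C"
      using LIMSEQ_unique[OF limint[OF M] limint[OF N, folded eq[OF cont]]] .
    thus ?thesis by (simp add: M.emeasure_eq_measure N.emeasure_eq_measure)
  qed simp
  show ?thesis
  proof (rule measure_eqI_generator_eq[where E="Collect closed" and \<Omega>=UNIV and A="\<lambda>_. UNIV"])
    show "Int_stable (Collect closed :: 'a set set)" by (auto simp: Int_stable_def)
    show "sets M = sigma_sets UNIV (Collect closed)" "sets N = sigma_sets UNIV (Collect closed)"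
      unfolding M(2) N(2) borel_eq_closed by simp_all
  qed (use closed_eq in auto)
qed

text \<open>From here on \<open>Rn n\<close> is viewed inside the type \<open>nat => real\<close>
  with its type-class product topology, as the functions frozen at \<open>undefined\<close> from
  index \<open>n\<close> on. This opens the libraries on metric spaces, Borel sets and
  Stone-Weierstrass.\<close>

lemma closed_Rn: "closed (Rn n)"
proof -
  have "Rn n = (\<Inter>i\<in>{n..}. {x. x i = undefined})"
    by (auto simp: Rn_iff extensional_def)
  moreover have "closed {x :: nat \<Rightarrow> real. x i = undefined}" for i
    by (intro closed_Collect_eq continuous_on_product_coordinates continuous_on_const)
  ultimately show ?thesis by auto
qed

lemma continuous_on_dotp_self: "continuous_on S (\<lambda>x. dotp n x x)"
  unfolding dotp_def
  by (rule continuous_on_subset[of UNIV]) (intro continuous_intros continuous_on_product_coordinates, simp)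

lemma continuous_on_dotp: "continuous_on S (\<lambda>x. dotp n t x)"
  unfolding dotp_def
  by (rule continuous_on_subset[of UNIV]) (intro continuous_intros continuous_on_product_coordinates, simp)

lemma unit_sphere_nth: "x \<in> unit_sphere n \<Longrightarrow> j < n \<Longrightarrow> \<bar>x j\<bar> \<le> 1"
  using unit_ball_subset_cube[of n] by (auto simp: unit_sphere_def unit_ball_def cube_iff)

lemma compact_unit_sphere: "compact (unit_sphere n)"
proof -
  \<comment> \<open>The singleton factors encode extensionality, which makes the sphere a closed
    subset of a compact product over all indices.\<close>
  let ?S = "\<lambda>i. if i < n then {-1..1} else {undefined :: real}"
  have "compactin (product_topology (\<lambda>i. euclidean) UNIV) (Pi\<^sub>E UNIV ?S)"
    unfolding compactin_PiE by auto
  hence c: "compact (Pi\<^sub>E UNIV ?S)" by (simp add: euclidean_product_topology)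
  have "unit_sphere n = Pi\<^sub>E UNIV ?S \<inter> {x. dotp n x x = 1}"
  proof (intro set_eqI iffI)
    fix x assume x: "x \<in> unit_sphere n"
    have "x i \<in> ?S i" for i
      using unit_sphere_nth[OF x, of i] x by (auto simp: unit_sphere_def Rn_iff extensional_def abs_le_iff)
    thus "x \<in> Pi\<^sub>E UNIV ?S \<inter> {x. dotp n x x = 1}" using x by (auto simp: unit_sphere_def)
  next
    fix x assume x: "x \<in> Pi\<^sub>E UNIV ?S \<inter> {x. dotp n x x = 1}"
    hence "x i = undefined" if "\<not> i < n" for i using that by (auto simp: PiE_iff split: if_splits)
    thus "x \<in> unit_sphere n" using x by (auto simp: unit_sphere_def Rn_iff extensional_def)
  qed
  moreover have "closed {x. dotp n x x = (1::real)}"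
    by (intro closed_Collect_eq continuous_on_dotp_self continuous_on_const)
  ultimately show ?thesis using c by (simp add: compact_Int_closed)
qed

lemma coordinate_borel_measurable: "(\<lambda>x :: nat \<Rightarrow> real. x i) \<in> borel_measurable borel"
  by (rule borel_measurable_continuous_onI) (rule continuous_on_product_coordinates)

lemma leb_id_borel: "(\<lambda>x. x) \<in> leb n \<rightarrow>\<^sub>M borel"
proof (rule measurable_coordinatewise_then_product)
  fix i
  show "(\<lambda>x. x i) \<in> borel_measurable (leb n)"
  proof (cases "i < n")
    case False
    have "(\<lambda>x. x i) \<in> borel_measurable (leb n) \<longleftrightarrow> (\<lambda>x. undefined :: real) \<in> borel_measurable (leb n)"
      by (rule measurable_cong) (use False in \<open>auto simp: Rn_iff extensional_def\<close>)
    thus ?thesis by simp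
  qed simp
qed

text \<open>Restriction to \<open>{..<n}\<close> is Borel measurable and is the identity on the
  closed set \<open>Rn n\<close>, so \<open>A\<close> is its own preimage cut down to
  \<open>Rn n\<close>.\<close>

lemma sets_leb_subset_borel:
  assumes "A \<in> sets (leb n)" shows "A \<in> sets borel"
proof -
  have m: "(\<lambda>x. restrict x {..<n}) \<in> borel \<rightarrow>\<^sub>M leb n"
    by (rule measurable_leb_restrict) (rule coordinate_borel_measurable)
  have AR: "A \<subseteq> Rn n" using sets.sets_into_space[OF assms] by simp
  have "A = ((\<lambda>x. restrict x {..<n}) -` A \<inter> space borel) \<inter> Rn n"
  proof (intro set_eqI iffI)
    fix x assume "x \<in> A"
    moreover from this have "restrict x {..<n} = x"
      using AR by (intro Rn_eqI[of _ n]) auto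
    ultimately show "x \<in> ((\<lambda>x. restrict x {..<n}) -` A \<inter> space borel) \<inter> Rn n" using AR by auto
  next
    fix x assume "x \<in> ((\<lambda>x. restrict x {..<n}) -` A \<inter> space borel) \<inter> Rn n"
    moreover from this have "restrict x {..<n} = x"
      by (intro Rn_eqI[of _ n]) auto
    ultimately show "x \<in> A" by auto
  qed
  thus ?thesis
    using measurable_sets[OF m assms] closed_Rn[of n]
    by (metis borel_closed sets.Int)
qed

section \<open>Uniqueness of the invariant probability measure on the sphere\<close>

definition is_haar :: "nat \<Rightarrow> (nat \<Rightarrow> real) measure \<Rightarrow> bool" where
  "is_haar n \<sigma> \<longleftrightarrow> prob_space \<sigma> \<and> space \<sigma> = unit_sphere n \<and>
     sets \<sigma> = sets (restrict_space (leb n) (unit_sphere n)) \<and>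
     (\<forall>U. orthogonal_Rn n U \<longrightarrow> (\<forall>A\<in>sets \<sigma>. emeasure \<sigma> (U ` A) = emeasure \<sigma> A))"

lemma sets_sphere_iff: "A \<in> sets (restrict_space (leb n) (unit_sphere n)) \<longleftrightarrow> A \<in> sets (leb n) \<and> A \<subseteq> unit_sphere n"
proof -
  have "unit_sphere n \<inter> Rn n = unit_sphere n" by (auto simp: unit_sphere_def)
  thus ?thesis by (subst sets_restrict_space_iff) auto
qed

lemma is_haarD:
  assumes "is_haar n \<sigma>"
  shows "prob_space \<sigma>" "space \<sigma> = unit_sphere n" "sets \<sigma> = sets (restrict_space (leb n) (unit_sphere n))"
    "(\<lambda>x. x) \<in> \<sigma> \<rightarrow>\<^sub>M leb n"
proof -
  show a: "prob_space \<sigma>" "space \<sigma> = unit_sphere n" "sets \<sigma> = sets (restrict_space (leb n) (unit_sphere n))"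
    using assms by (auto simp: is_haar_def)
  show "(\<lambda>x. x) \<in> \<sigma> \<rightarrow>\<^sub>M leb n"
    unfolding measurable_cong_sets[OF a(3) refl] by (rule measurable_restrict_space1) simp
qed

lemma orthogonal_unit_sphere:
  assumes "orthogonal_inverses n V W" shows "V ` unit_sphere n \<subseteq> unit_sphere n"
  using orthogonal_inversesD[OF assms] by (auto simp: unit_sphere_def)

text \<open>Invariance is defined through images of sets, while integrals need pushforwards. The two
  are linked because a preimage under \<open>V\<close> is an image under the orthogonal map
  \<open>W\<close>.\<close>

lemma is_haar_distr:
  assumes h: "is_haar n \<sigma>" and VW: "orthogonal_inverses n V W"
  shows "distr \<sigma> \<sigma> V = \<sigma>" "V \<in> \<sigma> \<rightarrow>\<^sub>M \<sigma>"
proof -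
  note D = is_haarD[OF h]
  note WV = orthogonal_inverses_sym[OF VW]
  have "V \<in> leb n \<rightarrow>\<^sub>M leb n"
    by (intro linear_Rn_measurable linear_inversesD(1)[OF orthogonal_inversesD(1)[OF VW]])
  thus V: "V \<in> \<sigma> \<rightarrow>\<^sub>M \<sigma>"
    unfolding measurable_cong_sets[OF D(3) D(3)]
    by (rule measurable_restrict_space3) (use orthogonal_unit_sphere[OF VW] in auto)
  show "distr \<sigma> \<sigma> V = \<sigma>"
  proof (rule measure_eqI)
    fix A assume "A \<in> sets (distr \<sigma> \<sigma> V)"
    hence A: "A \<in> sets \<sigma>" by simp
    hence AS: "A \<subseteq> unit_sphere n" by (simp add: D(3) sets_sphere_iff)
    have "V -` A \<inter> unit_sphere n = W ` A"
    proof (intro set_eqI iffI)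
      fix x assume "x \<in> V -` A \<inter> unit_sphere n"
      hence "x = W (V x)" "V x \<in> A" using orthogonal_inversesD[OF VW] by (auto simp: unit_sphere_def)
      thus "x \<in> W ` A" by blast
    next
      fix x assume "x \<in> W ` A"
      then obtain a where a: "a \<in> A" "x = W a" by blast
      hence "V x = a" using AS orthogonal_inversesD(3)[OF VW] by (auto simp: unit_sphere_def)
      thus "x \<in> V -` A \<inter> unit_sphere n" using a AS orthogonal_unit_sphere[OF WV] by auto
    qed
    hence "emeasure (distr \<sigma> \<sigma> V) A = emeasure \<sigma> (W ` A)"
      by (simp add: emeasure_distr[OF V A] D(2))
    also have "\<dots> = emeasure \<sigma> A"
      using h A orthogonal_inverses_Rn[OF WV] by (simp add: is_haar_def)
    finally show "emeasure (distr \<sigma> \<sigma> V) A = emeasure \<sigma> A" .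
  qed simp
qed

text \<open>A reflection takes \<open>t\<close> to \<open>u\<close>; being its own inverse, it is
  self-adjoint and can be moved from \<open>x\<close> onto \<open>t\<close>.\<close>

lemma is_haar_exp_radial:
  assumes h: "is_haar n \<sigma>" and t: "t \<in> Rn n" "u \<in> Rn n" "dotp n t t = dotp n u u"
  shows "(\<integral>\<^sup>+x. ennreal (exp (dotp n t x)) \<partial>\<sigma>) = (\<integral>\<^sup>+x. ennreal (exp (dotp n u x)) \<partial>\<sigma>)"
proof -
  define H where "H = reflection n (vadd n t (vscale n (-1) u))"
  have H: "orthogonal_inverses n H H" unfolding H_def by (rule reflection_orthogonal)
  have Ht: "H t = u" unfolding H_def by (rule reflection_swaps) (use t in auto)
  have m: "(\<lambda>x. ennreal (exp (dotp n t x))) \<in> borel_measurable \<sigma>"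
    by (intro measurable_compose[OF dotp_measurable[OF measurable_const is_haarD(4)[OF h]]])
      (use t in simp_all)
  have "(\<integral>\<^sup>+x. ennreal (exp (dotp n t x)) \<partial>distr \<sigma> \<sigma> H) = (\<integral>\<^sup>+x. ennreal (exp (dotp n t (H x))) \<partial>\<sigma>)"
    by (rule nn_integral_distr[OF is_haar_distr(2)[OF h H]]) (simp add: m)
  also have "\<dots> = (\<integral>\<^sup>+x. ennreal (exp (dotp n u x)) \<partial>\<sigma>)"
    by (rule nn_integral_cong)
      (simp add: is_haarD[OF h] unit_sphere_def orthogonal_inverses_dotp[OF H t(1), symmetric] Ht)
  finally show ?thesis by (simp add: is_haar_distr(1)[OF h H])
qed

text \<open>
  The exponential integral depends only on the length \<open>\<rho>\<close> of \<open>t\<close>, so it may be averaged over the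
  directions of \<open>t\<close> with respect to the other measure; Fubini then exchanges the two measures.
\<close>
lemma is_haar_exp_unique:
  assumes s: "is_haar n \<sigma>" and ta: "is_haar n \<tau>" and t: "t \<in> Rn n"
  shows "(\<integral>\<^sup>+x. ennreal (exp (dotp n t x)) \<partial>\<sigma>) = (\<integral>\<^sup>+x. ennreal (exp (dotp n t x)) \<partial>\<tau>)"
proof -
  interpret S: prob_space \<sigma> by (rule is_haarD(1)[OF s])
  interpret T: prob_space \<tau> by (rule is_haarD(1)[OF ta])
  interpret P: pair_prob_space \<sigma> \<tau> ..
  note [measurable] = is_haarD(4)[OF s] is_haarD(4)[OF ta]
  define \<rho> where "\<rho> = sqrt (dotp n t t)"
  have len: "dotp n t t = dotp n (vscale n \<rho> y) (vscale n \<rho> y)" if "y \<in> unit_sphere n" for y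
    using that by (simp add: unit_sphere_def \<rho>_def)
  have "(\<integral>\<^sup>+x. ennreal (exp (dotp n t x)) \<partial>\<sigma>) = (\<integral>\<^sup>+y. (\<integral>\<^sup>+x. ennreal (exp (dotp n t x)) \<partial>\<sigma>) \<partial>\<tau>)"
    by (simp add: T.emeasure_space_1)
  also have "\<dots> = (\<integral>\<^sup>+y. (\<integral>\<^sup>+x. ennreal (exp (dotp n (vscale n \<rho> y) x)) \<partial>\<sigma>) \<partial>\<tau>)"
    by (rule nn_integral_cong) (intro is_haar_exp_radial[OF s t] len, auto simp: is_haarD[OF ta])
  also have "\<dots> = (\<integral>\<^sup>+x. (\<integral>\<^sup>+y. ennreal (exp (dotp n (vscale n \<rho> y) x)) \<partial>\<tau>) \<partial>\<sigma>)"
  proof (rule P.Fubini')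
    have f: "fst \<in> \<sigma> \<Otimes>\<^sub>M \<tau> \<rightarrow>\<^sub>M leb n" "snd \<in> \<sigma> \<Otimes>\<^sub>M \<tau> \<rightarrow>\<^sub>M leb n"
      by (rule measurable_compose[OF measurable_fst is_haarD(4)[OF s]],
          rule measurable_compose[OF measurable_snd is_haarD(4)[OF ta]])
    have "(\<lambda>p. dotp n (vscale n \<rho> (snd p)) (fst p)) \<in> borel_measurable (\<sigma> \<Otimes>\<^sub>M \<tau>)"
      by (intro dotp_measurable vscale_measurable f) simp
    thus "(\<lambda>(x, y). ennreal (exp (dotp n (vscale n \<rho> y) x))) \<in> borel_measurable (\<sigma> \<Otimes>\<^sub>M \<tau>)"
      unfolding case_prod_beta' by measurable
  qed
  also have "\<dots> = (\<integral>\<^sup>+x. (\<integral>\<^sup>+y. ennreal (exp (dotp n t y)) \<partial>\<tau>) \<partial>\<sigma>)"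
  proof (rule nn_integral_cong)
    fix x assume "x \<in> space \<sigma>"
    hence x: "x \<in> unit_sphere n" by (simp add: is_haarD[OF s])
    have "(\<integral>\<^sup>+y. ennreal (exp (dotp n t y)) \<partial>\<tau>) = (\<integral>\<^sup>+y. ennreal (exp (dotp n (vscale n \<rho> x) y)) \<partial>\<tau>)"
      by (rule is_haar_exp_radial[OF ta t]) (use len[OF x] in auto)
    thus "(\<integral>\<^sup>+y. ennreal (exp (dotp n (vscale n \<rho> y) x)) \<partial>\<tau>) = (\<integral>\<^sup>+y. ennreal (exp (dotp n t y)) \<partial>\<tau>)"
      by (simp add: dotp_commute)
  qed
  also have "\<dots> = (\<integral>\<^sup>+y. ennreal (exp (dotp n t y)) \<partial>\<tau>)"
    by (simp add: S.emeasure_space_1)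
  finally show ?thesis .
qed

text \<open>Exponentials of linear forms suit both ends of the uniqueness proof: exponents add, so
  their span is an algebra for Stone-Weierstrass, and the integral of each of them is determined by
  the length of \<open>t\<close>.\<close>

inductive_set exp_span :: "nat \<Rightarrow> ((nat \<Rightarrow> real) \<Rightarrow> real) set" for n where
  exp: "t \<in> Rn n \<Longrightarrow> (\<lambda>x. c * exp (dotp n t x)) \<in> exp_span n"
| add: "f \<in> exp_span n \<Longrightarrow> g \<in> exp_span n \<Longrightarrow> (\<lambda>x. f x + g x) \<in> exp_span n"

lemma exp_span_mult:
  assumes "f \<in> exp_span n" "g \<in> exp_span n"
  shows "(\<lambda>x. f x * g x) \<in> exp_span n"
  using assms(1)
proof induction
  case t: (exp t c)
  show ?case using assms(2)
  proof induction
    case (exp u d)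
    have "(\<lambda>x. (c * d) * exp (dotp n (vadd n t u) x)) \<in> exp_span n"
      by (rule exp_span.exp) simp
    moreover have "(\<lambda>x. (c * d) * exp (dotp n (vadd n t u) x))
        = (\<lambda>x. (c * exp (dotp n t x)) * (d * exp (dotp n u x)))"
      by (simp add: exp_add mult_ac)
    ultimately show ?case by simp
  next
    case (add f g)
    thus ?case using exp_span.add[OF add.IH] by (simp add: distrib_left)
  qed
next
  case (add f g)
  thus ?case using exp_span.add[OF add.IH] by (simp add: distrib_right)
qed

lemma exp_span_continuous: "f \<in> exp_span n \<Longrightarrow> continuous_on S f"
  by (induction rule: exp_span.induct) (intro continuous_intros continuous_on_dotp; assumption)+

lemma exp_span_const: "(\<lambda>_. c) \<in> exp_span n"
proof -
  have "(\<lambda>x. c * exp (dotp n (\<lambda>j\<in>{..<n}. 0) x)) \<in> exp_span n" by (rule exp_span.exp) simp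
  thus ?thesis by (simp add: dotp_def)
qed

lemma function_ring_exp_span: "function_ring_on (exp_span n) (unit_sphere n)"
proof
  fix x y assume x: "x \<in> unit_sphere n" and y: "y \<in> unit_sphere n" and ne: "x \<noteq> y"
  then obtain j where j: "j < n" "x j \<noteq> y j"
    using Rn_eqI[of x n y] by (auto simp: unit_sphere_def)
  \<comment> \<open>The factor 1 matches the shape of the introduction rule of
    \<open>exp_span\<close>.\<close>
  define h where "h = (\<lambda>x. 1 * exp (dotp n (unit_vec n j) x))"
  have "h \<in> exp_span n" unfolding h_def by (rule exp_span.exp) simp
  moreover have "h x \<noteq> h y" using j by (simp add: h_def)
  ultimately show "\<exists>f\<in>exp_span n. f x \<noteq> f y" by blast
qed (auto intro: exp_span.add exp_span_mult exp_span_continuous exp_span_const compact_unit_sphere)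

lemma is_haar_integrable:
  assumes h: "is_haar n \<sigma>" and f: "continuous_on UNIV f"
  shows "integrable \<sigma> (f :: (nat \<Rightarrow> real) \<Rightarrow> real)"
proof -
  interpret prob_space \<sigma> by (rule is_haarD(1)[OF h])
  have "bounded (f ` unit_sphere n)"
    by (intro compact_imp_bounded compact_continuous_image compact_unit_sphere continuous_on_subset[OF f]) simp
  then obtain B where B: "\<And>x. x \<in> unit_sphere n \<Longrightarrow> norm (f x) \<le> B"
    by (auto simp: bounded_iff)
  have "f \<in> borel_measurable \<sigma>"
    by (rule measurable_compose[OF is_haarD(4)[OF h] measurable_compose[OF leb_id_borel
          borel_measurable_continuous_onI[OF f]]])
  thus ?thesis
    by (intro integrable_const_bound[where B=B]) (auto intro!: AE_I2 simp: is_haarD[OF h] B[simplified])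
qed

lemma is_haar_exp_span:
  assumes s: "is_haar n \<sigma>" and ta: "is_haar n \<tau>" and f: "f \<in> exp_span n"
  shows "(LINT x|\<sigma>. f x) = (LINT x|\<tau>. f x)"
  using f
proof induction
  case (exp t c)
  have i: "integrable \<sigma> (\<lambda>x. exp (dotp n t x))" if "is_haar n \<sigma>" for \<sigma>
    by (intro is_haar_integrable[OF that] continuous_intros continuous_on_dotp)
  have "ennreal (LINT x|\<sigma>. exp (dotp n t x)) = ennreal (LINT x|\<tau>. exp (dotp n t x))"
    using is_haar_exp_unique[OF s ta exp] i[OF s] i[OF ta]
    by (simp add: nn_integral_eq_integral)
  hence "(LINT x|\<sigma>. exp (dotp n t x)) = (LINT x|\<tau>. exp (dotp n t x))"
    by (subst (asm) ennreal_inj) (auto intro!: Bochner_Integration.integral_nonneg)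
  thus ?case by simp
next
  case (add f g)
  have "integrable \<sigma> f" "integrable \<sigma> g" "integrable \<tau> f" "integrable \<tau> g"
    using add.hyps s ta by (auto intro: is_haar_integrable exp_span_continuous)
  thus ?case using add.IH by simp
qed

lemma is_haar_continuous_unique:
  fixes f :: "(nat \<Rightarrow> real) \<Rightarrow> real"
  assumes s: "is_haar n \<sigma>" and ta: "is_haar n \<tau>" and f: "continuous_on UNIV f"
  shows "(LINT x|\<sigma>. f x) = (LINT x|\<tau>. f x)"
proof (rule ccontr)
  assume ne: "(LINT x|\<sigma>. f x) \<noteq> (LINT x|\<tau>. f x)"
  \<comment> \<open>Replacing \<open>f\<close> by \<open>g\<close> costs at most \<open>e\<close>
    under each measure, so the gap 3\<open>e\<close> would be at most 2\<open>e\<close>.\<close>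
  define e where "e = \<bar>(LINT x|\<sigma>. f x) - (LINT x|\<tau>. f x)\<bar> / 3"
  have e: "0 < e" using ne by (simp add: e_def)
  obtain g where g: "g \<in> exp_span n" "\<And>x. x \<in> unit_sphere n \<Longrightarrow> \<bar>f x - g x\<bar> < e"
    using function_ring_on.Stone_Weierstrass_basic[OF function_ring_exp_span continuous_on_subset[OF f] e]
    by (metis subset_UNIV)
  have close: "\<bar>(LINT x|\<sigma>. f x) - (LINT x|\<sigma>. g x)\<bar> \<le> e" if h: "is_haar n \<sigma>" for \<sigma>
  proof -
    interpret prob_space \<sigma> by (rule is_haarD(1)[OF h])
    have i: "integrable \<sigma> f" "integrable \<sigma> g"
      using h f exp_span_continuous[OF g(1)] by (auto intro: is_haar_integrable)
    have "\<bar>(LINT x|\<sigma>. f x) - (LINT x|\<sigma>. g x)\<bar> = \<bar>LINT x|\<sigma>. f x - g x\<bar>" using i by simp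
    also have "\<dots> \<le> (LINT x|\<sigma>. \<bar>f x - g x\<bar>)" by (rule integral_abs_bound)
    also have "\<dots> \<le> (LINT x|\<sigma>. e)"
      using i g(2) by (intro integral_mono) (auto simp: is_haarD[OF h] less_imp_le)
    finally show ?thesis by (simp add: prob_space)
  qed
  have tri: "\<bar>a - b\<bar> \<le> 2 * e" if "\<bar>a - c\<bar> \<le> e" "\<bar>b - c\<bar> \<le> e" for a b c :: real
    using that by linarith
  show False
    using tri[OF close[OF s] close[OF ta, folded is_haar_exp_span[OF s ta g(1)]]] ne by (simp add: e_def)
qed

text \<open>Both measures live on the sphere only; the identity pushes them to Borel measures on the
  whole type, where continuous functions determine them.\<close>

lemma is_haar_unique:
  assumes s: "is_haar n \<sigma>" and ta: "is_haar n \<tau>" shows "\<sigma> = \<tau>"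
proof (rule measure_eqI)
  show "sets \<sigma> = sets \<tau>" using is_haarD(3)[OF s] is_haarD(3)[OF ta] by simp
  have m: "(\<lambda>x. x) \<in> \<sigma> \<rightarrow>\<^sub>M borel" if "is_haar n \<sigma>" for \<sigma>
    by (rule measurable_compose[OF is_haarD(4)[OF that] leb_id_borel])
  have eq: "distr \<sigma> borel (\<lambda>x. x) = distr \<tau> borel (\<lambda>x. x)"
  proof (rule borel_measure_eqI_continuous)
    fix f :: "(nat \<Rightarrow> real) \<Rightarrow> real" assume f: "continuous_on UNIV f"
    note fm = borel_measurable_continuous_onI[OF f]
    show "(LINT x|distr \<sigma> borel (\<lambda>x. x). f x) = (LINT x|distr \<tau> borel (\<lambda>x. x). f x)"
      using is_haar_continuous_unique[OF s ta f]
      by (simp add: integral_distr[OF m[OF s] fm] integral_distr[OF m[OF ta] fm])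
  qed (use prob_space.prob_space_distr[OF is_haarD(1) m] s ta in auto)
  fix A assume A: "A \<in> sets \<sigma>"
  hence AS: "A \<in> sets (leb n)" "A \<subseteq> unit_sphere n" by (simp_all add: is_haarD(3)[OF s] sets_sphere_iff)
  have "emeasure (distr \<sigma> borel (\<lambda>x. x)) A = emeasure \<sigma> A" if "is_haar n \<sigma>" for \<sigma>
    using AS by (subst emeasure_distr[OF m[OF that] sets_leb_subset_borel])
      (auto simp: is_haarD[OF that] Int_absorb2)
  from this[OF s] this[OF ta] show "emeasure \<sigma> A = emeasure \<tau> A" by (simp add: eq)
qed

section \<open>Haar measure realized by Gaussian directions\<close>

definition direction :: "nat \<Rightarrow> (nat \<Rightarrow> real) \<Rightarrow> nat \<Rightarrow> real" where
  \<comment> \<open>The default value keeps \<open>direction\<close> on the sphere everywhere. It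
    breaks equivariance only at the origin, where the weight of \<open>gaussian_haar\<close>
    vanishes.\<close>
  "direction n g = (if dotp n g g = 0 then unit_vec n 0 else vscale n (1 / sqrt (dotp n g g)) g)"

text \<open>
  Weighting the Gaussian measure by \<open>\<bar>g\<bar>\<^sup>2 / n\<close> makes the passage from Gaussian to spherical
  averages of \<open>2\<close>-homogeneous functions a mere change of variables: no independence of
  \<open>\<bar>g\<bar>\<close> and \<open>g / \<bar>g\<bar>\<close> is needed.
\<close>
definition gaussian_haar :: "nat \<Rightarrow> (nat \<Rightarrow> real) measure" where
  "gaussian_haar n = distr (density (std_gaussian n) (\<lambda>g. ennreal (dotp n g g / n)))
     (restrict_space (leb n) (unit_sphere n)) (direction n)"

lemma direction_unit_sphere: "0 < n \<Longrightarrow> direction n g \<in> unit_sphere n"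
  using dotp_self_nonneg[of n g]
  by (auto simp: direction_def unit_sphere_def field_simps real_sqrt_mult[symmetric] simp del: dotp_self_nonneg)

lemma direction_measurable:
  assumes "0 < n" shows "direction n \<in> leb n \<rightarrow>\<^sub>M restrict_space (leb n) (unit_sphere n)"
proof (rule measurable_restrict_space2)
  show "direction n \<in> space (leb n) \<rightarrow> unit_sphere n" using direction_unit_sphere[OF assms] by auto
  have [measurable]: "unit_vec n 0 \<in> space (leb n)" by simp
  show "direction n \<in> leb n \<rightarrow>\<^sub>M leb n"
    unfolding direction_def by measurable
qed

lemma direction_orthogonal:
  assumes VW: "orthogonal_inverses n V W" and g: "g \<in> Rn n" "dotp n g g \<noteq> 0"
  shows "direction n (V g) = V (direction n g)"
  using g orthogonal_inversesD[OF VW]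
  by (simp add: direction_def linear_RnD(3)[OF linear_inversesD(1)[OF orthogonal_inversesD(1)[OF VW]]])

lemma emeasure_gaussian_haar:
  assumes n: "0 < n" and A: "A \<in> sets (leb n)" "A \<subseteq> unit_sphere n"
  shows "emeasure (gaussian_haar n) A
    = (\<integral>\<^sup>+g. ennreal (dotp n g g / n) * indicator A (direction n g) \<partial>std_gaussian n)"
proof -
  have A': "A \<in> sets (restrict_space (leb n) (unit_sphere n))" using A by (simp add: sets_sphere_iff)
  have m: "direction n \<in> density (std_gaussian n) (\<lambda>g. ennreal (dotp n g g / n)) \<rightarrow>\<^sub>M restrict_space (leb n) (unit_sphere n)"
    using direction_measurable[OF n] by (simp cong: measurable_cong_sets)
  have v: "direction n -` A \<inter> Rn n \<in> sets (std_gaussian n)"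
    using measurable_sets[OF m A'] by simp
  have "emeasure (gaussian_haar n) A
      = emeasure (density (std_gaussian n) (\<lambda>g. ennreal (dotp n g g / n))) (direction n -` A \<inter> Rn n)"
    unfolding gaussian_haar_def by (subst emeasure_distr[OF m A']) simp
  also have "\<dots> = (\<integral>\<^sup>+g. ennreal (dotp n g g / n) * indicator (direction n -` A \<inter> Rn n) g \<partial>std_gaussian n)"
    using v by (subst emeasure_density) auto
  also have "\<dots> = (\<integral>\<^sup>+g. ennreal (dotp n g g / n) * indicator A (direction n g) \<partial>std_gaussian n)"
    by (rule nn_integral_cong) (auto simp: indicator_def)
  finally show ?thesis .
qed

text \<open>The total mass is 1 because the expected squared length of a Gaussian vector is
  \<open>n\<close>. Invariance follows since \<open>direction\<close> commutes with rotations
  wherever the weight is positive.\<close>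

lemma is_haar_gaussian_haar:
  assumes n: "0 < n" shows "is_haar n (gaussian_haar n)"
  unfolding is_haar_def
proof (intro conjI allI impI ballI)
  show space: "space (gaussian_haar n) = unit_sphere n"
    by (auto simp: gaussian_haar_def space_restrict_space unit_sphere_def)
  show sets: "sets (gaussian_haar n) = sets (restrict_space (leb n) (unit_sphere n))"
    by (simp add: gaussian_haar_def)
  show "prob_space (gaussian_haar n)"
  proof
    have "emeasure (gaussian_haar n) (unit_sphere n)
        = (\<integral>\<^sup>+g. ennreal (dotp n g g / n) \<partial>std_gaussian n)"
      by (subst emeasure_gaussian_haar[OF n]) (auto simp: direction_unit_sphere[OF n])
    also have "\<dots> = ennreal (LINT g|std_gaussian n. dotp n g g / n)"
      by (rule nn_integral_eq_integral) (use std_gaussian_dotp_self in auto)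
    also have "\<dots> = 1" using std_gaussian_dotp_self(2)[of n] n by simp
    finally show "emeasure (gaussian_haar n) (space (gaussian_haar n)) = 1" by (simp add: space)
  qed
  fix U A assume U: "orthogonal_Rn n U" and "A \<in> sets (gaussian_haar n)"
  hence A: "A \<in> sets (leb n)" "A \<subseteq> unit_sphere n" by (simp_all add: sets sets_sphere_iff)
  obtain V W where VW: "orthogonal_inverses n V W" and UV: "\<And>x. x \<in> Rn n \<Longrightarrow> U x = V x"
    using orthogonal_RnE[OF U] by blast
  note WV = orthogonal_inverses_sym[OF VW]
  have AR: "A \<subseteq> Rn n" using A(2) by (auto simp: unit_sphere_def)
  hence UA: "U ` A = V ` A" using UV by (intro image_cong) auto
  have VA: "V ` A \<in> sets (leb n)" "V ` A \<subseteq> unit_sphere n"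
    using linear_image_sets[OF orthogonal_inversesD(1)[OF VW] A(1)] orthogonal_unit_sphere[OF VW] A(2) by auto
  define F where "F g = ennreal (dotp n g g / n) * indicator A (direction n g)" for g
  have W: "W \<in> std_gaussian n \<rightarrow>\<^sub>M leb n"
    using linear_Rn_measurable[OF linear_inversesD(1)[OF orthogonal_inversesD(1)[OF WV]]]
    by (simp add: measurable_cong_sets[OF sets_std_gaussian refl])
  have "indicator A \<in> borel_measurable (restrict_space (leb n) (unit_sphere n))"
    using A by (intro borel_measurable_indicator) (simp add: sets_sphere_iff)
  hence F: "F \<in> borel_measurable (leb n)"
    unfolding F_def
    by (intro borel_measurable_times_ennreal measurable_compose[OF direction_measurable[OF n]]) auto
  have "emeasure (gaussian_haar n) (V ` A)
      = (\<integral>\<^sup>+g. ennreal (dotp n g g / n) * indicator (V ` A) (direction n g) \<partial>std_gaussian n)"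
    by (rule emeasure_gaussian_haar[OF n VA])
  also have "\<dots> = (\<integral>\<^sup>+g. F (W g) \<partial>std_gaussian n)"
  proof (rule nn_integral_cong)
    fix g assume "g \<in> space (std_gaussian n)"
    hence g: "g \<in> Rn n" by simp
    have WW: "dotp n (W g) (W g) = dotp n g g" using orthogonal_inversesD(6)[OF WV g g] .
    show "ennreal (dotp n g g / n) * indicator (V ` A) (direction n g) = F (W g)"
    proof (cases "dotp n g g = 0")
      case False
      have "direction n g \<in> Rn n" using direction_unit_sphere[OF n, of g] by (simp add: unit_sphere_def)
      hence "direction n g \<in> V ` A \<longleftrightarrow> W (direction n g) \<in> A"
        using AR by (subst linear_image_eq_vimage[OF orthogonal_inversesD(1)[OF VW] AR]) auto
      thus ?thesis
        by (simp add: F_def WW direction_orthogonal[OF WV g False] indicator_def)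
    qed (simp add: F_def WW)
  qed
  also have "\<dots> = (\<integral>\<^sup>+g. F g \<partial>distr (std_gaussian n) (leb n) W)"
    by (rule nn_integral_distr[OF W, symmetric]) (simp add: F)
  also have "\<dots> = emeasure (gaussian_haar n) A"
    by (simp add: distr_std_gaussian_orthogonal[OF WV] emeasure_gaussian_haar[OF n A] F_def)
  finally show "emeasure (gaussian_haar n) (U ` A) = emeasure (gaussian_haar n) A" by (simp add: UA)
qed

lemma haar_sphere_eq:
  assumes "0 < n" shows "haar_sphere n = gaussian_haar n"
proof -
  have "haar_sphere n = (THE \<sigma>. is_haar n \<sigma>)" by (simp add: haar_sphere_def is_haar_def)
  also have "\<dots> = gaussian_haar n"
    by (rule the_equality) (use is_haar_gaussian_haar[OF assms] is_haar_unique in auto)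
  finally show ?thesis .
qed

text \<open>The squared length in the weight cancels the one in the denominator of the square of
  \<open>N\<close> at a normalized vector.\<close>

lemma integral_haar_sphere_homogeneous:
  assumes n: "0 < n" and N: "N \<in> borel_measurable (leb n)"
    and hom: "\<And>a x. 0 \<le> a \<Longrightarrow> x \<in> Rn n \<Longrightarrow> N (vscale n a x) = a * N x"
  shows "(LINT x|haar_sphere n. (N x)\<^sup>2) = (LINT g|std_gaussian n. (N g)\<^sup>2) / n"
proof -
  have m: "direction n \<in> density (std_gaussian n) (\<lambda>g. ennreal (dotp n g g / n)) \<rightarrow>\<^sub>M restrict_space (leb n) (unit_sphere n)"
    using direction_measurable[OF n] by (simp cong: measurable_cong_sets)
  have N2: "(\<lambda>x. (N x)\<^sup>2) \<in> borel_measurable (restrict_space (leb n) (unit_sphere n))"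
    using N by (intro measurable_restrict_space1) simp
  have Nd: "(\<lambda>g. (N (direction n g))\<^sup>2) \<in> borel_measurable (std_gaussian n)"
    using measurable_compose[OF direction_measurable[OF n] N2] by (simp cong: measurable_cong_sets)
  have "(LINT x|haar_sphere n. (N x)\<^sup>2)
      = (LINT g|density (std_gaussian n) (\<lambda>g. ennreal (dotp n g g / n)). (N (direction n g))\<^sup>2)"
    unfolding haar_sphere_eq[OF n] gaussian_haar_def by (rule integral_distr[OF m N2])
  also have "\<dots> = (LINT g|std_gaussian n. (dotp n g g / n) *\<^sub>R (N (direction n g))\<^sup>2)"
    by (rule integral_density) (use Nd in auto)
  also have "\<dots> = (LINT g|std_gaussian n. (N g)\<^sup>2 / n)"
  proof (rule Bochner_Integration.integral_cong[OF refl])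
    fix g assume "g \<in> space (std_gaussian n)"
    hence g: "g \<in> Rn n" by simp
    show "(dotp n g g / n) *\<^sub>R (N (direction n g))\<^sup>2 = (N g)\<^sup>2 / n"
    proof (cases "dotp n g g = 0")
      case True
      have "g = vscale n 0 g" by (rule Rn_eqI[of _ n]) (use g dotp_self_eq_0[OF True] in auto)
      hence "N g = 0" using hom[of 0 g] g by simp
      thus ?thesis by (simp add: True)
    next
      case False
      hence "N (direction n g) = N g / sqrt (dotp n g g)"
        using g by (simp add: direction_def hom)
      thus ?thesis using False by (simp add: power_divide)
    qed
  qed
  finally show ?thesis by simp
qed

section \<open>The norm of a symmetric body and its type-2 constant\<close>

text \<open>The working form of a body: between two cubes, star-shaped and symmetric. The inner and
  outer cubes give explicit comparisons of the gauge with Euclidean length.\<close>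

locale star_body =
  fixes n :: nat and K :: "(nat \<Rightarrow> real) set" and r R :: real
  assumes n_pos: "0 < n" and r_pos: "0 < r" and R_pos: "0 < R"
    and K_sets: "K \<in> sets (leb n)"
    and cube_subset: "cube n r \<subseteq> K" and subset_cube: "K \<subseteq> cube n R"
    and star: "x \<in> K \<Longrightarrow> 0 \<le> t \<Longrightarrow> t \<le> 1 \<Longrightarrow> vscale n t x \<in> K"
    and symmetric: "x \<in> K \<Longrightarrow> vscale n (- 1) x \<in> K"
begin

abbreviation N where "N \<equiv> body_norm n K"

lemma K_Rn: "x \<in> K \<Longrightarrow> x \<in> Rn n"
  using subset_cube by (auto simp: cube_iff)

lemma mem_vscale_iff:
  assumes "0 < t" "x \<in> Rn n" shows "x \<in> vscale n t ` K \<longleftrightarrow> vscale n (1 / t) x \<in> K"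
proof -
  have "K \<subseteq> Rn n" using K_Rn by blast
  thus ?thesis
    using assms by (subst linear_image_eq_vimage[OF vscale_linear_inverses]) auto
qed

lemma body_norm_le:
  assumes "0 < t" "x \<in> Rn n" "vscale n (1 / t) x \<in> K" shows "N x \<le> t"
  unfolding body_norm_def
  by (rule cInf_lower) (use assms in \<open>auto simp: mem_vscale_iff intro: bdd_belowI[of _ 0]\<close>)

lemma bounded_mem:
  assumes "0 < b" "x \<in> Rn n" "\<And>j. j < n \<Longrightarrow> \<bar>x j\<bar> \<le> b" shows "vscale n (1 / (b / r)) x \<in> K"
proof -
  have "\<bar>1 / (b / r) * x j\<bar> \<le> r" if "j < n" for j
    using assms(1) assms(3)[OF that] r_pos by (simp add: abs_mult field_simps)
  hence "vscale n (1 / (b / r)) x \<in> cube n r" by (simp add: cube_iff)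
  thus ?thesis using cube_subset by blast
qed

text \<open>The inner cube absorbs every point. This keeps the infimum in \<open>body_norm\<close>
  away from the unspecified \<open>Inf\<close> of the empty set.\<close>

lemma gauge_nonempty:
  assumes x: "x \<in> Rn n" shows "\<exists>t>0. vscale n (1 / t) x \<in> K"
proof -
  define b where "b = 1 + (\<Sum>j<n. \<bar>x j\<bar>)"
  have b: "0 < b" unfolding b_def by (intro add_pos_nonneg sum_nonneg) auto
  have "\<bar>x j\<bar> \<le> b" if "j < n" for j
    using member_le_sum[of j "{..<n}" "\<lambda>j. \<bar>x j\<bar>"] that by (simp add: b_def)
  from bounded_mem[OF b x this] show ?thesis using b r_pos by (intro exI[of _ "b / r"]) auto
qed

lemma le_body_norm:
  assumes x: "x \<in> Rn n" and le: "\<And>t. 0 < t \<Longrightarrow> vscale n (1 / t) x \<in> K \<Longrightarrow> c \<le> t"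
  shows "c \<le> N x"
proof -
  have "{t. 0 < t \<and> x \<in> vscale n t ` K} = {t. 0 < t \<and> vscale n (1 / t) x \<in> K}"
    by (rule Collect_cong) (use x mem_vscale_iff in blast)
  thus ?thesis
    unfolding body_norm_def using gauge_nonempty[OF x] le by (auto intro!: cInf_greatest)
qed

lemma body_norm_nonneg: "x \<in> Rn n \<Longrightarrow> 0 \<le> N x"
  by (rule le_body_norm) auto

text \<open>Star-shapedness allows an admissible scale to be enlarged to a rational one, so sublevel
  sets become countable unions of scaled copies of \<open>K\<close>; measurability follows.\<close>

lemma body_norm_less_iff:
  assumes x: "x \<in> Rn n" shows "N x < t \<longleftrightarrow> (\<exists>s\<in>\<rat>. 0 < s \<and> s < t \<and> vscale n (1 / s) x \<in> K)"
proof
  assume "N x < t"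
  then obtain s where s: "0 < s" "vscale n (1 / s) x \<in> K" "s < t"
    using le_body_norm[OF x, of t] by (metis not_le)
  obtain q where q: "q \<in> \<rat>" "s < q" "q < t" using Rats_dense_in_real[OF s(3)] by blast
  have "vscale n (s / q) (vscale n (1 / s) x) \<in> K" by (rule star) (use s q in simp_all)
  thus "\<exists>s\<in>\<rat>. 0 < s \<and> s < t \<and> vscale n (1 / s) x \<in> K"
    using s q by (intro bexI[of _ q]) auto
next
  assume "\<exists>s\<in>\<rat>. 0 < s \<and> s < t \<and> vscale n (1 / s) x \<in> K"
  thus "N x < t" using body_norm_le[OF _ x] by fastforce
qed

lemma body_norm_measurable: "N \<in> borel_measurable (leb n)"
proof (rule borel_measurableI_less)
  fix t
  have "{x \<in> space (leb n). N x < t} = (\<Union>s\<in>{s\<in>\<rat>. 0 < s \<and> s < t}. vscale n s ` K)"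
  proof (intro set_eqI iffI)
    fix x assume "x \<in> {x \<in> space (leb n). N x < t}"
    thus "x \<in> (\<Union>s\<in>{s\<in>\<rat>. 0 < s \<and> s < t}. vscale n s ` K)"
      using body_norm_less_iff[of x t] mem_vscale_iff[of _ x] by fastforce
  next
    fix x assume "x \<in> (\<Union>s\<in>{s\<in>\<rat>. 0 < s \<and> s < t}. vscale n s ` K)"
    then obtain s where s: "s \<in> \<rat>" "0 < s" "s < t" "x \<in> vscale n s ` K" by blast
    have "x \<in> Rn n" using s by auto
    thus "x \<in> {x \<in> space (leb n). N x < t}"
      using s body_norm_less_iff[of x t] mem_vscale_iff[of s x] by auto
  qed
  moreover have "countable {s::real. s \<in> \<rat> \<and> 0 < s \<and> s < t}"
    by (rule countable_subset[OF _ countable_rat]) auto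
  moreover have "vscale n s ` K \<in> sets (leb n)" if "0 < s" for s
    using that by (intro linear_image_sets[OF vscale_linear_inverses K_sets]) simp
  ultimately show "{x \<in> space (leb n). N x < t} \<in> sets (leb n)"
    by (auto intro!: sets.countable_UN')
qed

lemma body_norm_zero: "N (vscale n 0 x) = 0"
proof (rule antisym)
  have "vscale n (1 / t) (vscale n 0 x) \<in> K" for t
    using cube_subset r_pos by (auto simp: cube_iff)
  hence "N (vscale n 0 x) \<le> t" if "0 < t" for t
    using that by (intro body_norm_le) auto
  thus "N (vscale n 0 x) \<le> 0" by (metis field_le_epsilon add_0)
qed (simp add: body_norm_nonneg)

lemma body_norm_vscale_le:
  assumes x: "x \<in> Rn n" and a: "a \<noteq> 0" shows "N (vscale n a x) \<le> \<bar>a\<bar> * N x"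
proof -
  have "N (vscale n a x) / \<bar>a\<bar> \<le> N x"
  proof (rule le_body_norm[OF x])
    fix t :: real assume t: "0 < t" "vscale n (1 / t) x \<in> K"
    have "vscale n (1 / (\<bar>a\<bar> * t)) (vscale n a x) \<in> K"
    proof (cases "0 < a")
      case True
      thus ?thesis using t by simp
    next
      case False
      hence "vscale n (1 / (\<bar>a\<bar> * t)) (vscale n a x) = vscale n (- 1) (vscale n (1 / t) x)"
        using a by simp
      thus ?thesis using symmetric[OF t(2)] by simp
    qed
    hence "N (vscale n a x) \<le> \<bar>a\<bar> * t" using t a by (intro body_norm_le) auto
    thus "N (vscale n a x) / \<bar>a\<bar> \<le> t" using a by (simp add: field_simps)
  qed
  thus ?thesis using a by (simp add: field_simps)
qed

lemma body_norm_vscale: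
  assumes x: "x \<in> Rn n" shows "N (vscale n a x) = \<bar>a\<bar> * N x"
proof (cases "a = 0")
  case False
  have "N x = N (vscale n (1 / a) (vscale n a x))" using x False by simp
  also have "\<dots> \<le> \<bar>1 / a\<bar> * N (vscale n a x)" using False by (intro body_norm_vscale_le) auto
  finally have "\<bar>a\<bar> * N x \<le> N (vscale n a x)" using False by (simp add: field_simps)
  with body_norm_vscale_le[OF x False] show ?thesis by simp
qed (simp add: body_norm_zero)

lemma body_norm_le_1: "x \<in> K \<Longrightarrow> N x \<le> 1"
  using body_norm_le[of 1 x] K_Rn by simp

text \<open>This comparison through the inner cube, and the reverse one through the outer cube,
  serve finiteness, positivity and vanishing errors; \<open>r\<close> and \<open>R\<close> do not
  survive into the final bound.\<close>

lemma body_norm_square_le: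
  assumes x: "x \<in> Rn n" shows "(N x)\<^sup>2 \<le> dotp n x x / r\<^sup>2"
proof (cases "dotp n x x = 0")
  case True
  have "x = vscale n 0 x" by (rule Rn_eqI[of _ n]) (use x dotp_self_eq_0[OF True] in auto)
  hence "N x = 0" using body_norm_zero[of x] by simp
  thus ?thesis by simp
next
  case False
  define b where "b = sqrt (dotp n x x)"
  have b: "0 < b" using False dotp_self_nonneg[of n x] by (simp add: b_def less_le)
  have "\<bar>x j\<bar> \<le> b" if "j < n" for j
    unfolding b_def using nth_square_le_dotp[OF that, of x] real_le_rsqrt by fastforce
  from bounded_mem[OF b x this] have "N x \<le> b / r" using b x r_pos by (intro body_norm_le) auto
  hence "(N x)\<^sup>2 \<le> (b / r)\<^sup>2" using body_norm_nonneg[OF x] by (intro power_mono) auto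
  thus ?thesis by (simp add: b_def power_divide)
qed

lemma dotp_le_body_norm:
  assumes x: "x \<in> Rn n" shows "dotp n x x \<le> n * R\<^sup>2 * (N x)\<^sup>2"
proof -
  have "\<bar>x j\<bar> / R \<le> N x" if j: "j < n" for j
  proof (rule le_body_norm[OF x])
    fix t :: real assume t: "0 < t" "vscale n (1 / t) x \<in> K"
    hence "vscale n (1 / t) x \<in> cube n R" using subset_cube by blast
    hence "\<bar>1 / t * x j\<bar> \<le> R" using j by (simp add: cube_iff)
    thus "\<bar>x j\<bar> / R \<le> t" using t R_pos by (simp add: abs_mult field_simps)
  qed
  hence "x \<in> cube n (R * N x)" using x R_pos by (simp add: cube_iff field_simps)
  from dotp_le_cube[OF this] show ?thesis by (simp add: power_mult_distrib)
qed

section \<open>Existence of the least type-2 constant\<close>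

definition valid_type2 :: "real \<Rightarrow> bool" where
  "valid_type2 T \<longleftrightarrow> 0 < T \<and> (\<forall>m\<ge>1. \<forall>x. (\<forall>i<m. x i \<in> Rn n) \<longrightarrow>
        sqrt (LINT g|std_gaussian m. (N (\<lambda>j\<in>{..<n}. \<Sum>i<m. g i * x i j))\<^sup>2)
          \<le> T * sqrt (\<Sum>i<m. (N (x i))\<^sup>2))"

text \<open>Euclidean space satisfies the inequality with constant 1; the witness is the distortion
  between \<open>N\<close> and Euclidean length given by the two cubes.\<close>

lemma valid_type2_exists: "valid_type2 (sqrt n * R / r)"
  unfolding valid_type2_def
proof (intro conjI allI impI)
  show "0 < sqrt n * R / r" using n_pos r_pos R_pos by simp
  fix m :: nat and x assume x: "\<forall>i<m. x i \<in> Rn n"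
  let ?v = "\<lambda>g. \<lambda>j\<in>{..<n}. \<Sum>i<m. g i * x i j"
  have d: "dotp n (?v g) (?v g) = (\<Sum>j<n. (\<Sum>i<m. g i * x i j)\<^sup>2)" for g :: "nat \<Rightarrow> real"
    by (simp add: dotp_def power2_eq_square)
  have "(LINT g|std_gaussian m. (N (?v g))\<^sup>2)
      \<le> (LINT g|std_gaussian m. (\<Sum>j<n. (\<Sum>i<m. g i * x i j)\<^sup>2) / r\<^sup>2)"
  proof (rule integral_mono')
    show "integrable (std_gaussian m) (\<lambda>g. (\<Sum>j<n. (\<Sum>i<m. g i * x i j)\<^sup>2) / r\<^sup>2)"
      by (intro integrable_divide_zero impI std_gaussian_combination_square(1))
    fix g show "(N (?v g))\<^sup>2 \<le> (\<Sum>j<n. (\<Sum>i<m. g i * x i j)\<^sup>2) / r\<^sup>2"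
      unfolding d[symmetric] by (rule body_norm_square_le) simp
  qed (simp add: sum_nonneg)
  also have "\<dots> = (\<Sum>i<m. dotp n (x i) (x i)) / r\<^sup>2"
    by (simp add: std_gaussian_combination_square(2))
  also have "\<dots> \<le> (\<Sum>i<m. n * R\<^sup>2 * (N (x i))\<^sup>2) / r\<^sup>2"
    using x by (intro divide_right_mono sum_mono dotp_le_body_norm) auto
  also have "\<dots> = (sqrt n * R / r)\<^sup>2 * (\<Sum>i<m. (N (x i))\<^sup>2)"
    by (simp add: sum_distrib_left sum_divide_distrib power_divide power_mult_distrib)
  finally have "sqrt (LINT g|std_gaussian m. (N (?v g))\<^sup>2)
      \<le> sqrt ((sqrt n * R / r)\<^sup>2 * (\<Sum>i<m. (N (x i))\<^sup>2))" by (rule real_sqrt_le_mono)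
  also have "\<dots> = sqrt n * R / r * sqrt (\<Sum>i<m. (N (x i))\<^sup>2)"
    using n_pos r_pos R_pos by (simp add: real_sqrt_mult)
  finally show "sqrt (LINT g|std_gaussian m. (N (?v g))\<^sup>2) \<le> \<dots>" .
qed

text \<open>A single nonzero vector gives equality with constant 1. The bound makes the infimum of
  the admissible constants meaningful and positive.\<close>

lemma valid_type2_ge_1:
  assumes T: "valid_type2 T" shows "1 \<le> T"
proof -
  define u where "u = unit_vec n 0"
  have u: "u \<in> Rn n" by (simp add: u_def)
  have "0 < dotp n u u" using n_pos by (simp add: u_def)
  also have "\<dots> \<le> n * R\<^sup>2 * (N u)\<^sup>2" by (rule dotp_le_body_norm[OF u])
  finally have "N u \<noteq> 0" by auto
  hence Nu: "0 < N u" using body_norm_nonneg[OF u] by simp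
  have "(N (\<lambda>j\<in>{..<n}. \<Sum>i<1. g i * u j))\<^sup>2 = (g 0)\<^sup>2 * (N u)\<^sup>2" for g :: "nat \<Rightarrow> real"
  proof -
    have "(\<lambda>j\<in>{..<n}. \<Sum>i<1. g i * u j) = vscale n (g 0) u"
      by (rule Rn_eqI[of _ n]) auto
    thus ?thesis by (simp add: body_norm_vscale[OF u] power_mult_distrib)
  qed
  hence "(LINT g|std_gaussian 1. (N (\<lambda>j\<in>{..<n}. \<Sum>i<1. g i * u j))\<^sup>2) = (N u)\<^sup>2"
    using std_gaussian_component(2)[of 0 1] by simp
  moreover have "sqrt (LINT g|std_gaussian 1. (N (\<lambda>j\<in>{..<n}. \<Sum>i<1. g i * (\<lambda>_. u) i j))\<^sup>2)
      \<le> T * sqrt (\<Sum>i<1::nat. (N ((\<lambda>_. u) i))\<^sup>2)"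
    using T[unfolded valid_type2_def, THEN conjunct2, rule_format, of 1 "\<lambda>_. u"] u by simp
  ultimately have "N u \<le> T * N u" using Nu by simp
  thus ?thesis using Nu by simp
qed

text \<open>Each instance of the inequality is a non-strict linear condition on \<open>T\<close>, so
  it passes to the infimum, which is therefore the \<open>LEAST\<close> element.\<close>

lemma type2_constant_valid: "valid_type2 (type2_constant n N)"
proof -
  define T where "T = Inf (Collect valid_type2)"
  have ne: "Collect valid_type2 \<noteq> {}" using valid_type2_exists by blast
  have T1: "1 \<le> T" unfolding T_def by (rule cInf_greatest[OF ne]) (simp add: valid_type2_ge_1)
  have le: "T \<le> t" if "valid_type2 t" for t
    unfolding T_def by (rule cInf_lower) (use that valid_type2_ge_1 in \<open>auto intro!: bdd_belowI[of _ 1]\<close>)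
  have T: "valid_type2 T"
    unfolding valid_type2_def
  proof (intro conjI allI impI)
    show "0 < T" using T1 by simp
    fix m :: nat and x assume m: "1 \<le> m" and x: "\<forall>i<m. x i \<in> Rn n"
    let ?a = "sqrt (LINT g|std_gaussian m. (N (\<lambda>j\<in>{..<n}. \<Sum>i<m. g i * x i j))\<^sup>2)"
    let ?b = "sqrt (\<Sum>i<m. (N (x i))\<^sup>2)"
    have ab: "?a \<le> t * ?b" if "valid_type2 t" for t
      using that m x unfolding valid_type2_def by blast
    have b0: "0 \<le> ?b" by (simp add: sum_nonneg)
    show "?a \<le> T * ?b"
    proof (cases "?b = 0")
      \<comment> \<open>Division by \<open>?b\<close> is impossible here, but any one admissible
        constant already forces \<open>?a\<close> to be at most 0.\<close>
      case True
      show ?thesis using ab[OF valid_type2_exists] unfolding True by simp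
    next
      case False
      hence b: "0 < ?b" using b0 by simp
      have "?a / ?b \<le> T"
        unfolding T_def by (rule cInf_greatest[OF ne]) (use ab b in \<open>auto simp: pos_divide_le_eq\<close>)
      thus ?thesis using b by (simp only: pos_divide_le_eq)
    qed
  qed
  have "type2_constant n N = (LEAST T. valid_type2 T)"
    by (simp add: type2_constant_def valid_type2_def)
  also have "\<dots> = T" by (rule Least_equality) (use T le in auto)
  finally show ?thesis using T by simp
qed

text \<open>The squared form, extended to m = 0 because the decompositions below may be empty
  sums.\<close>

lemma type2_inequality:
  assumes "\<And>i. i < m \<Longrightarrow> x i \<in> Rn n"
  shows "(LINT g|std_gaussian m. (N (\<lambda>j\<in>{..<n}. \<Sum>i<m. g i * x i j))\<^sup>2)
    \<le> (type2_constant n N)\<^sup>2 * (\<Sum>i<m. (N (x i))\<^sup>2)"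
proof (cases "m = 0")
  case True
  have "(\<lambda>j\<in>{..<n}. 0) = vscale n 0 (\<lambda>j\<in>{..<n}. 0 :: real)" by (rule Rn_eqI[of _ n]) auto
  hence "N (\<lambda>j\<in>{..<n}. 0) = 0" using body_norm_zero by metis
  thus ?thesis using True by simp
next
  case False
  let ?a = "LINT g|std_gaussian m. (N (\<lambda>j\<in>{..<n}. \<Sum>i<m. g i * x i j))\<^sup>2"
  have s: "sqrt ?a \<le> type2_constant n N * sqrt (\<Sum>i<m. (N (x i))\<^sup>2)"
    using type2_constant_valid False assms unfolding valid_type2_def by simp
  have a: "0 \<le> ?a" by (intro Bochner_Integration.integral_nonneg) simp
  have "(sqrt ?a)\<^sup>2 \<le> (type2_constant n N * sqrt (\<Sum>i<m. (N (x i))\<^sup>2))\<^sup>2"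
    using s a by (intro power_mono) auto
  thus ?thesis using a by (simp add: power_mult_distrib sum_nonneg)
qed

text \<open>Positivity, needed to divide by \<open>M2\<close>, holds because the mean of the squared
  norm dominates a positive multiple of the mean squared length.\<close>

lemma M2_square:
  "(M2 n K)\<^sup>2 = (LINT g|std_gaussian n. (N g)\<^sup>2) / n" "0 < M2 n K"
proof -
  have "0 \<le> (LINT x|haar_sphere n. (N x)\<^sup>2)" by (intro Bochner_Integration.integral_nonneg) simp
  thus eq: "(M2 n K)\<^sup>2 = (LINT g|std_gaussian n. (N g)\<^sup>2) / n"
    using integral_haar_sphere_homogeneous[OF n_pos body_norm_measurable]
    by (simp add: M2_def body_norm_vscale)
  have i: "integrable (std_gaussian n) (\<lambda>g. (N g)\<^sup>2)"
  proof (rule Bochner_Integration.integrable_bound)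
    show "integrable (std_gaussian n) (\<lambda>g. dotp n g g / r\<^sup>2)"
      by (intro integrable_divide_zero impI std_gaussian_dotp_self)
    show "(\<lambda>g. (N g)\<^sup>2) \<in> borel_measurable (std_gaussian n)"
      using body_norm_measurable by (simp cong: measurable_cong_sets)
    show "AE g in std_gaussian n. norm ((N g)\<^sup>2) \<le> norm (dotp n g g / r\<^sup>2)"
      by (rule AE_I2) (use body_norm_square_le in simp)
  qed
  have "n = (LINT g|std_gaussian n. dotp n g g)" by (simp add: std_gaussian_dotp_self)
  also have "\<dots> \<le> (LINT g|std_gaussian n. n * R\<^sup>2 * (N g)\<^sup>2)"
    using i by (intro integral_mono std_gaussian_dotp_self integrable_mult_right)
      (auto simp: dotp_le_body_norm)
  finally have "n \<le> n * R\<^sup>2 * (LINT g|std_gaussian n. (N g)\<^sup>2)" by simp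
  hence "(LINT g|std_gaussian n. (N g)\<^sup>2) \<noteq> 0" using n_pos by auto
  hence "(M2 n K)\<^sup>2 \<noteq> 0" using eq n_pos by simp
  moreover have "0 \<le> M2 n K" by (auto simp: M2_def intro!: Bochner_Integration.integral_nonneg)
  ultimately show "0 < M2 n K" by simp
qed

lemma emeasure_K: "0 < vol n K" "emeasure (leb n) K = ennreal (vol n K)"
proof -
  have "emeasure (leb n) K \<le> emeasure (leb n) (cube n R)"
    using subset_cube by (intro emeasure_mono) auto
  also have "\<dots> < \<infinity>" using R_pos by (simp add: emeasure_cube)
  finally show eq: "emeasure (leb n) K = ennreal (vol n K)"
    by (simp add: vol_def emeasure_eq_ennreal_measure less_top)
  have "ennreal ((2 * r) ^ n) \<le> emeasure (leb n) K"
    using r_pos emeasure_mono[OF cube_subset K_sets] by (simp add: emeasure_cube)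
  hence "(2 * r) ^ n \<le> vol n K" by (simp add: eq vol_def)
  moreover have "0 < (2 * r) ^ n" using r_pos by simp
  ultimately show "0 < vol n K" by linarith
qed

end

text \<open>Compactness gives the outer cube. For the inner one, a box around an interior point
  \<open>z\<close> is averaged with the point -z of the body, which recentres it at the
  origin.\<close>

lemma convex_body_star_body:
  assumes n: "0 < n" and K: "convex_body n K" and sym: "centrally_symmetric n K"
  obtains r R where "star_body n K r R"
proof -
  let ?X = "powertop_real {..<n}"
  have cpt: "compactin ?X K" and conv: "\<And>x y t. x \<in> K \<Longrightarrow> y \<in> K \<Longrightarrow> t \<in> {0..1} \<Longrightarrow>
      vadd n (vscale n (1 - t) x) (vscale n t y) \<in> K" and int: "?X interior_of K \<noteq> {}"
    using K by (auto simp: convex_body_def)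
  have tX: "topspace ?X = Rn n" by (simp add: Rn_def)
  have KR: "K \<subseteq> Rn n" using compactin_subset_topspace[OF cpt] tX by simp
  have symm: "vscale n (-1) x \<in> K" if "x \<in> K" for x
    using sym that by (auto simp: centrally_symmetric_def)
  \<comment> \<open>The identity carries compactness from the topology of the statement to the
    type-class topology; the coordinates from \<open>n\<close> on are constant.\<close>
  have idc: "continuous_map ?X euclidean (\<lambda>x. x)"
    unfolding euclidean_product_topology[symmetric] continuous_map_componentwise_UNIV
  proof
    fix i
    show "continuous_map ?X euclidean (\<lambda>x. x i)"
    proof (cases "i < n")
      case False
      have "continuous_map ?X euclidean (\<lambda>x. undefined :: real)" by simp
      moreover have "x i = undefined" if "x \<in> topspace ?X" for x
        using that False unfolding tX by (auto simp: Rn_iff extensional_def)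
      ultimately show ?thesis by (metis continuous_map_eq)
    qed (auto intro: continuous_map_product_projection)
  qed
  have cK: "compact K" using image_compactin[OF cpt idc] by simp
  have "K \<in> sets borel" using compact_imp_closed[OF cK] by simp
  from measurable_sets[OF leb_id_borel this, of n] have Ks: "K \<in> sets (leb n)"
    using KR by (simp add: Int_absorb2)
  have "\<exists>B. \<forall>x\<in>K. \<bar>x j\<bar> \<le> B" for j
  proof -
    have "bounded ((\<lambda>x. x j) ` K)"
      by (intro compact_imp_bounded compact_continuous_image cK
          continuous_on_subset[OF continuous_on_product_coordinates]) simp
    thus ?thesis by (auto simp: bounded_iff)
  qed
  then obtain B where B: "\<And>j x. x \<in> K \<Longrightarrow> \<bar>x j\<bar> \<le> B j" by metis
  define R where "R = 1 + (\<Sum>j<n. \<bar>B j\<bar>)"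
  have R: "0 < R" unfolding R_def by (intro add_pos_nonneg sum_nonneg) auto
  have "\<bar>x j\<bar> \<le> R" if "x \<in> K" "j < n" for x j
    using B[OF that(1), of j] member_le_sum[of j "{..<n}" "\<lambda>j. \<bar>B j\<bar>"] that(2) by (simp add: R_def)
  hence KcR: "K \<subseteq> cube n R" using KR by (auto simp: cube_iff)
  obtain z where z: "z \<in> ?X interior_of K" using int by blast
  have op: "openin ?X (?X interior_of K)" by (rule openin_interior_of)
  obtain U where U: "finite {i \<in> {..<n}. U i \<noteq> topspace euclideanreal}"
    "\<And>i. i \<in> {..<n} \<Longrightarrow> openin euclideanreal (U i)" "z \<in> Pi\<^sub>E {..<n} U" "Pi\<^sub>E {..<n} U \<subseteq> ?X interior_of K"
    using op z unfolding openin_product_topology_alt by meson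
  have zK: "z \<in> K" using z interior_of_subset[of ?X K] by auto
  have "\<exists>e>0. \<forall>y. \<bar>y - z j\<bar> < e \<longrightarrow> y \<in> U j" if "j < n" for j
  proof -
    have "open (U j)" "z j \<in> U j" using U(2,3) that by auto
    thus ?thesis by (metis open_dist dist_real_def)
  qed
  then obtain e where e: "\<And>j. j < n \<Longrightarrow> 0 < e j" "\<And>j y. j < n \<Longrightarrow> \<bar>y - z j\<bar> < e j \<Longrightarrow> y \<in> U j"
    by metis
  define d where "d = Min (e ` {..<n})"
  have ne: "e ` {..<n} \<noteq> {}" using n by auto
  have d: "0 < d" unfolding d_def using ne e(1) by (subst Min_gr_iff) auto
  have de: "d \<le> e j" if "j < n" for j unfolding d_def using that by (intro Min_le) auto
  \<comment> \<open>A point y of the cube is the midpoint of -z and z + 2y, and 2y has coordinates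
    of size at most d/2, strictly below \<open>d\<close>.\<close>
  define r where "r = d / 4"
  have r: "0 < r" using d by (simp add: r_def)
  have near: "y \<in> K" if "y \<in> Rn n" "\<And>j. j < n \<Longrightarrow> \<bar>y j - z j\<bar> < d" for y
  proof -
    have "y j \<in> U j" if j: "j < n" for j
      using e(2)[OF j, of "y j"] de[OF j] \<open>\<And>j. j < n \<Longrightarrow> \<bar>y j - z j\<bar> < d\<close>[OF j] by linarith
    hence "y \<in> Pi\<^sub>E {..<n} U" using that(1) by (auto simp: PiE_iff Rn_iff)
    thus ?thesis using U(4) interior_of_subset[of ?X K] by blast
  qed
  have cubeK: "cube n r \<subseteq> K"
  proof
    fix y assume y: "y \<in> cube n r"
    have "vadd n z (vscale n 2 y) \<in> K"
    proof (rule near)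
      fix j assume j: "j < n"
      hence "\<bar>y j\<bar> \<le> r" using y by (simp add: cube_iff)
      thus "\<bar>vadd n z (vscale n 2 y) j - z j\<bar> < d" using j d by (simp add: r_def abs_mult)
    qed simp
    from conv[OF symm[OF zK] this, of "1/2"]
    have "vadd n (vscale n (1 - 1/2) (vscale n (-1) z)) (vscale n (1/2) (vadd n z (vscale n 2 y))) \<in> K" by simp
    moreover have "vadd n (vscale n (1 - 1/2) (vscale n (-1) z)) (vscale n (1/2) (vadd n z (vscale n 2 y))) = y"
      by (rule Rn_eqI[of _ n]) (use y in \<open>auto simp: cube_iff algebra_simps\<close>)
    ultimately show "y \<in> K" by simp
  qed
  have star: "vscale n t x \<in> K" if x: "x \<in> K" and t: "0 \<le> t" "t \<le> 1" for x t
  proof -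
    have "vscale n 0 x \<in> K" using cubeK r by (auto simp: cube_iff)
    from conv[OF this x, of t] t
    have "vadd n (vscale n (1 - t) (vscale n 0 x)) (vscale n t x) \<in> K" by simp
    moreover have "vadd n (vscale n (1 - t) (vscale n 0 x)) (vscale n t x) = vscale n t x"
      by (rule Rn_eqI[of _ n]) auto
    ultimately show ?thesis by simp
  qed
  show ?thesis
    by (rule that[of r R]) (unfold_locales; use n r R Ks cubeK KcR star symm in blast)
qed

section \<open>Decomposing the covariance of the body\<close>

context star_body
begin

lemma K_Int_Rn [simp]: "K \<inter> Rn n = K"
  using K_Rn by blast

lemma K_integrable:
  fixes f :: "(nat \<Rightarrow> real) \<Rightarrow> real"
  assumes f: "f \<in> borel_measurable (leb n)" and B: "\<And>x. x \<in> K \<Longrightarrow> \<bar>f x\<bar> \<le> B"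
  shows "set_integrable (leb n) K f"
  unfolding set_integrable_def
proof (rule Bochner_Integration.integrable_bound)
  show "integrable (leb n) (\<lambda>x. indicator K x *\<^sub>R B)"
    using K_sets emeasure_K(2) by (simp add: integrable_indicator_iff)
  show "(\<lambda>x. indicator K x *\<^sub>R f x) \<in> borel_measurable (leb n)"
    using f K_sets by simp
  show "AE x in leb n. norm (indicator K x *\<^sub>R f x) \<le> norm (indicator K x *\<^sub>R B)"
    by (rule AE_I2) (use B in \<open>force simp: indicator_def\<close>)
qed

lemma K_nth: "x \<in> K \<Longrightarrow> j < n \<Longrightarrow> \<bar>x j\<bar> \<le> R"
  using subset_cube by (auto simp: cube_iff)

lemma K_moment_integrable:
  assumes "j < n" "l < n" shows "set_integrable (leb n) K (\<lambda>x. x j * x l)"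
proof (rule K_integrable[where B = "R * R"])
  show "\<bar>x j * x l\<bar> \<le> R * R" if "x \<in> K" for x
    unfolding abs_mult using K_nth[OF that] assms R_pos by (intro mult_mono) auto
qed (use assms in simp)

text \<open>Polarization: unit vectors give the diagonal, and the normalized sum of two of them
  isolates the mixed moment.\<close>

lemma second_moment:
  assumes iso: "\<And>\<theta>. \<theta> \<in> unit_sphere n \<Longrightarrow> (LINT x:K|leb n. (dotp n x \<theta>)\<^sup>2) = c"
    and jl: "j < n" "l < n"
  shows "(LINT x:K|leb n. x j * x l) = (if j = l then c else 0)"
proof -
  have diag: "(LINT x:K|leb n. x i * x i) = c" if "i < n" for i
    using iso[of "unit_vec n i"] that by (simp add: unit_sphere_def power2_eq_square)
  show ?thesis
  proof (cases "j = l")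
    case False
    define \<theta> where "\<theta> = vscale n (1 / sqrt 2) (vadd n (unit_vec n j) (unit_vec n l))"
    have "\<theta> \<in> unit_sphere n"
      using jl False by (simp add: \<theta>_def unit_sphere_def)
    hence "c = (LINT x:K|leb n. (dotp n x \<theta>)\<^sup>2)" by (rule iso[symmetric])
    also have "\<dots> = (LINT x:K|leb n. (1/2) * (x j * x j + x l * x l + 2 * (x j * x l)))"
    proof -
      have eq: "(dotp n x \<theta>)\<^sup>2 = (1/2) * (x j * x j + x l * x l + 2 * (x j * x l))" for x
        using jl by (simp add: \<theta>_def power_mult_distrib power_divide)
          (simp add: power2_eq_square algebra_simps)
      show ?thesis by (simp only: eq)
    qed
    also have "\<dots> = (1/2) * (c + c + 2 * (LINT x:K|leb n. x j * x l))"
    proof -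
      define m where "m a b x = indicator K x *\<^sub>R (x a * x b :: real)" for a b :: nat and x :: "nat \<Rightarrow> real"
      have mi: "integrable (leb n) (m a b)" if "a < n" "b < n" for a b
        unfolding m_def using K_moment_integrable[OF that] by (simp add: set_integrable_def)
      have mm: "(LINT x:K|leb n. x a * x b) = (LINT x|leb n. m a b x)" for a b
        by (simp add: set_lebesgue_integral_def m_def)
      have "(LINT x:K|leb n. (1/2) * (x j * x j + x l * x l + 2 * (x j * x l)))
          = (LINT x|leb n. (1/2) * (m j j x + m l l x + 2 * m j l x))"
        unfolding set_lebesgue_integral_def
        by (rule Bochner_Integration.integral_cong) (simp_all add: m_def algebra_simps)
      also have "\<dots> = (1/2) * ((LINT x|leb n. m j j x) + (LINT x|leb n. m l l x) + 2 * (LINT x|leb n. m j l x))"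
        using mi jl by simp
      finally show ?thesis using diag jl by (simp only: mm[symmetric])
    qed
    finally have "(LINT x:K|leb n. x j * x l) = 0" by simp
    thus ?thesis using False by simp
  qed (use diag jl in simp)
qed

lemma second_moment_dotp:
  assumes iso: "\<And>\<theta>. \<theta> \<in> unit_sphere n \<Longrightarrow> (LINT x:K|leb n. (dotp n x \<theta>)\<^sup>2) = c"
    and u: "u \<in> Rn n"
  shows "(LINT x:K|leb n. (dotp n x u)\<^sup>2) = c * dotp n u u"
proof (cases "dotp n u u = 0")
  case True
  hence "dotp n x u = 0" for x using dotp_self_eq_0[OF True] by (simp add: dotp_def)
  thus ?thesis using True by simp
next
  case False
  define s where "s = sqrt (dotp n u u)"
  have s: "s \<noteq> 0" "s * s = dotp n u u" using False by (simp_all add: s_def)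
  have "vscale n (1 / s) u \<in> unit_sphere n" using s False by (simp add: unit_sphere_def)
  hence "(LINT x:K|leb n. (dotp n x (vscale n (1 / s) u))\<^sup>2) = c" by (rule iso)
  moreover have "(dotp n x u)\<^sup>2 = dotp n u u * (dotp n x (vscale n (1 / s) u))\<^sup>2" for x
    using s False by (simp add: power_mult_distrib power_divide power2_eq_square)
  ultimately show ?thesis by simp
qed

text \<open>The shell between the cubes of half-sides r/2 and r lies in \<open>K\<close>, has
  positive volume, and each of its points has a coordinate larger than r/2. Hence the integral of
  the squared length, which is n c, is positive.\<close>

lemma second_moment_pos:
  assumes iso: "\<And>\<theta>. \<theta> \<in> unit_sphere n \<Longrightarrow> (LINT x:K|leb n. (dotp n x \<theta>)\<^sup>2) = c"
  shows "0 < c"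
proof -
  have expand: "indicator K x *\<^sub>R dotp n x x = (\<Sum>j<n. indicator K x *\<^sub>R (x j * x j))" for x
    unfolding dotp_def by (rule scaleR_sum_right)
  have int: "set_integrable (leb n) K (\<lambda>x. dotp n x x)"
    unfolding set_integrable_def expand
    by (intro Bochner_Integration.integrable_sum K_moment_integrable[unfolded set_integrable_def]) auto
  define D where "D = cube n r - cube n (r / 2)"
  have D: "D \<in> sets (leb n)" by (simp add: D_def)
  have fin: "emeasure (leb n) (cube n a) \<noteq> \<infinity>" if "0 \<le> a" for a
    using that by (simp add: emeasure_cube)
  have mc: "measure (leb n) (cube n a) = (2 * a) ^ n" if "0 \<le> a" for a
    using that by (simp add: measure_def emeasure_cube)
  have DR: "D \<inter> Rn n = D" by (auto simp: D_def cube_iff)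
  have "measure (leb n) D = (2 * r) ^ n - r ^ n"
  proof -
    have "cube n (r / 2) \<subseteq> cube n r" using r_pos by (force simp: cube_iff)
    hence "measure (leb n) D = measure (leb n) (cube n r) - measure (leb n) (cube n (r / 2))"
      unfolding D_def using fin[of r] r_pos by (intro measure_Diff) auto
    thus ?thesis using r_pos by (simp add: mc)
  qed
  moreover have "r ^ n < (2 * r) ^ n" using r_pos n_pos by (intro power_strict_mono) auto
  ultimately have mD: "0 < measure (leb n) D" by simp
  have iD: "integrable (leb n) (\<lambda>x. (r / 2)\<^sup>2 * indicator D x)"
  proof -
    have "emeasure (leb n) D \<le> emeasure (leb n) (cube n r)" by (rule emeasure_mono) (auto simp: D_def)
    hence "emeasure (leb n) D < \<infinity>" using fin[of r] r_pos by (simp add: less_top le_less_trans)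
    thus ?thesis using D by simp
  qed
  have "0 < (r / 2)\<^sup>2 * measure (leb n) D" using r_pos mD by simp
  also have "\<dots> = (LINT x|leb n. (r / 2)\<^sup>2 * indicator D x)" by (simp add: DR)
  also have "\<dots> \<le> (LINT x:K|leb n. dotp n x x)"
    unfolding set_lebesgue_integral_def
  proof (rule integral_mono[OF iD int[unfolded set_integrable_def]])
    fix x
    show "(r / 2)\<^sup>2 * indicator D x \<le> indicator K x *\<^sub>R dotp n x x"
    proof (cases "x \<in> D")
      case True
      hence xK: "x \<in> K" using cube_subset by (auto simp: D_def)
      from True obtain j where j: "j < n" "r / 2 < \<bar>x j\<bar>" by (auto simp: D_def cube_iff not_le)
      have "(r / 2)\<^sup>2 \<le> \<bar>x j\<bar>\<^sup>2" using j r_pos by (intro power_mono) auto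
      also have "\<dots> \<le> dotp n x x" using nth_square_le_dotp[OF j(1)] by simp
      finally show ?thesis using True xK by simp
    next
      case False
      thus ?thesis by (auto simp: indicator_def)
    qed
  qed
  also have "\<dots> = (\<Sum>j<n. LINT x:K|leb n. x j * x j)"
    unfolding set_lebesgue_integral_def expand
    by (intro Bochner_Integration.integral_sum K_moment_integrable[unfolded set_integrable_def]) auto
  also have "\<dots> = n * c" using second_moment[OF iso] by simp
  finally show ?thesis using n_pos by (simp add: zero_less_mult_iff)
qed

text \<open>\<open>A\<close> is the covariance matrix of the Gaussian sum of the vectors
  \<open>x i\<close>, and \<open>w\<close> bounds the sum on the right-hand side of the type-2
  inequality. Both are additive under concatenation of families, which makes the repair
  possible.\<close>

definition decomposable :: "(nat \<Rightarrow> nat \<Rightarrow> real) \<Rightarrow> real \<Rightarrow> bool" where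
  "decomposable A w \<longleftrightarrow> (\<exists>(m::nat) x. (\<forall>i<m. x i \<in> Rn n) \<and>
     (\<forall>j<n. \<forall>l<n. A j l = (\<Sum>i<m. x i j * x i l)) \<and> (\<Sum>i<m. (N (x i))\<^sup>2) \<le> w)"

lemma decomposable_cong:
  assumes "decomposable A w" "\<And>j l. j < n \<Longrightarrow> l < n \<Longrightarrow> A j l = B j l" "w \<le> w'"
  shows "decomposable B w'"
proof -
  obtain m :: nat and x where x: "\<forall>i<m. x i \<in> Rn n"
    "\<forall>j<n. \<forall>l<n. A j l = (\<Sum>i<m. x i j * x i l)" "(\<Sum>i<m. (N (x i))\<^sup>2) \<le> w"
    using assms(1) unfolding decomposable_def by (elim exE conjE)
  show ?thesis
    unfolding decomposable_def
    by (intro exI[of _ m] exI[of _ x] conjI allI impI)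
      (use x(1) in blast, use x(2) assms(2) in simp, use x(3) assms(3) in linarith)
qed

lemma decomposable_zero: "decomposable (\<lambda>_ _. 0) 0"
  unfolding decomposable_def by (rule exI[of _ 0]) simp

lemma decomposable_single:
  assumes v: "v \<in> Rn n" and p: "0 \<le> p"
  shows "decomposable (\<lambda>j l. p * (v j * v l)) (p * (N v)\<^sup>2)"
  unfolding decomposable_def
proof (intro exI[of _ 1] exI[of _ "\<lambda>_. vscale n (sqrt p) v"] conjI allI impI)
  fix j l assume "j < n" "l < n"
  thus "p * (v j * v l) = (\<Sum>i<(1::nat). vscale n (sqrt p) v j * vscale n (sqrt p) v l)"
    using p by (simp add: mult_ac)
qed (use p in \<open>simp_all add: body_norm_vscale[OF v] power_mult_distrib\<close>)

lemma decomposable_add: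
  assumes "decomposable A w" "decomposable B v"
  shows "decomposable (\<lambda>j l. A j l + B j l) (w + v)"
proof -
  obtain m :: nat and x where x: "\<forall>i<m. x i \<in> Rn n"
    "\<forall>j<n. \<forall>l<n. A j l = (\<Sum>i<m. x i j * x i l)" "(\<Sum>i<m. (N (x i))\<^sup>2) \<le> w"
    using assms(1) unfolding decomposable_def by (elim exE conjE)
  obtain k :: nat and y where y: "\<forall>i<k. y i \<in> Rn n"
    "\<forall>j<n. \<forall>l<n. B j l = (\<Sum>i<k. y i j * y i l)" "(\<Sum>i<k. (N (y i))\<^sup>2) \<le> v"
    using assms(2) unfolding decomposable_def by (elim exE conjE)
  define z where "z i = (if i < m then x i else y (i - m))" for i
  have split: "(\<Sum>i<m + k. F (z i)) = (\<Sum>i<m. F (x i)) + (\<Sum>i<k. F (y i))" for F :: "_ \<Rightarrow> real"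
  proof -
    have "(\<Sum>i<m + k. F (z i)) = (\<Sum>i<m. F (z i)) + (\<Sum>i<k. F (z (m + i)))"
      by (induction k) simp_all
    thus ?thesis by (simp add: z_def)
  qed
  show ?thesis
    unfolding decomposable_def
  proof (intro exI[of _ "m + k"] exI[of _ z] conjI allI impI)
    show "z i \<in> Rn n" if "i < m + k" for i using that x(1) y(1) by (auto simp: z_def)
    show "A j l + B j l = (\<Sum>i<m + k. z i j * z i l)" if "j < n" "l < n" for j l
      using split[of "\<lambda>u. u j * u l"] x(2) y(2) that by simp
    show "(\<Sum>i<m + k. (N (z i))\<^sup>2) \<le> w + v"
      using split[of "\<lambda>u. (N u)\<^sup>2"] x(3) y(3) by simp
  qed
qed

lemma decomposable_sum:
  assumes "finite I" "\<And>i. i \<in> I \<Longrightarrow> decomposable (A i) (w i)"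
  shows "decomposable (\<lambda>j l. \<Sum>i\<in>I. A i j l) (\<Sum>i\<in>I. w i)"
  using assms by (induction I rule: finite_induct) (simp_all add: decomposable_zero decomposable_add)

lemma decomposable_scalar:
  assumes d: "decomposable (\<lambda>j l. if j = l then s else 0) w" and s: "0 < s"
  shows "s * (LINT g|std_gaussian n. (N g)\<^sup>2) \<le> (type2_constant n N)\<^sup>2 * w"
proof -
  obtain m :: nat and x where x: "\<forall>i<m. x i \<in> Rn n"
    and cov: "\<forall>j<n. \<forall>l<n. (if j = l then s else 0) = (\<Sum>i<m. x i j * x i l)"
    and w: "(\<Sum>i<m. (N (x i))\<^sup>2) \<le> w"
    using d unfolding decomposable_def by (elim exE conjE)
  have "(LINT g|std_gaussian m. (N (\<lambda>j\<in>{..<n}. \<Sum>i<m. g i * x i j))\<^sup>2)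
      = (LINT g|std_gaussian n. (N (vscale n (sqrt s) g))\<^sup>2)"
    by (rule integral_gaussian_combination[where F = "\<lambda>x. (N x)\<^sup>2"])
      (use s cov[rule_format] body_norm_measurable in \<open>auto simp: cov[rule_format, symmetric]\<close>)
  also have "\<dots> = (LINT g|std_gaussian n. s * (N g)\<^sup>2)"
    by (rule Bochner_Integration.integral_cong) (use s in \<open>simp_all add: body_norm_vscale power_mult_distrib\<close>)
  finally have "s * (LINT g|std_gaussian n. (N g)\<^sup>2)
      \<le> (type2_constant n N)\<^sup>2 * (\<Sum>i<m. (N (x i))\<^sup>2)"
    using type2_inequality[of m x] x by simp
  also have "\<dots> \<le> (type2_constant n N)\<^sup>2 * w"
    using w by (intro mult_left_mono) auto
  finally show ?thesis .
qed

text \<open>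
  Diagonal dominance: \<open>E\<^sub>a\<^sub>b (e\<^sub>a e\<^sub>b\<^sup>T + e\<^sub>b e\<^sub>a\<^sup>T)\<close> is, up to diagonal terms, the square of
  \<open>e\<^sub>a \<plusminus> e\<^sub>b\<close> weighted by \<open>\<bar>E\<^sub>a\<^sub>b\<bar>\<close>.
\<close>
lemma decomposable_perturbation:
  fixes E :: "nat \<Rightarrow> nat \<Rightarrow> real" and \<eta> :: real
  assumes sym: "\<And>j l. j < n \<Longrightarrow> l < n \<Longrightarrow> E j l = E l j"
    and small: "\<And>j l. j < n \<Longrightarrow> l < n \<Longrightarrow> \<bar>E j l\<bar> \<le> \<eta>"
  shows "decomposable (\<lambda>j l. E j l + (if j = l then n * \<eta> else 0)) (3 * (real n)\<^sup>2 / r\<^sup>2 * \<eta>)"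
proof -
  have \<eta>: "0 \<le> \<eta>" using small[of 0 0] n_pos by simp
  \<comment> \<open>The sign makes the cross terms of weight |E| sum to \<open>E\<close>; where an
    entry is 0 its weight is 0 too.\<close>
  define v where "v a b = vadd n (unit_vec n a) (vscale n (sgn (E a b)) (unit_vec n b))" for a b
  \<comment> \<open>Row \<open>a\<close> has already received the sum of its |E| entries on the
    diagonal; \<open>q\<close> tops this up to the same value n \<eta> in every row.\<close>
  define q where "q a = n * \<eta> - (\<Sum>b<n. \<bar>E a b\<bar>)" for a
  have q: "0 \<le> q a" "q a \<le> n * \<eta>" if "a < n" for a
  proof -
    have "(\<Sum>b<n. \<bar>E a b\<bar>) \<le> (\<Sum>b<n. \<eta>)" using small that by (intro sum_mono) auto
    thus "0 \<le> q a" by (simp add: q_def)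
    show "q a \<le> n * \<eta>" by (simp add: q_def sum_nonneg)
  qed
  have d1: "decomposable (\<lambda>j l. \<Sum>a<n. \<Sum>b<n. \<bar>E a b\<bar> / 2 * (v a b j * v a b l))
      (\<Sum>a<n. \<Sum>b<n. \<bar>E a b\<bar> / 2 * (N (v a b))\<^sup>2)"
    by (intro decomposable_sum decomposable_single) (auto simp: v_def)
  have d2: "decomposable (\<lambda>j l. \<Sum>a<n. q a * (unit_vec n a j * unit_vec n a l))
      (\<Sum>a<n. q a * (N (unit_vec n a))\<^sup>2)"
    by (intro decomposable_sum decomposable_single) (auto simp: q)
  have Nv: "(N (v a b))\<^sup>2 \<le> 4 / r\<^sup>2" if ab: "a < n" "b < n" for a b
  proof -
    \<comment> \<open>The value 4 is reached for a = b with positive sign, where the two unit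
      vectors add up.\<close>
    have "dotp n (v a b) (v a b) \<le> 4" using ab by (auto simp: v_def sgn_if)
    hence "dotp n (v a b) (v a b) / r\<^sup>2 \<le> 4 / r\<^sup>2" by (intro divide_right_mono) auto
    thus ?thesis using body_norm_square_le[of "v a b"] by (simp add: v_def)
  qed
  have Nu: "(N (unit_vec n a))\<^sup>2 \<le> 1 / r\<^sup>2" if "a < n" for a
    using body_norm_square_le[of "unit_vec n a"] that by simp
  have c1: "(\<Sum>a<n. \<Sum>b<n. \<bar>E a b\<bar> / 2 * (N (v a b))\<^sup>2) \<le> (\<Sum>a<n. \<Sum>b<n. \<eta> / 2 * (4 / r\<^sup>2))"
    using small Nv \<eta> by (intro sum_mono mult_mono) auto
  have c2: "(\<Sum>a<n. q a * (N (unit_vec n a))\<^sup>2) \<le> (\<Sum>a<n. n * \<eta> * (1 / r\<^sup>2))"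
    using q Nu \<eta> by (intro sum_mono mult_mono) auto
  have cost: "(\<Sum>a<n. \<Sum>b<n. \<bar>E a b\<bar> / 2 * (N (v a b))\<^sup>2) + (\<Sum>a<n. q a * (N (unit_vec n a))\<^sup>2)
      \<le> 3 * (real n)\<^sup>2 / r\<^sup>2 * \<eta>"
  proof -
    \<comment> \<open>The 3 is 2 + 1: the pairs cost twice, and the diagonal terms once, the common
      quantity.\<close>
    have "(\<Sum>a<n. \<Sum>b<n. \<eta> / 2 * (4 / r\<^sup>2)) = 2 * ((real n)\<^sup>2 / r\<^sup>2 * \<eta>)"
      "(\<Sum>a<n. n * \<eta> * (1 / r\<^sup>2)) = (real n)\<^sup>2 / r\<^sup>2 * \<eta>"
      "3 * (real n)\<^sup>2 / r\<^sup>2 * \<eta> = 2 * ((real n)\<^sup>2 / r\<^sup>2 * \<eta>) + (real n)\<^sup>2 / r\<^sup>2 * \<eta>"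
      using r_pos by (simp_all add: power2_eq_square field_simps)
    thus ?thesis using c1 c2 by linarith
  qed
  show ?thesis
  proof (rule decomposable_cong[OF decomposable_add[OF d1 d2] _ cost])
    fix j l assume jl: "j < n" "l < n"
    let ?d = "\<lambda>i k. if i = k then 1 else 0 :: real"
    have vv: "\<bar>E a b\<bar> / 2 * (v a b j * v a b l)
        = (\<bar>E a b\<bar> / 2) * ?d j a * ?d l a + (\<bar>E a b\<bar> / 2) * ?d j b * ?d l b
          + (E a b / 2) * ?d j a * ?d l b + (E a b / 2) * ?d l a * ?d j b" for a b
      using jl by (cases "E a b" "0 :: real" rule: linorder_cases) (auto simp: v_def)
    have delta: "(\<Sum>b<n. f b * ?d i b) = f i" if "i < n" for f :: "nat \<Rightarrow> real" and i
      using that by (simp add: if_distrib[of "\<lambda>t. _ * t"] cong: if_cong)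
    have s2: "(\<Sum>a<n. \<Sum>b<n. F a b * ?d j b * ?d l b) = (\<Sum>a<n. F a j * ?d j l)"
      and s3: "(\<Sum>a<n. \<Sum>b<n. F a b * ?d j a * ?d l a) = (\<Sum>b<n. F j b * ?d j l)"
      and s4: "(\<Sum>a<n. \<Sum>b<n. F a b * ?d j a * ?d l b) = F j l"
      and s5: "(\<Sum>a<n. \<Sum>b<n. F a b * ?d l a * ?d j b) = F l j" for F :: "nat \<Rightarrow> nat \<Rightarrow> real"
    proof -
      have sw: "F a b * ?d j b * ?d l b = F a b * ?d j l * ?d l b" for a b by simp
      show "(\<Sum>a<n. \<Sum>b<n. F a b * ?d j b * ?d l b) = (\<Sum>a<n. F a j * ?d j l)"
        unfolding sw delta[OF jl(2)] by (intro sum.cong) auto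
      have sw': "F a b * ?d j a * ?d l a = F a b * ?d j l * ?d l a" for a b by simp
      show "(\<Sum>a<n. \<Sum>b<n. F a b * ?d j a * ?d l a) = (\<Sum>b<n. F j b * ?d j l)"
        by (subst sum.swap) (unfold sw' delta[OF jl(2)], intro sum.cong, auto)
    qed (simp_all only: delta[OF jl(1)] delta[OF jl(2)])
    have "(\<Sum>a<n. \<Sum>b<n. \<bar>E a b\<bar> / 2 * (v a b j * v a b l))
        = (\<Sum>b<n. (\<bar>E j b\<bar> / 2) * ?d j l) + (\<Sum>a<n. (\<bar>E a j\<bar> / 2) * ?d j l) + E j l / 2 + E l j / 2"
      unfolding vv sum.distrib s2 s3 s4 s5 by simp
    also have "(\<Sum>a<n. (\<bar>E a j\<bar> / 2) * ?d j l) = (\<Sum>b<n. (\<bar>E j b\<bar> / 2) * ?d j l)"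
      using sym jl by (intro sum.cong) auto
    also have "E l j = E j l" by (rule sym) (use jl in auto)
    finally have "(\<Sum>a<n. \<Sum>b<n. \<bar>E a b\<bar> / 2 * (v a b j * v a b l))
        = E j l + ?d j l * (\<Sum>b<n. \<bar>E j b\<bar>)"
      by (simp add: sum_distrib_left[symmetric] sum_distrib_right[symmetric] sum_divide_distrib[symmetric])
    moreover have "(\<Sum>a<n. q a * (unit_vec n a j * unit_vec n a l)) = ?d j l * q j"
      using jl by (simp add: if_distrib[of "\<lambda>t. t * _"] if_distrib[of "\<lambda>t. _ * t"] cong: if_cong)
    ultimately show "(\<Sum>a<n. \<Sum>b<n. \<bar>E a b\<bar> / 2 * (v a b j * v a b l))
        + (\<Sum>a<n. q a * (unit_vec n a j * unit_vec n a l)) = E j l + (if j = l then n * \<eta> else 0)"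
      by (simp add: q_def)
  qed
qed

section \<open>Replacing the second moments of the body by finite sums over a grid\<close>

definition cell :: "nat \<Rightarrow> (nat \<Rightarrow> real) \<Rightarrow> nat \<Rightarrow> int" where
  "cell k x = (\<lambda>j\<in>{..<n}. \<lfloor>real k * x j\<rfloor>)"

lemma finite_cells: "finite (cell k ` K)"
proof (rule finite_subset)
  define L where "L = \<lceil>real k * R\<rceil> + 1"
  show "cell k ` K \<subseteq> {..<n} \<rightarrow>\<^sub>E {-L..L}"
  proof (intro image_subsetI)
    fix x assume x: "x \<in> K"
    have "\<lfloor>real k * x j\<rfloor> \<in> {-L..L}" if j: "j < n" for j
    proof -
      have "\<bar>real k * x j\<bar> \<le> real k * R" using K_nth[OF x j] by (simp add: abs_mult mult_left_mono)
      thus ?thesis unfolding L_def atLeastAtMost_iff abs_le_iff by (auto; linarith)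
    qed
    thus "cell k x \<in> {..<n} \<rightarrow>\<^sub>E {-L..L}" by (simp add: cell_def PiE_iff)
  qed
  show "finite ({..<n} \<rightarrow>\<^sub>E {-L..L})" by (intro finite_PiE) auto
qed

lemma cell_sets: "{x \<in> K. cell k x = cell k y} \<in> sets (leb n)"
proof -
  have "{x \<in> K. cell k x = cell k y}
      = K \<inter> (\<Inter>j\<in>{..<n}. {x \<in> space (leb n). of_int \<lfloor>real k * y j\<rfloor> \<le> real k * x j
          \<and> real k * x j < of_int \<lfloor>real k * y j\<rfloor> + 1})"
  proof (intro set_eqI iffI)
    fix x assume "x \<in> {x \<in> K. cell k x = cell k y}"
    hence x: "x \<in> K" "cell k x = cell k y" by auto
    have "\<lfloor>real k * x j\<rfloor> = \<lfloor>real k * y j\<rfloor>" if "j < n" for j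
      using fun_cong[OF x(2), of j] that by (simp add: cell_def)
    thus "x \<in> K \<inter> (\<Inter>j\<in>{..<n}. {x \<in> space (leb n). of_int \<lfloor>real k * y j\<rfloor> \<le> real k * x j
          \<and> real k * x j < of_int \<lfloor>real k * y j\<rfloor> + 1})"
      using x(1) K_Rn[OF x(1)] by (auto simp: floor_eq_iff)
  next
    fix x assume "x \<in> K \<inter> (\<Inter>j\<in>{..<n}. {x \<in> space (leb n). of_int \<lfloor>real k * y j\<rfloor> \<le> real k * x j
          \<and> real k * x j < of_int \<lfloor>real k * y j\<rfloor> + 1})"
    hence "x \<in> K" "\<And>j. j < n \<Longrightarrow> \<lfloor>real k * x j\<rfloor> = \<lfloor>real k * y j\<rfloor>" by (auto simp: floor_eq_iff)
    thus "x \<in> {x \<in> K. cell k x = cell k y}" by (auto simp: cell_def)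
  qed
  also have "\<dots> \<in> sets (leb n)"
  proof (intro sets.Int K_sets sets.finite_INT)
    fix j assume "j \<in> {..<n}"
    hence [measurable]: "(\<lambda>x. x j) \<in> borel_measurable (leb n)" by simp
    show "{x \<in> space (leb n). of_int \<lfloor>real k * y j\<rfloor> \<le> real k * x j
          \<and> real k * x j < of_int \<lfloor>real k * y j\<rfloor> + 1} \<in> sets (leb n)"
      by measurable
  qed (use n_pos in auto)
  finally show ?thesis .
qed

lemma cell_eq_dist:
  assumes "cell k x = cell k y" "0 < k" "j < n" shows "\<bar>x j - y j\<bar> \<le> 1 / k"
proof -
  have "\<lfloor>real k * x j\<rfloor> = \<lfloor>real k * y j\<rfloor>"
    using fun_cong[OF assms(1), of j] assms(3) by (simp add: cell_def)
  hence "\<bar>real k * x j - real k * y j\<bar> \<le> 1" by linarith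
  hence "real k * \<bar>x j - y j\<bar> \<le> 1" by (simp add: abs_mult right_diff_distrib[symmetric])
  thus ?thesis using assms(2) by (simp add: field_simps)
qed

text \<open>\<open>K\<close> meets finitely many cells of the grid of mesh 1/k; each contributes one
  sample point of \<open>K\<close>, weighted by its share of the volume. Sampling inside
  \<open>K\<close> is what keeps the norms at most 1.\<close>

lemma discretization:
  fixes k :: nat
  assumes k: "0 < k"
  obtains Z :: "(nat \<Rightarrow> int) set" and p :: "(nat \<Rightarrow> int) \<Rightarrow> real" and y :: "(nat \<Rightarrow> int) \<Rightarrow> nat \<Rightarrow> real"
  where "finite Z" "\<forall>z\<in>Z. 0 \<le> p z" "\<forall>z\<in>Z. y z \<in> K" "(\<Sum>z\<in>Z. p z) = 1"
    "\<forall>j<n. \<forall>l<n.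
       \<bar>(LINT x:K|leb n. x j * x l) / vol n K - (\<Sum>z\<in>Z. p z * (y z j * y z l))\<bar> \<le> 2 * R / k"
proof -
  define Z where "Z = cell k ` K"
  define C where "C z = {x \<in> K. cell k x = z}" for z
  define p where "p z = measure (leb n) (C z) / vol n K" for z
  define y where "y z = (SOME x. x \<in> K \<and> cell k x = z)" for z
  have V: "0 < vol n K" by (rule emeasure_K)
  have Z: "finite Z" unfolding Z_def by (rule finite_cells)
  have y: "y z \<in> K" "cell k (y z) = z" if "z \<in> Z" for z
    using that someI_ex[of "\<lambda>x. x \<in> K \<and> cell k x = z"] by (auto simp: y_def Z_def)
  have Cs: "C z \<in> sets (leb n)" if "z \<in> Z" for z
    using cell_sets[of k "y z"] y[OF that] by (simp add: C_def)
  have Ci: "integrable (leb n) (indicator (C z) :: _ \<Rightarrow> real)" if "z \<in> Z" for z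
  proof -
    have "emeasure (leb n) (C z) \<le> emeasure (leb n) K"
      using K_sets by (intro emeasure_mono) (auto simp: C_def)
    also have "\<dots> < \<infinity>" by (simp add: emeasure_K)
    finally show ?thesis using Cs[OF that] by simp
  qed
  \<comment> \<open>The cells partition \<open>K\<close>, so exactly one term survives at a point of
    \<open>K\<close>.\<close>
  have step: "(\<Sum>z\<in>Z. indicator (C z) x * a z) = indicator K x * a (cell k x)" for a :: "_ \<Rightarrow> real" and x
  proof (cases "x \<in> K")
    case True
    hence "(\<Sum>z\<in>Z. indicator (C z) x * a z) = (\<Sum>z\<in>Z. if z = cell k x then a z else 0)"
      by (intro sum.cong) (auto simp: C_def indicator_def)
    thus ?thesis using True Z by (simp add: Z_def)
  qed (simp add: C_def)
  have CR [simp]: "C z \<inter> Rn n = C z" for z using K_Rn by (auto simp: C_def)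
  have intstep: "(LINT x|leb n. (\<Sum>z\<in>Z. indicator (C z) x * a z)) = (\<Sum>z\<in>Z. measure (leb n) (C z) * a z)"
    for a :: "_ \<Rightarrow> real"
    using Ci by (subst Bochner_Integration.integral_sum) auto
  have istep: "integrable (leb n) (\<lambda>x. \<Sum>z\<in>Z. indicator (C z) x * a z)" for a :: "_ \<Rightarrow> real"
    using Ci by (intro Bochner_Integration.integrable_sum integrable_mult_left) auto
  have Ki: "integrable (leb n) (indicator K :: _ \<Rightarrow> real)"
    using K_sets emeasure_K(2) by (simp add: integrable_indicator_iff)
  show ?thesis
  proof (rule that[of Z p y]; (intro allI impI)?)
    show "finite Z" by (rule Z)
    show "\<forall>z\<in>Z. 0 \<le> p z" using V by (simp add: p_def)
    show "\<forall>z\<in>Z. y z \<in> K" using y by blast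
    have "(\<Sum>z\<in>Z. measure (leb n) (C z)) = (LINT x|leb n. indicator K x)"
      using intstep[of "\<lambda>_. 1"] step[of _ "\<lambda>_. 1"] by simp
    also have "\<dots> = vol n K" by (simp add: vol_def)
    finally show "(\<Sum>z\<in>Z. p z) = 1"
      using V by (simp add: p_def sum_divide_distrib[symmetric])
    fix j l assume jl: "j < n" "l < n"
    let ?a = "\<lambda>z. y z j * y z l"
    have mi: "integrable (leb n) (\<lambda>x. indicator K x * (x j * x l))"
      using K_moment_integrable[OF jl] by (simp add: set_integrable_def)
    have "\<bar>(LINT x:K|leb n. x j * x l) - (\<Sum>z\<in>Z. measure (leb n) (C z) * ?a z)\<bar>
        = \<bar>LINT x|leb n. indicator K x * (x j * x l) - (\<Sum>z\<in>Z. indicator (C z) x * ?a z)\<bar>"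
      using mi istep[of ?a] intstep[of ?a] by (simp add: set_lebesgue_integral_def)
    also have "\<dots> \<le> (LINT x|leb n. \<bar>indicator K x * (x j * x l) - (\<Sum>z\<in>Z. indicator (C z) x * ?a z)\<bar>)"
      by (rule integral_abs_bound)
    also have "\<dots> \<le> (LINT x|leb n. indicator K x * (2 * R / k))"
    proof (rule integral_mono)
      show "integrable (leb n) (\<lambda>x. \<bar>indicator K x * (x j * x l) - (\<Sum>z\<in>Z. indicator (C z) x * ?a z)\<bar>)"
        using mi istep[of ?a] by simp
      show "integrable (leb n) (\<lambda>x. indicator K x * (2 * R / k))" using Ki by simp
      fix x
      show "\<bar>indicator K x * (x j * x l) - (\<Sum>z\<in>Z. indicator (C z) x * ?a z)\<bar> \<le> indicator K x * (2 * R / k)"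
      proof (cases "x \<in> K")
        case True
        define u where "u = y (cell k x)"
        have cz: "cell k x \<in> Z" using True by (simp add: Z_def)
        have u: "u \<in> K" "cell k u = cell k x" using y[OF cz] by (simp_all add: u_def)
        have d: "\<bar>x i - u i\<bar> \<le> 1 / k" if "i < n" for i
          using cell_eq_dist[OF u(2)[symmetric] k that] .
        \<comment> \<open>Changing one factor at a time costs R/k twice, whence the 2R/k.\<close>
        have "\<bar>x j * x l - u j * u l\<bar> = \<bar>x j * (x l - u l) + (x j - u j) * u l\<bar>"
          by (simp add: algebra_simps)
        also have "\<dots> \<le> \<bar>x j\<bar> * \<bar>x l - u l\<bar> + \<bar>x j - u j\<bar> * \<bar>u l\<bar>"
          by (metis abs_mult abs_triangle_ineq)
        also have "\<dots> \<le> R * (1 / k) + (1 / k) * R"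
          using K_nth[OF True jl(1)] K_nth[OF u(1) jl(2)] d jl R_pos by (intro add_mono mult_mono) auto
        finally show ?thesis using True by (simp only: step) (simp add: u_def)
      qed (simp only: step, simp)
    qed
    also have "\<dots> = vol n K * (2 * R / k)" by (simp add: vol_def)
    finally have "\<bar>(LINT x:K|leb n. x j * x l) - (\<Sum>z\<in>Z. measure (leb n) (C z) * ?a z)\<bar> / vol n K \<le> 2 * R / k"
      using V by (simp add: pos_divide_le_eq mult.commute)
    moreover have "(LINT x:K|leb n. x j * x l) / vol n K - (\<Sum>z\<in>Z. p z * ?a z)
        = ((LINT x:K|leb n. x j * x l) - (\<Sum>z\<in>Z. measure (leb n) (C z) * ?a z)) / vol n K"
      by (simp add: p_def diff_divide_distrib sum_divide_distrib)
    ultimately show "\<bar>(LINT x:K|leb n. x j * x l) / vol n K - (\<Sum>z\<in>Z. p z * ?a z)\<bar> \<le> 2 * R / k"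
      using V by simp
  qed
qed

lemma type2_lower_bound:
  assumes iso: "\<And>\<theta>. \<theta> \<in> unit_sphere n \<Longrightarrow> (LINT x:K|leb n. (dotp n x \<theta>)\<^sup>2) = c"
  shows "c / vol n K * (n * (M2 n K)\<^sup>2) \<le> (type2_constant n N)\<^sup>2"
proof -
  define G where "G = (LINT g|std_gaussian n. (N g)\<^sup>2)"
  define T where "T = (type2_constant n N)\<^sup>2"
  define \<mu> where "\<mu> = c / vol n K"
  have \<mu>: "0 < \<mu>" using second_moment_pos[OF iso] emeasure_K(1) by (simp add: \<mu>_def)
  have G: "0 \<le> G" unfolding G_def by (intro Bochner_Integration.integral_nonneg) simp
  have bound: "\<mu> * G \<le> T + T * (3 * (real n)\<^sup>2 / r\<^sup>2) * (2 * R / real k)" if k: "0 < k" for k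
  proof -
    obtain Z :: "(nat \<Rightarrow> int) set" and p and y
      where Z: "finite Z" "\<forall>z\<in>Z. 0 \<le> p z" "\<forall>z\<in>Z. y z \<in> K" "(\<Sum>z\<in>Z. p z) = 1"
      and approx: "\<forall>j<n. \<forall>l<n.
       \<bar>(LINT x:K|leb n. x j * x l) / vol n K - (\<Sum>z\<in>Z. p z * (y z j * y z l))\<bar> \<le> 2 * R / k"
      by (rule discretization[OF k])
    define \<eta> where "\<eta> = 2 * R / k"
    \<comment> \<open>The defect of the sampled covariance: adding back \<open>E\<close> plus n
      \<eta> times the identity leaves exactly a scalar matrix.\<close>
    define E where "E j l = (if j = l then \<mu> else 0) - (\<Sum>z\<in>Z. p z * (y z j * y z l))" for j l
    have \<eta>: "0 \<le> \<eta>" using R_pos by (simp add: \<eta>_def)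
    have "\<bar>E j l\<bar> \<le> \<eta>" if "j < n" "l < n" for j l
      using approx[rule_format, OF that] second_moment[OF iso that] by (simp add: E_def \<mu>_def \<eta>_def split: if_splits)
    hence d2: "decomposable (\<lambda>j l. E j l + (if j = l then n * \<eta> else 0)) (3 * (real n)\<^sup>2 / r\<^sup>2 * \<eta>)"
      by (intro decomposable_perturbation) (auto simp: E_def mult_ac)
    have d1: "decomposable (\<lambda>j l. \<Sum>z\<in>Z. p z * (y z j * y z l)) (\<Sum>z\<in>Z. p z * (N (y z))\<^sup>2)"
      using Z K_Rn by (intro decomposable_sum decomposable_single) auto
    have "(\<Sum>z\<in>Z. p z * (N (y z))\<^sup>2) \<le> (\<Sum>z\<in>Z. p z * 1)"
      using Z K_Rn body_norm_le_1 body_norm_nonneg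
      by (intro sum_mono mult_left_mono) (auto simp: power_le_one)
    hence cost: "(\<Sum>z\<in>Z. p z * (N (y z))\<^sup>2) + 3 * (real n)\<^sup>2 / r\<^sup>2 * \<eta> \<le> 1 + 3 * (real n)\<^sup>2 / r\<^sup>2 * \<eta>"
      using Z(4) by simp
    have "decomposable (\<lambda>j l. if j = l then \<mu> + n * \<eta> else 0) (1 + 3 * (real n)\<^sup>2 / r\<^sup>2 * \<eta>)"
      by (rule decomposable_cong[OF decomposable_add[OF d1 d2] _ cost]) (simp add: E_def)
    hence "(\<mu> + n * \<eta>) * G \<le> T * (1 + 3 * (real n)\<^sup>2 / r\<^sup>2 * \<eta>)"
      unfolding G_def T_def by (rule decomposable_scalar) (use \<mu> \<eta> in \<open>simp add: add_pos_nonneg\<close>)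
    \<comment> \<open>The surplus on the diagonal is simply dropped, since it stands on the smaller
      side of the inequality.\<close>
    moreover have "\<mu> * G \<le> (\<mu> + n * \<eta>) * G" using G \<eta> by (intro mult_right_mono) auto
    ultimately show ?thesis by (simp add: \<eta>_def algebra_simps)
  qed
  \<comment> \<open>Refining the grid removes the cost of the repair, and with it \<open>r\<close>
    and \<open>R\<close>.\<close>
  have "(\<lambda>k. T + T * (3 * (real n)\<^sup>2 / r\<^sup>2) * (2 * R / real k)) \<longlonglongrightarrow> T + T * (3 * (real n)\<^sup>2 / r\<^sup>2) * 0"
    by (intro tendsto_intros lim_const_over_n)
  hence "\<mu> * G \<le> T + T * (3 * (real n)\<^sup>2 / r\<^sup>2) * 0"
    by (rule LIMSEQ_le_const) (use bound in \<open>auto intro!: exI[of _ 1]\<close>)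
  thus ?thesis using M2_square(1) n_pos by (simp add: G_def T_def \<mu>_def)
qed

end

section \<open>The isotropic constant\<close>

text \<open>Homogeneity extends preservation of length from the sphere to all vectors, and
  polarization turns it into preservation of inner products.\<close>

lemma orthogonal_RnI:
  assumes lin: "linear_Rn n U"
    and norm: "\<And>\<theta>. \<theta> \<in> unit_sphere n \<Longrightarrow> dotp n (U \<theta>) (U \<theta>) = 1"
  shows "orthogonal_Rn n U"
proof -
  have len: "dotp n (U x) (U x) = dotp n x x" if x: "x \<in> Rn n" for x
  proof (cases "dotp n x x = 0")
    case True
    have "x = vscale n 0 x" by (rule Rn_eqI[of _ n]) (use x dotp_self_eq_0[OF True] in auto)
    hence "U x = vscale n 0 (U x)" using linear_RnD(3)[OF lin x] by metis
    hence "dotp n (U x) (U x) = 0" by (metis dotp_vscale(1) mult_zero_left)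
    thus ?thesis using True by simp
  next
    case False
    define s where "s = sqrt (dotp n x x)"
    have s: "s \<noteq> 0" "s * s = dotp n x x" using False by (simp_all add: s_def)
    have "vscale n (1 / s) x \<in> unit_sphere n" using s False by (simp add: unit_sphere_def)
    from norm[OF this] have "1 / s * (1 / s * dotp n (U x) (U x)) = 1"
      by (simp only: linear_RnD(3)[OF lin x] dotp_vscale)
    hence "dotp n (U x) (U x) = s * s" using s(1) by (simp add: divide_eq_eq)
    thus ?thesis using s(2) by linarith
  qed
  have "dotp n (U x) (U y) = dotp n x y" if x: "x \<in> Rn n" and y: "y \<in> Rn n" for x y
  proof -
    have "dotp n (U (vadd n x y)) (U (vadd n x y)) = dotp n (vadd n x y) (vadd n x y)"
      by (rule len) simp
    thus ?thesis
      using len[OF x] len[OF y]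
      by (simp add: linear_RnD(2)[OF lin x y] dotp_commute[of n "U y" "U x"] dotp_commute[of n y x])
  qed
  thus ?thesis using lin by (simp add: orthogonal_Rn_def)
qed

context star_body
begin

lemma vol_linear_image:
  assumes TS: "linear_inverses n T S" and d: "distr (leb n) (leb n) S = density (leb n) (\<lambda>_. ennreal d)"
    and d0: "0 \<le> d"
  shows "vol n (T ` K) = d * vol n K"
  using emeasure_linear_image[OF TS d K_sets] d0 by (simp add: vol_def measure_def enn2real_mult)

text \<open>
  If \<open>T ` K\<close> is again isotropic, then the transpose of \<open>T\<close> scales all lengths by one factor \<open>t\<close>,
  so \<open>T\<close> is \<open>t\<close> times an orthogonal map and the volume determines \<open>t\<close>.
\<close>
lemma isotropic_constant_eq:
  assumes iso: "\<And>\<theta>. \<theta> \<in> unit_sphere n \<Longrightarrow> (LINT x:K|leb n. (dotp n x \<theta>)\<^sup>2) = c"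
    and s: "0 < s" "s ^ n * vol n K = 1"
  shows "isotropic_constant n K = s * sqrt (c / vol n K)"
  unfolding isotropic_constant_def
proof (rule the_equality)
  define V where "V = vol n K"
  have V: "0 < V" using emeasure_K by (simp add: V_def)
  have c: "0 < c" by (rule second_moment_pos[OF iso])
  have sV: "s ^ n = 1 / V" using s V by (simp add: V_def field_simps)
  have dm: "(\<lambda>x. (dotp n x \<theta>)\<^sup>2) \<in> borel_measurable (leb n)" if "\<theta> \<in> Rn n" for \<theta>
    using that by (intro borel_measurable_power dotp_measurable) simp_all
  have sphereR: "\<theta> \<in> Rn n" if "\<theta> \<in> unit_sphere n" for \<theta> using that by (simp add: unit_sphere_def)
  let ?P = "\<lambda>L T. invertible_linear_Rn n T \<and> vol n (T ` K) = 1 \<and> isotropic_position n (T ` K) \<and>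
          (\<forall>\<theta>\<in>unit_sphere n. (LINT x:T ` K|leb n. (dotp n x \<theta>)\<^sup>2) = L\<^sup>2)"
  have TS: "linear_inverses n (vscale n s) (vscale n (1 / s))"
    using s by (intro vscale_linear_inverses) simp
  have m: "(LINT x:vscale n s ` K|leb n. (dotp n x \<theta>)\<^sup>2) = (s * sqrt (c / V))\<^sup>2"
    if \<theta>: "\<theta> \<in> unit_sphere n" for \<theta>
  proof -
    have "(LINT x:vscale n s ` K|leb n. (dotp n x \<theta>)\<^sup>2)
        = s ^ n * (LINT x:K|leb n. (dotp n (vscale n s x) \<theta>)\<^sup>2)"
      by (rule integral_linear_image[OF TS distr_leb_vscale[OF s(1)] _ K_sets dm[OF sphereR[OF \<theta>]]])
        (use s in simp)
    also have "\<dots> = s ^ n * (s\<^sup>2 * c)"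
      using iso[OF \<theta>] by (simp add: power_mult_distrib)
    also have "\<dots> = (s * sqrt (c / V))\<^sup>2"
      using c V by (simp add: sV power_mult_distrib)
    finally show ?thesis .
  qed
  have "?P (s * sqrt (c / V)) (vscale n s)"
  proof (intro conjI ballI m)
    show "invertible_linear_Rn n (vscale n s)" by (rule linear_inverses_bij[OF TS])
    show "vol n (vscale n s ` K) = 1"
      using vol_linear_image[OF TS distr_leb_vscale[OF s(1)]] s by simp
    show "isotropic_position n (vscale n s ` K)"
      unfolding isotropic_position_def using m by blast
  qed
  moreover have "0 < s * sqrt (c / V)" using s c V by simp
  ultimately show "0 < s * sqrt (c / vol n K) \<and> (\<exists>T. ?P (s * sqrt (c / vol n K)) T)"
    unfolding V_def by blast
  fix L assume "0 < L \<and> (\<exists>T. ?P L T)"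
  then obtain T where L: "0 < L" and inv: "invertible_linear_Rn n T" and vol1: "vol n (T ` K) = 1"
    and isoL: "\<forall>\<theta>\<in>unit_sphere n. (LINT x:T ` K|leb n. (dotp n x \<theta>)\<^sup>2) = L\<^sup>2" by blast
  obtain S where TS': "linear_inverses n T S" using invertible_linear_inverses[OF inv] .
  note Tlin = linear_inversesD(1)[OF TS']
  obtain d where d: "0 \<le> d" "distr (leb n) (leb n) S = density (leb n) (\<lambda>_. ennreal d)"
    using distr_leb_linear[OF TS'] .
  have dV: "d = 1 / V" using vol_linear_image[OF TS' d(2) d(1)] vol1 V by (simp add: V_def field_simps)
  \<comment> \<open>Changing variables turns isotropy of the image into L^2 = (c / V) times the
    squared length of the transpose at any unit vector, so this length can only be
    \<open>t\<close>.\<close>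
  define t where "t = L * sqrt (V / c)"
  have t: "0 < t" using L V c by (simp add: t_def)
  define U where "U y = vscale n (1 / t) (transpose_Rn n T y)" for y
  have Ulin: "linear_Rn n U"
    using linear_transpose[of n T] unfolding U_def linear_Rn_def
    by (auto simp: algebra_simps intro!: Rn_eqI[of _ n])
  have Uorth: "orthogonal_Rn n U"
  proof (rule orthogonal_RnI[OF Ulin])
    fix \<theta> assume \<theta>: "\<theta> \<in> unit_sphere n"
    let ?u = "transpose_Rn n T \<theta>"
    have u: "?u \<in> Rn n" by (simp add: transpose_Rn_def)
    have "L\<^sup>2 = (LINT x:T ` K|leb n. (dotp n x \<theta>)\<^sup>2)" using isoL \<theta> by simp
    also have "\<dots> = d * (LINT x:K|leb n. (dotp n (T x) \<theta>)\<^sup>2)"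
      by (rule integral_linear_image[OF TS' d(2) d(1) K_sets dm[OF sphereR[OF \<theta>]]])
    also have "(LINT x:K|leb n. (dotp n (T x) \<theta>)\<^sup>2) = (LINT x:K|leb n. (dotp n x ?u)\<^sup>2)"
      unfolding set_lebesgue_integral_def
      by (rule Bochner_Integration.integral_cong) (auto simp: dotp_transpose[OF Tlin])
    also have "\<dots> = c * dotp n ?u ?u" by (rule second_moment_dotp[OF iso u])
    finally have "L\<^sup>2 * V / c = dotp n ?u ?u" using V c by (simp add: dV field_simps)
    moreover have "L\<^sup>2 * V / c = t * t"
      using V c by (simp add: t_def power2_eq_square algebra_simps)
    ultimately have "dotp n ?u ?u = t * t" by simp
    thus "dotp n (U \<theta>) (U \<theta>) = 1" using t by (simp add: U_def)
  qed
  obtain A B where AB: "orthogonal_inverses n A B" and UA: "\<And>x. x \<in> Rn n \<Longrightarrow> U x = A x"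
    using orthogonal_RnE[OF Uorth] by blast
  note BA = orthogonal_inverses_sym[OF AB]
  \<comment> \<open>The rescaled transpose agrees with the orthogonal map \<open>A\<close>; its
    adjoint \<open>B\<close> therefore gives \<open>T\<close> itself up to the factor
    \<open>t\<close>.\<close>
  have TB: "T x = vscale n t (B x)" if x: "x \<in> Rn n" for x
  proof (rule Rn_eqI[of _ n])
    fix j assume j: "j < n"
    have "T x j = dotp n (T x) (unit_vec n j)" using j by simp
    also have "\<dots> = dotp n x (transpose_Rn n T (unit_vec n j))" by (rule dotp_transpose[OF Tlin x])
    also have "\<dots> = t * dotp n x (U (unit_vec n j))" using t by (simp add: U_def)
    also have "\<dots> = t * dotp n (B x) (unit_vec n j)"
      using orthogonal_inverses_dotp[OF BA x unit_vec_Rn] by (simp add: UA)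
    finally show "T x j = vscale n t (B x) j" using j by simp
  qed (use x linear_RnD(1)[OF Tlin] in auto)
  have "T ` K = vscale n t ` (B ` K)"
    unfolding image_image using TB K_Rn by (intro image_cong) auto
  moreover have TSt: "linear_inverses n (vscale n t) (vscale n (1 / t))"
    using t by (intro vscale_linear_inverses) simp
  moreover have BK: "emeasure (leb n) (B ` K) = emeasure (leb n) K"
    using emeasure_linear_image[OF orthogonal_inversesD(1)[OF BA] _ K_sets, of 1]
    by (simp add: distr_leb_orthogonal[OF AB] density_1)
  ultimately have "emeasure (leb n) (T ` K) = ennreal (t ^ n) * emeasure (leb n) K"
    using emeasure_linear_image[OF TSt distr_leb_vscale[OF t]
        linear_image_sets[OF orthogonal_inversesD(1)[OF BA] K_sets]] by simp
  hence "t ^ n * V = 1" using vol1 t by (simp add: vol_def measure_def enn2real_mult V_def)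
  hence "t ^ n = s ^ n" using V by (simp add: sV field_simps)
  hence "t = s" using t s n_pos by (metis less_eq_real_def power_eq_imp_eq_base)
  thus "L = s * sqrt (c / vol n K)"
    using V c by (simp add: t_def V_def[symmetric] real_sqrt_divide field_simps)
qed

text \<open>The dimension cancels: the rescaling \<open>s\<close> to volume 1 contributes at most
  sqrt n / 2, and the type-2 estimate supplies the matching sqrt n next to \<open>M2\<close>. What
  remains is the constant 1/2.\<close>

lemma isotropic_constant_bound:
  assumes iso: "\<And>\<theta>. \<theta> \<in> unit_sphere n \<Longrightarrow> (LINT x:K|leb n. (dotp n x \<theta>)\<^sup>2) = c"
    and vol: "vol n K = vol n (unit_ball n)"
  shows "isotropic_constant n K \<le> 1 / 2 * (type2_constant n N / M2 n K)"
proof -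
  define V where "V = vol n K"
  define s where "s = root n (1 / V)"
  have V: "0 < V" using emeasure_K by (simp add: V_def)
  have c: "0 < c" by (rule second_moment_pos[OF iso])
  have s: "0 < s" "s ^ n = 1 / V" using V n_pos by (simp_all add: s_def)
  have Vball: "(2 / sqrt n) ^ n \<le> V"
    using emeasure_unit_ball[of n] V
    by (simp add: V_def vol) (simp add: vol_def emeasure_eq_ennreal_measure less_top)
  have "s ^ n \<le> (sqrt n / 2) ^ n"
  proof -
    have "1 / V \<le> 1 / (2 / sqrt n) ^ n" using Vball n_pos by (intro divide_left_mono mult_pos_pos V) auto
    thus ?thesis using s by (simp add: power_divide)
  qed
  hence "s \<le> sqrt n / 2" using s n_pos by (metis divide_nonneg_pos power_mono_iff less_imp_le real_sqrt_ge_0_iff of_nat_0_le_iff zero_less_numeral)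
  have "(sqrt (c / V) * sqrt n * M2 n K)\<^sup>2 \<le> (type2_constant n N)\<^sup>2"
    using type2_lower_bound[OF iso] c V by (simp add: power_mult_distrib V_def[symmetric] mult_ac)
  hence T: "sqrt (c / V) * sqrt n * M2 n K \<le> type2_constant n N"
    by (rule power2_le_imp_le) (use valid_type2_ge_1[OF type2_constant_valid] in linarith)
  have "isotropic_constant n K = s * sqrt (c / V)"
    unfolding V_def by (rule isotropic_constant_eq[OF iso s(1)]) (use s V in \<open>simp_all add: V_def\<close>)
  also have "\<dots> \<le> sqrt n / 2 * sqrt (c / V)"
    using \<open>s \<le> sqrt n / 2\<close> c V by (intro mult_right_mono) auto
  also have "\<dots> \<le> 1 / 2 * (type2_constant n N / M2 n K)"
    using T M2_square(2) by (simp add: field_simps)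
  finally show ?thesis .
qed

end

theorem theorem1:
  "\<exists>C::real. 0 < C \<and>
     (\<forall>(n::nat) (K::(nat \<Rightarrow> real) set).
        1 \<le> n \<and> convex_body n K \<and> centrally_symmetric n K \<and> isotropic_position n K \<and>
        vol n K = vol n (unit_ball n) \<longrightarrow>
        isotropic_constant n K \<le> C * (type2_constant n (body_norm n K) / M2 n K))"
proof (intro exI[of _ "1/2"] conjI allI impI)
  fix n :: nat and K :: "(nat \<Rightarrow> real) set"
  assume h: "1 \<le> n \<and> convex_body n K \<and> centrally_symmetric n K \<and> isotropic_position n K \<and>
        vol n K = vol n (unit_ball n)"
  hence n: "0 < n" by simp
  obtain r R where "star_body n K r R"
    using convex_body_star_body[OF n, of K] h by blast
  then interpret star_body n K r R .
  obtain c where "\<forall>\<theta>\<in>unit_sphere n. (LINT x:K|leb n. (dotp n x \<theta>)\<^sup>2) = c"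
    using h unfolding isotropic_position_def by blast
  thus "isotropic_constant n K \<le> 1 / 2 * (type2_constant n (body_norm n K) / M2 n K)"
    using h by (intro isotropic_constant_bound[of c]) auto
qed simp

end
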